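(* Let $F>0$, $\nu>0$, and let $\bar U=(\bar\tau,\bar u)$ be the profile of a nonconstant periodic traveling wave, with speed $c\in\mathbb{R}$ and fundamental period $\Xi$, of the St. Venant system $\partial_t \tau-\partial_x u=0$, $\partial_t u+\partial_x\big(\frac{\tau^{-2}}{2F^2}\big)=1-\tau u^2+\nu\,\partial_x(\tau^{-2}\partial_x u)$. Let $L_\xi$, $\xi\in[-\pi/\Xi,\pi/\Xi)$, be the Bloch symbols of the linearized operator about $\bar U$ (see context). Then for any positive integer $s$ there exist positive constants $\eta$, $C$ and $R$ such that if $\lambda\in\mathbb{C}$ satisfies $|\lambda|\ge R$ and $\Re(\lambda)\ge-\eta$, then for any $\xi\in[-\pi/\Xi,\pi/\Xi)$ $$\lambda\notin\sigma_{H^s_{per}(0,\Xi)}(L_\xi)\qquad\text{and}\qquad \|(\lambda-L_\xi)^{-1}\|_{H^s_\xi\to H^s_\xi}\le C .$$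
   Context: Profile. $\bar U=(\bar\tau,\bar u):\mathbb{R}\to(0,\infty)\times\mathbb{R}$ is smooth, nonconstant, periodic with fundamental period $\Xi>0$, and satisfies $-c\bar\tau_x-\bar u_x=0$ and $-c\bar u_x+((2F^2)^{-1}\bar\tau^{-2})_x=1-\bar\tau\bar u^2+\nu(\bar\tau^{-2}\bar u_x)_x$. Linearized operator. $L$ is the generator of the linearization about $\bar U$ of the system written in the co-moving coordinate $x-ct$: for $U=(\tau,u)$, $$L U=\Big(c\tau_x+u_x,\;\; c u_x+(\alpha\tau)_x+\nu(\bar\tau^{-2}u_x)_x-\bar u^2\tau-2\bar u\bar\tau u\Big),\qquad \alpha:=\bar\tau^{-3}(F^{-2}-2\nu\bar u_x).$$ Bloch symbols. For $\xi\in[-\pi/\Xi,\pi/\Xi)$, $L_\xi:=e^{-i\xi\cdot}Le^{i\xi\cdot}$ (i.e. $\partial_x$ is replaced by $\partial_x+i\xi$ in $L$), acting on complex-valued $\Xi$-periodic functions. $\sigma_{H^s_{per}(0,\Xi)}(L_\xi)$ denotes the spectrum of $L_\xi$ as an unbounded operator on $H^s_{per}(0,\Xi)$ (pairs of $\Xi$-periodic functions of Sobolev regularity $H^s$), with its natural domain. The space $H^s_{per}(0,\Xi)$ is equipped with the equivalent norm $$\|f\|_{H^s_\xi}=\Big(\sum_{k=0}^s\|(\partial_x+i\xi)^kf\|_{L^2(0,\Xi)}^2\Big)^{1/2},$$ and $\|\cdot\|_{H^s_\xi\to H^s_\xi}$ is the associated operator norm. *)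

theory Defs
  imports "HOL-Analysis.Analysis"
begin

section \<open>Profiles of periodic traveling waves\<close>

definition smooth :: "(real \<Rightarrow> 'a::real_normed_vector) \<Rightarrow> bool" where
  "smooth f \<longleftrightarrow>
     (\<exists>D :: nat \<Rightarrow> real \<Rightarrow> 'a. D 0 = f \<and>
        (\<forall>n x. (D n has_vector_derivative D (Suc n) x) (at x)))"

definition periodic :: "real \<Rightarrow> (real \<Rightarrow> 'a) \<Rightarrow> bool" where
  "periodic \<Xi> f \<longleftrightarrow> (\<forall>x. f (x + \<Xi>) = f x)"

definition st_venant_profile ::
    "real \<Rightarrow> real \<Rightarrow> real \<Rightarrow> real \<Rightarrow> (real \<Rightarrow> real) \<Rightarrow> (real \<Rightarrow> real) \<Rightarrow> bool" where
  "st_venant_profile F \<nu> c \<Xi> \<tau>b ub \<longleftrightarrow>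
     smooth \<tau>b \<and> smooth ub \<and> (\<forall>x. \<tau>b x > 0) \<and>
     \<not> (\<exists>a b. \<forall>x. \<tau>b x = a \<and> ub x = b) \<and>
     \<Xi> > 0 \<and> periodic \<Xi> \<tau>b \<and> periodic \<Xi> ub \<and>
     (\<forall>T. 0 < T \<and> T < \<Xi> \<longrightarrow> \<not> (periodic T \<tau>b \<and> periodic T ub)) \<and>
     (\<forall>x. - c * deriv \<tau>b x - deriv ub x = 0) \<and>
     (\<forall>x. - c * deriv ub x + deriv (\<lambda>y. 1 / (2 * F\<^sup>2) * (1 / (\<tau>b y)\<^sup>2)) x
          = 1 - \<tau>b x * (ub x)\<^sup>2 + \<nu> * deriv (\<lambda>y. deriv ub y / (\<tau>b y)\<^sup>2) x)"


section \<open>Periodic Sobolev spaces\<close>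

text \<open>
  Elements of $L^2$ and $H^s$ are represented by functions on the line (Borel measurable and
  everywhere periodic); two of them are the same element iff they agree almost everywhere.
\<close>

definition L2_per :: "real \<Rightarrow> (real \<Rightarrow> complex) set" where
  "L2_per \<Xi> = {f. f \<in> borel_measurable borel \<and> periodic \<Xi> f \<and>
                   set_integrable lborel {0..\<Xi>} (\<lambda>x. (cmod (f x))\<^sup>2)}"

definition L2_norm :: "real \<Rightarrow> (real \<Rightarrow> complex) \<Rightarrow> real" where
  "L2_norm \<Xi> f = sqrt (LBINT x:{0..\<Xi>}. (cmod (f x))\<^sup>2)"

text \<open>Weak differentiation on the circle of length $\Xi$: test functions are smooth and periodic.\<close>

definition has_weak_deriv :: "real \<Rightarrow> (real \<Rightarrow> complex) \<Rightarrow> (real \<Rightarrow> complex) \<Rightarrow> bool" where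
  "has_weak_deriv \<Xi> f g \<longleftrightarrow> f \<in> L2_per \<Xi> \<and> g \<in> L2_per \<Xi> \<and>
     (\<forall>\<phi> :: real \<Rightarrow> complex. smooth \<phi> \<and> periodic \<Xi> \<phi> \<longrightarrow>
        (LBINT x:{0..\<Xi>}. f x * vector_derivative \<phi> (at x)) = - (LBINT x:{0..\<Xi>}. g x * \<phi> x))"

text \<open>The weak derivative is determined up to null sets only; any choice will do below.\<close>

definition weak_deriv :: "real \<Rightarrow> (real \<Rightarrow> complex) \<Rightarrow> (real \<Rightarrow> complex)" where
  "weak_deriv \<Xi> f = (SOME g. has_weak_deriv \<Xi> f g)"

fun H_per :: "real \<Rightarrow> nat \<Rightarrow> (real \<Rightarrow> complex) set" where
  "H_per \<Xi> 0 = L2_per \<Xi>"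
| "H_per \<Xi> (Suc s) = {f \<in> L2_per \<Xi>. \<exists>g \<in> H_per \<Xi> s. has_weak_deriv \<Xi> f g}"

definition bloch_deriv :: "real \<Rightarrow> real \<Rightarrow> (real \<Rightarrow> complex) \<Rightarrow> (real \<Rightarrow> complex)" where
  "bloch_deriv \<Xi> \<xi> f = (\<lambda>x. weak_deriv \<Xi> f x + \<i> * of_real \<xi> * f x)"

type_synonym state = "(real \<Rightarrow> complex) \<times> (real \<Rightarrow> complex)"

definition state_norm :: "real \<Rightarrow> real \<Rightarrow> nat \<Rightarrow> state \<Rightarrow> real" where
  "state_norm \<Xi> \<xi> s U = sqrt (\<Sum>k\<le>s.
      (L2_norm \<Xi> ((bloch_deriv \<Xi> \<xi> ^^ k) (fst U)))\<^sup>2 +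
      (L2_norm \<Xi> ((bloch_deriv \<Xi> \<xi> ^^ k) (snd U)))\<^sup>2)"

definition state_space :: "real \<Rightarrow> nat \<Rightarrow> state set" where
  "state_space \<Xi> s = H_per \<Xi> s \<times> H_per \<Xi> s"

definition state_eq :: "state \<Rightarrow> state \<Rightarrow> bool" where
  "state_eq U V \<longleftrightarrow> (AE x in lborel. fst U x = fst V x \<and> snd U x = snd V x)"


section \<open>The Bloch symbols, their spectra and resolvents\<close>

definition alpha ::
    "real \<Rightarrow> real \<Rightarrow> (real \<Rightarrow> real) \<Rightarrow> (real \<Rightarrow> real) \<Rightarrow> real \<Rightarrow> real" where
  "alpha F \<nu> \<tau>b ub x = (1 / F\<^sup>2 - 2 * \<nu> * deriv ub x) / (\<tau>b x) ^ 3"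

definition bloch_op ::
    "real \<Rightarrow> real \<Rightarrow> real \<Rightarrow> real \<Rightarrow> (real \<Rightarrow> real) \<Rightarrow> (real \<Rightarrow> real) \<Rightarrow> real \<Rightarrow> state \<Rightarrow> state" where
  "bloch_op F \<nu> c \<Xi> \<tau>b ub \<xi> = (\<lambda>(\<tau>, u).
     let D = bloch_deriv \<Xi> \<xi> in
     ((\<lambda>x. of_real c * D \<tau> x + D u x),
      (\<lambda>x. of_real c * D u x
          + D (\<lambda>y. of_real (alpha F \<nu> \<tau>b ub y) * \<tau> y) x
          + of_real \<nu> * D (\<lambda>y. of_real (1 / (\<tau>b y)\<^sup>2) * D u y) x
          - of_real ((ub x)\<^sup>2) * \<tau> x
          - of_real (2 * ub x * \<tau>b x) * u x)))"

text \<open>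
  The natural domain of the Bloch symbol on $H^s \times H^s$. A nonconstant profile has
  $c \neq 0$, and then this is also the maximal domain, i.e. the set of $U \in H^s \times H^s$
  whose image in the sense of distributions lies in $H^s \times H^s$.
\<close>

definition bloch_dom :: "real \<Rightarrow> nat \<Rightarrow> state set" where
  "bloch_dom \<Xi> s = H_per \<Xi> (s + 1) \<times> H_per \<Xi> (s + 2)"

definition shifted_op :: "(state \<Rightarrow> state) \<Rightarrow> complex \<Rightarrow> state \<Rightarrow> state" where
  "shifted_op A z U = ((\<lambda>x. z * fst U x - fst (A U) x), (\<lambda>x. z * snd U x - snd (A U) x))"

definition resolvent_op :: "state set \<Rightarrow> (state \<Rightarrow> state) \<Rightarrow> complex \<Rightarrow> state \<Rightarrow> state" where
  "resolvent_op Dom A z V = (SOME U. U \<in> Dom \<and> state_eq (shifted_op A z U) V)"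

definition op_norm :: "state set \<Rightarrow> (state \<Rightarrow> real) \<Rightarrow> (state \<Rightarrow> state) \<Rightarrow> ereal" where
  "op_norm X N T = (SUP V \<in> {V \<in> X. N V \<le> 1}. ereal (N (T V)))"

text \<open>
  Spectrum of an operator \<open>A\<close> with domain \<open>Dom\<close> on the space \<open>X\<close> with norm \<open>N\<close>: the complement
  of the set of \<open>z\<close> such that \<open>z - A\<close> maps \<open>Dom\<close> bijectively onto \<open>X\<close> (modulo almost everywhere
  equality) with bounded inverse.
\<close>

definition resolvent_set ::
    "state set \<Rightarrow> (state \<Rightarrow> real) \<Rightarrow> state set \<Rightarrow> (state \<Rightarrow> state) \<Rightarrow> complex set" where
  "resolvent_set X N Dom A = {z.
     (\<forall>U\<in>Dom. \<forall>U'\<in>Dom. state_eq (shifted_op A z U) (shifted_op A z U') \<longrightarrow> state_eq U U') \<and>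
     (\<forall>V\<in>X. \<exists>U\<in>Dom. state_eq (shifted_op A z U) V) \<and>
     op_norm X N (resolvent_op Dom A z) < \<infinity>}"

definition spectrum ::
    "state set \<Rightarrow> (state \<Rightarrow> real) \<Rightarrow> state set \<Rightarrow> (state \<Rightarrow> state) \<Rightarrow> complex set" where
  "spectrum X N Dom A = - resolvent_set X N Dom A"

definition bloch_spectrum ::
    "real \<Rightarrow> real \<Rightarrow> real \<Rightarrow> real \<Rightarrow> (real \<Rightarrow> real) \<Rightarrow> (real \<Rightarrow> real) \<Rightarrow> nat \<Rightarrow> real \<Rightarrow> complex set" where
  "bloch_spectrum F \<nu> c \<Xi> \<tau>b ub s \<xi> =
     spectrum (state_space \<Xi> s) (state_norm \<Xi> \<xi> s) (bloch_dom \<Xi> s) (bloch_op F \<nu> c \<Xi> \<tau>b ub \<xi>)"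

definition bloch_resolvent ::
    "real \<Rightarrow> real \<Rightarrow> real \<Rightarrow> real \<Rightarrow> (real \<Rightarrow> real) \<Rightarrow> (real \<Rightarrow> real) \<Rightarrow> nat \<Rightarrow> real \<Rightarrow>
     complex \<Rightarrow> state \<Rightarrow> state" where
  "bloch_resolvent F \<nu> c \<Xi> \<tau>b ub s \<xi> = resolvent_op (bloch_dom \<Xi> s) (bloch_op F \<nu> c \<Xi> \<tau>b ub \<xi>)"

end

theory Submission
  imports Defs
begin

text \<open>
  For \<open>(\<lambda> - L\<^sub>\<xi>)(\<tau>, u) = (f, g)\<close> write \<open>D\<close> for the Bloch derivative and introduce the flux
  \<open>w = \<alpha> \<tau> + \<nu> \<tau>b\<^sup>-\<^sup>2 D u\<close>. Then \<open>\<tau>\<close> solves \<open>\<lambda> \<tau> - c D \<tau> + a \<tau> = f + b w\<close>, where \<open>a\<close> has the positive mean \<open>m\<close> of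
  \<open>1 / (\<nu> F\<^sup>2 \<tau>b)\<close>; a periodic weight makes \<open>a\<close> constant, so for \<open>Re \<lambda> \<ge> - m / 2\<close> the norm of \<open>\<tau>\<close> is controlled
  by those of \<open>f\<close> and \<open>w\<close>. In turn \<open>w\<close> and \<open>u\<close> satisfy heat-type resolvent equations with data of order zero
  in \<open>\<lambda>\<close>, hence have norms of size \<open>|\<lambda>|\<^sup>-\<^sup>1\<^sup>/\<^sup>2\<close> times the norms of the unknowns and data, and are absorbed for large \<open>|\<lambda>|\<close>.
  Differentiating the system gives the same bound in all Sobolev norms. Existence follows from uniqueness,
  as the resolvent equation is a linear periodic first order system of ordinary differential
  equations (here \<open>c \<noteq> 0\<close> enters).
\<close>

section \<open>Smooth functions\<close>

text \<open>Viscosity smooths \<open>u\<close> only, and \<open>D u\<close> is not small for large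
  |\<lambda>|, so the first equation cannot simply treat it as a source for \<tau>. Trading it for
  the flux produces the damping: \<open>D u = b w - a \<tau>\<close>, the part
  \<open>- a \<tau>\<close> moves to the left side, and what remains, \<open>b w\<close>, is small.
  The gap \<eta> is half the mean: \<open>m / 2\<close>.

  The constants must not depend on \<xi>. To this end all estimates are written with the Bloch
  derivative \<open>D\<close>: for every real \<xi> it is skew-adjoint in the square-integrable
  setting, and its commutator with a coefficient \<open>p\<close> is multiplication by
  \<open>deriv p\<close>, so \<xi> never enters a bound.

  Existence is a Fredholm alternative: the monodromy map minus the identity acts on a
  finite-dimensional space, is injective by the a priori bound, and is therefore onto. Differential
  equations need continuous data and give classical solutions, whereas the spaces contain weakly
  differentiable functions up to null sets and \<open>weak_deriv\<close> is an arbitrary choice.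
  Much of the development passes between these two worlds.\<close>

lemmas real_vector_deriv = has_real_derivative_iff_has_vector_derivative

text \<open>Coinduction for smoothness: a choice function \<open>d\<close> picks a derivative inside
  \<open>S\<close>, and its iterates supply the sequence \<open>D\<close> in the definition of
  \<open>smooth\<close>. Later proofs only exhibit a set closed under differentiation.\<close>

lemma smoothI_closed:
  assumes f: "f \<in> S"
    and S: "\<And>g. g \<in> S \<Longrightarrow> \<exists>g'\<in>S. \<forall>x. (g has_vector_derivative g' x) (at x)"
  shows "smooth f"
proof -
  obtain d where d: "\<And>g. g \<in> S \<Longrightarrow> d g \<in> S \<and> (\<forall>x. (g has_vector_derivative d g x) (at x))"
    using S by metis
  have "(d ^^ n) f \<in> S" for n
    by (induction n) (use f d in auto)
  with d show ?thesis
    unfolding smooth_def by (intro exI[of _ "\<lambda>n. (d ^^ n) f"]) auto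
qed

lemma smooth_derivE:
  assumes "smooth f"
  obtains f' where "smooth f'" "\<And>x. (f has_vector_derivative f' x) (at x)"
proof -
  obtain D where D: "D 0 = f" "\<And>n x. (D n has_vector_derivative D (Suc n) x) (at x)"
    using assms unfolding smooth_def by blast
  have "smooth (D 1)"
    unfolding smooth_def by (rule exI[of _ "\<lambda>n. D (Suc n)"]) (use D in auto)
  with D that show thesis by (metis One_nat_def)
qed

lemma smoothI_deriv:
  assumes "smooth f'" "\<And>x. (f has_vector_derivative f' x) (at x)"
  shows "smooth f"
proof (rule smoothI_closed)
  show "f \<in> insert f (Collect smooth)" by simp
  show "\<exists>g'\<in>insert f (Collect smooth). \<forall>x. (g has_vector_derivative g' x) (at x)"
    if "g \<in> insert f (Collect smooth)" for g
    using that assms by (metis insert_iff mem_Collect_eq smooth_derivE)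
qed

lemma smooth_vector_derivative:
  assumes "smooth f"
  shows "smooth (\<lambda>x. vector_derivative f (at x))"
    and "(f has_vector_derivative vector_derivative f (at x)) (at x)"
proof -
  obtain f' where f': "smooth f'" "\<And>x. (f has_vector_derivative f' x) (at x)"
    using smooth_derivE[OF assms] by blast
  have "(\<lambda>x. vector_derivative f (at x)) = f'"
    using f'(2) by (intro ext vector_derivative_at)
  with f' show "smooth (\<lambda>x. vector_derivative f (at x))"
    and "(f has_vector_derivative vector_derivative f (at x)) (at x)" by (auto dest: fun_cong)
qed

lemma smooth_real_deriv:
  fixes f :: "real \<Rightarrow> real"
  assumes "smooth f"
  shows "smooth (deriv f)" and "(f has_real_derivative deriv f x) (at x)"
proof -
  obtain f' where f': "smooth f'" "\<And>x. (f has_real_derivative f' x) (at x)"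
    using assms smooth_derivE by (metis real_vector_deriv)
  have "deriv f = f'" using f'(2) by (intro ext DERIV_imp_deriv)
  with f' show "smooth (deriv f)" "(f has_real_derivative deriv f x) (at x)"
    by auto
qed

lemma smooth_continuous_on: "smooth f \<Longrightarrow> continuous_on A f"
  by (metis continuous_on_eq_continuous_at continuous_on_subset has_vector_derivative_continuous
      open_UNIV smooth_derivE subset_UNIV)

section \<open>Closure of smooth functions under algebraic operations, exponential and sine\<close>

lemma smooth_const [intro, simp]: "smooth (\<lambda>_. c)"
  by (rule smoothI_closed[of _ "range (\<lambda>c _. c)"]) (auto intro!: derivative_eq_intros)

text \<open>Higher derivatives of products and quotients stay in such an algebra, so closure under
  differentiation takes the place of Leibniz formulas of every order.\<close>

inductive_set fun_alg :: "(real \<Rightarrow> 'a::real_normed_algebra) set \<Rightarrow> (real \<Rightarrow> 'a) set"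
  for G where
  base: "f \<in> G \<Longrightarrow> f \<in> fun_alg G"
| add: "f \<in> fun_alg G \<Longrightarrow> g \<in> fun_alg G \<Longrightarrow> (\<lambda>x. f x + g x) \<in> fun_alg G"
| mult: "f \<in> fun_alg G \<Longrightarrow> g \<in> fun_alg G \<Longrightarrow> (\<lambda>x. f x * g x) \<in> fun_alg G"

lemma smooth_fun_alg:
  assumes G: "\<And>g. g \<in> G \<Longrightarrow> \<exists>g'\<in>fun_alg G. \<forall>x. (g has_vector_derivative g' x) (at x)"
    and f: "f \<in> fun_alg G"
  shows "smooth f"
proof (rule smoothI_closed[OF f])
  fix g assume "g \<in> fun_alg G"
  then show "\<exists>g'\<in>fun_alg G. \<forall>x. (g has_vector_derivative g' x) (at x)"
  proof induction
    case (base f) then show ?case by (rule G)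
  next
    case (add f g)
    then obtain f' g' where "f' \<in> fun_alg G" "g' \<in> fun_alg G"
      "\<And>x. (f has_vector_derivative f' x) (at x)" "\<And>x. (g has_vector_derivative g' x) (at x)"
      by blast
    then show ?case
      by (intro bexI[of _ "\<lambda>x. f' x + g' x"] allI has_vector_derivative_add fun_alg.add)
  next
    case (mult f g)
    then obtain f' g' where "f' \<in> fun_alg G" "g' \<in> fun_alg G"
      "\<And>x. (f has_vector_derivative f' x) (at x)" "\<And>x. (g has_vector_derivative g' x) (at x)"
      by blast
    with mult show ?case
      by (intro bexI[of _ "\<lambda>x. f x * g' x + f' x * g x"] allI has_vector_derivative_mult
          fun_alg.add fun_alg.mult)
  qed
qed

lemma smooth_generators:
  fixes g :: "real \<Rightarrow> 'a::real_normed_algebra"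
  assumes "smooth g" "Collect smooth \<subseteq> G"
  shows "\<exists>g'\<in>fun_alg G. \<forall>x. (g has_vector_derivative g' x) (at x)"
  using smooth_derivE[OF assms(1)] assms(2) by (metis fun_alg.base mem_Collect_eq subsetD)

lemma smooth_add [intro]:
  fixes f g :: "real \<Rightarrow> 'a::real_normed_algebra"
  assumes "smooth f" "smooth g" shows "smooth (\<lambda>x. f x + g x)"
  by (rule smooth_fun_alg[of "Collect smooth"])
    (use assms smooth_generators in \<open>auto intro: fun_alg.intros\<close>)

lemma smooth_mult [intro]:
  fixes f g :: "real \<Rightarrow> 'a::real_normed_algebra"
  assumes "smooth f" "smooth g" shows "smooth (\<lambda>x. f x * g x)"
  by (rule smooth_fun_alg[of "Collect smooth"])
    (use assms smooth_generators in \<open>auto intro: fun_alg.intros\<close>)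

lemma smooth_minus [intro]:
  fixes f :: "real \<Rightarrow> 'a::real_normed_algebra_1"
  assumes "smooth f" shows "smooth (\<lambda>x. - f x)"
  using smooth_mult[OF smooth_const[of "-1"] assms] by simp

lemma smooth_diff [intro]:
  fixes f :: "real \<Rightarrow> 'a::real_normed_algebra_1"
  assumes "smooth f" "smooth g" shows "smooth (\<lambda>x. f x - g x)"
  using smooth_add[OF assms(1) smooth_minus[OF assms(2)]] by simp

lemma smooth_power [intro]:
  fixes f :: "real \<Rightarrow> 'a::real_normed_algebra_1"
  assumes "smooth f" shows "smooth (\<lambda>x. f x ^ n)"
  by (induction n) (use assms in auto)

lemma smooth_of_real [intro]:
  fixes f :: "real \<Rightarrow> real"
  assumes "smooth f" shows "smooth (\<lambda>x. of_real (f x) :: 'a::real_normed_algebra_1)"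
proof -
  obtain D where D: "D 0 = f" "\<And>n x. (D n has_vector_derivative D (Suc n) x) (at x)"
    using assms unfolding smooth_def by blast
  show ?thesis unfolding smooth_def
    by (rule exI[of _ "\<lambda>n x. of_real (D n x)"])
      (use D in \<open>auto intro: has_vector_derivative_of_real simp: real_vector_deriv\<close>)
qed

text \<open>For functions whose derivative is a polynomial in the function itself with smooth
  coefficients. The two uses are the reciprocal, with derivative \<open>- f' / f^2\<close>, and
  \<open>exp f\<close>, with derivative \<open>exp f * f'\<close>.\<close>

lemma smooth_if_deriv_generated:
  fixes g :: "real \<Rightarrow> 'a::real_normed_algebra"
  assumes "g' \<in> fun_alg (insert g (Collect smooth))" "\<And>x. (g has_vector_derivative g' x) (at x)"
  shows "smooth g"
proof (rule smooth_fun_alg)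
  show "g \<in> fun_alg (insert g (Collect smooth))" by (rule fun_alg.base) simp
  show "\<exists>k'\<in>fun_alg (insert g (Collect smooth)). \<forall>x. (k has_vector_derivative k' x) (at x)"
    if "k \<in> insert g (Collect smooth)" for k
    using that assms smooth_generators[of k "insert g (Collect smooth)"] by blast
qed

lemma smooth_inverse [intro]:
  fixes f :: "real \<Rightarrow> real"
  assumes f: "smooth f" and nz: "\<And>x. f x \<noteq> 0"
  shows "smooth (\<lambda>x. inverse (f x))"
proof -
  obtain f' where f': "smooth f'" "\<And>x. (f has_vector_derivative f' x) (at x)"
    using smooth_derivE[OF f] by blast
  show ?thesis
  proof (rule smooth_if_deriv_generated)
    show "(\<lambda>x. - f' x * (inverse (f x) * inverse (f x))) \<in> fun_alg (insert (\<lambda>x. inverse (f x)) (Collect smooth))"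
      using f' by (intro fun_alg.mult) (auto intro!: fun_alg.base)
    show "((\<lambda>x. inverse (f x)) has_vector_derivative - f' x * (inverse (f x) * inverse (f x))) (at x)" for x
      using f'(2) nz unfolding real_vector_deriv[symmetric]
      by (auto intro!: derivative_eq_intros simp: field_simps)
  qed
qed

lemma smooth_divide [intro]:
  fixes f g :: "real \<Rightarrow> real"
  assumes "smooth f" "smooth g" "\<And>x. g x \<noteq> 0"
  shows "smooth (\<lambda>x. f x / g x)"
  unfolding divide_inverse by (intro smooth_mult smooth_inverse assms)

lemma smooth_exp [intro]:
  fixes f :: "real \<Rightarrow> real"
  assumes f: "smooth f"
  shows "smooth (\<lambda>x. exp (f x))"
proof -
  obtain f' where f': "smooth f'" "\<And>x. (f has_vector_derivative f' x) (at x)"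
    using smooth_derivE[OF f] by blast
  show ?thesis
  proof (rule smooth_if_deriv_generated)
    show "(\<lambda>x. exp (f x) * f' x) \<in> fun_alg (insert (\<lambda>x. exp (f x)) (Collect smooth))"
      using f' by (intro fun_alg.mult) (auto intro!: fun_alg.base)
    show "((\<lambda>x. exp (f x)) has_vector_derivative exp (f x) * f' x) (at x)" for x
      using f'(2) unfolding real_vector_deriv[symmetric]
      by (auto intro!: derivative_eq_intros)
  qed
qed

lemma smooth_sin: "smooth (\<lambda>x::real. sin (k * x + m) :: real)"
proof (rule smoothI_closed)
  \<comment> \<open>Differentiation multiplies the amplitude by \<open>k\<close> and advances the
    phase by \<open>pi / 2\<close>, so this family is closed under it.\<close>
  let ?S = "range (\<lambda>(C, m) x. C * sin (k * x + m) :: real)"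
  show "(\<lambda>x. sin (k * x + m)) \<in> ?S" by (rule range_eqI[of _ _ "(1, m)"]) simp
  show "\<exists>g'\<in>?S. \<forall>x. (g has_vector_derivative g' x) (at x)" if "g \<in> ?S" for g
  proof -
    from that obtain C m where g: "g = (\<lambda>x. C * sin (k * x + m))" by auto
    have "(g has_vector_derivative (C * k) * sin (k * x + (m + pi / 2))) (at x)" for x
      unfolding g real_vector_deriv[symmetric]
      by (auto intro!: derivative_eq_intros simp: sin_add cos_add algebra_simps)
    then show ?thesis
      by (intro bexI[of _ "\<lambda>x. (C * k) * sin (k * x + (m + pi / 2))"] allI)
        (auto intro: range_eqI[of _ _ "(C * k, m + pi / 2)"])
  qed
qed

section \<open>Antiderivatives and periodic functions on the line\<close>

lemma antiderivative_on_line: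
  fixes f :: "real \<Rightarrow> 'a::euclidean_space"
  assumes "continuous_on UNIV f"
  obtains F where "F 0 = 0" "\<And>x. (F has_vector_derivative f x) (at x)"
proof -
  have "\<exists>F. \<forall>x::real. -\<infinity> < ereal x \<longrightarrow> ereal x < \<infinity> \<longrightarrow> (F has_vector_derivative f x) (at x)"
    using assms by (intro einterval_antiderivative) (auto simp: continuous_on_eq_continuous_at)
  then obtain F where F: "\<And>x. (F has_vector_derivative f x) (at x)" by auto
  show thesis
    by (rule that[of "\<lambda>x. F x - F 0"]) (use F in \<open>auto intro!: derivative_eq_intros\<close>)
qed

lemma zero_deriv_const:
  fixes f :: "real \<Rightarrow> 'a::real_normed_vector"
  assumes "\<And>x. (f has_vector_derivative 0) (at x)"
  shows "f x = f y"
  using has_vector_derivative_zero_constant[of UNIV f] assms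
  by (metis UNIV_I convex_UNIV has_vector_derivative_at_within)

lemma periodic_deriv:
  fixes f :: "real \<Rightarrow> 'a::real_normed_vector"
  assumes "\<And>x. (f has_vector_derivative f' x) (at x)" "periodic X f"
  shows "periodic X f'"
  unfolding periodic_def
proof
  fix x
  have "(f has_vector_derivative f' (x + X)) (at x)"
  proof -
    have "((\<lambda>x. f (x + X)) has_vector_derivative f' (x + X)) (at x)"
      using vector_diff_chain_at[of "\<lambda>x. x + X" 1 x f "f' (x + X)"] assms(1)
      by (simp add: o_def has_vector_derivative_add_const)
    then show ?thesis using assms(2) by (simp add: periodic_def)
  qed
  with assms(1) show "f' (x + X) = f' x" by (metis vector_derivative_unique_at)
qed

lemma periodic_shift_int:
  assumes "periodic X f"
  shows "f (x + of_int n * X) = f x"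
proof -
  have *: "f (x + of_nat n * X) = f x" for n :: nat and x
  proof (induction n)
    case (Suc n)
    have "f (x + of_nat (Suc n) * X) = f ((x + of_nat n * X) + X)" by (simp add: algebra_simps)
    with Suc assms show ?case by (simp add: periodic_def)
  qed simp
  show ?thesis
  proof (cases "n \<ge> 0")
    case True then show ?thesis using *[of x "nat n"] by simp
  next
    case False then show ?thesis using *[of "x + of_int n * X" "nat (- n)"] by simp
  qed
qed

lemma periodic_reduce:
  assumes "periodic X f" "X > 0"
  obtains y where "0 \<le> y" "y < X" "f x = f y"
proof
  let ?y = "x + of_int (- \<lfloor>x / X\<rfloor>) * X"
  show "f x = f ?y" using periodic_shift_int[OF assms(1)] by metis
  have "of_int \<lfloor>x / X\<rfloor> * X \<le> x" "x < (of_int \<lfloor>x / X\<rfloor> + 1) * X"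
    using \<open>X > 0\<close> floor_divide_lower floor_divide_upper by blast+
  then show "0 \<le> ?y" "?y < X" by (simp_all add: algebra_simps)
qed

lemma periodic_bounded:
  fixes f :: "real \<Rightarrow> 'a::real_normed_vector"
  assumes "continuous_on UNIV f" "periodic X f" "X > 0"
  obtains M where "M > 0" "\<And>x. norm (f x) \<le> M"
proof -
  have "bounded (f ` {0..X})"
    using assms(1) by (intro compact_imp_bounded compact_continuous_image)
      (auto intro: continuous_on_subset)
  then obtain M where M: "M > 0" "\<And>x. x \<in> {0..X} \<Longrightarrow> norm (f x) \<le> M"
    unfolding bounded_pos by blast
  have "norm (f x) \<le> M" for x
    using periodic_reduce[OF assms(2,3), of x] M(2)[of _] by (metis atLeastAtMost_iff less_imp_le)
  with M that show thesis by blast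
qed

lemma periodic_positive_lower_bound:
  fixes f :: "real \<Rightarrow> real"
  assumes "continuous_on UNIV f" "periodic X f" "X > 0" "\<And>x. f x > 0"
  obtains m where "m > 0" "\<And>x. m \<le> f x"
proof -
  have "continuous_on {0..X} f" using assms(1) by (rule continuous_on_subset) simp
  then obtain y where y: "\<And>x. x \<in> {0..X} \<Longrightarrow> f y \<le> f x"
    using continuous_attains_inf[of "{0..X}" f] \<open>X > 0\<close>
    by (metis atLeastAtMost_iff compact_Icc empty_iff less_imp_le order_refl)
  have "f y \<le> f x" for x
    using periodic_reduce[OF assms(2,3), of x] y by (metis atLeastAtMost_iff less_imp_le)
  with assms(4) that show thesis by blast
qed

section \<open>Smooth periodic coefficients\<close>

definition coef :: "real \<Rightarrow> (real \<Rightarrow> real) \<Rightarrow> bool" where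
  "coef X f \<longleftrightarrow> smooth f \<and> periodic X f"

lemma coefI: "smooth f \<Longrightarrow> (\<And>x. f (x + X) = f x) \<Longrightarrow> coef X f"
  by (simp add: coef_def periodic_def)

lemma coefD:
  assumes "coef X f"
  shows "smooth f" "periodic X f" "f (x + X) = f x" "continuous_on A f"
    "(f has_real_derivative deriv f x) (at x)"
  using assms by (auto simp: coef_def periodic_def smooth_continuous_on smooth_real_deriv)

lemma coef_const [simp, intro]: "coef X (\<lambda>_. k)"
  by (auto intro: coefI)

lemma coef_deriv [intro]: "coef X f \<Longrightarrow> coef X (deriv f)"
  using periodic_deriv[of f "deriv f"]
  by (auto simp: coef_def smooth_real_deriv real_vector_deriv[symmetric])

lemma coef_add [intro]: "coef X f \<Longrightarrow> coef X g \<Longrightarrow> coef X (\<lambda>x. f x + g x)"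
  and coef_diff [intro]: "coef X f \<Longrightarrow> coef X g \<Longrightarrow> coef X (\<lambda>x. f x - g x)"
  and coef_mult [intro]: "coef X f \<Longrightarrow> coef X g \<Longrightarrow> coef X (\<lambda>x. f x * g x)"
  and coef_power [intro]: "coef X f \<Longrightarrow> coef X (\<lambda>x. f x ^ n)"
  by (auto intro!: coefI dest: coefD simp: coefD(3))

lemma coef_divide [intro]:
  "coef X f \<Longrightarrow> coef X g \<Longrightarrow> (\<And>x. g x \<noteq> 0) \<Longrightarrow> coef X (\<lambda>x. f x / g x)"
  by (auto intro!: coefI dest: coefD simp: coefD(3))

lemma coef_bounded:
  assumes "coef X f" "X > 0"
  obtains M where "M > 0" "\<And>x. \<bar>f x\<bar> \<le> M"
  using periodic_bounded[of f X] assms by (auto simp: coef_def smooth_continuous_on)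

section \<open>Square-integrable functions on the circle\<close>

text \<open>Norms see only \<open>{0..X}\<close>, whereas \<open>state_eq\<close> asks for equality
  almost everywhere on the line. The exceptional set is covered by the integer translates of its
  part in one period, a countable union of null sets.\<close>

lemma AE_periodic:
  fixes X :: real
  assumes P: "{x. \<not> P x} \<in> sets borel" and per: "\<And>x. P (x + X) \<longleftrightarrow> P x" and "X > 0"
    and ae: "AE x in lborel. x \<in> {0..X} \<longrightarrow> P x"
  shows "AE x in lborel. P x"
proof -
  let ?N = "{x. \<not> P x} \<inter> {0..X}"
  have N: "?N \<in> null_sets lborel"
  proof (subst AE_iff_null_sets)
    show "?N \<in> sets lborel" unfolding sets_lborel by (rule sets.Int[OF P]) simp
    show "AE x in lborel. x \<notin> ?N" using ae by eventually_elim auto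
  qed
  have "(\<Union>n::int. {x. x - of_int n * X \<in> ?N}) \<in> null_sets lborel"
    by (intro null_sets_UN null_sets_translation N)
  moreover have "{x. \<not> P x} \<subseteq> (\<Union>n::int. {x. x - of_int n * X \<in> ?N})"
  proof
    fix x assume "x \<in> {x. \<not> P x}"
    moreover have "P (x + of_int (- \<lfloor>x / X\<rfloor>) * X) \<longleftrightarrow> P x"
      by (rule periodic_shift_int) (use per in \<open>auto simp: periodic_def\<close>)
    moreover have "of_int \<lfloor>x / X\<rfloor> * X \<le> x" "x < (of_int \<lfloor>x / X\<rfloor> + 1) * X"
      using \<open>X > 0\<close> floor_divide_lower floor_divide_upper by blast+
    ultimately show "x \<in> (\<Union>n::int. {x. x - of_int n * X \<in> ?N})"
      by (intro UN_I[of "\<lfloor>x / X\<rfloor>"]) (auto simp: algebra_simps)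
  qed
  ultimately show ?thesis by (intro AE_I'[of "\<Union>n::int. {x. x - of_int n * X \<in> ?N}"]) auto
qed

section \<open>Inner product and norm on one period\<close>

definition ip :: "real \<Rightarrow> (real \<Rightarrow> complex) \<Rightarrow> (real \<Rightarrow> complex) \<Rightarrow> complex" where
  "ip X f g = (LBINT x:{0..X}. f x * cnj (g x))"

lemma L2D:
  assumes "f \<in> L2_per X"
  shows "f \<in> borel_measurable borel" "periodic X f" "f (x + X) = f x"
  using assms by (auto simp: L2_per_def periodic_def)

lemma L2_mult_integrable:
  assumes "f \<in> L2_per X" "g \<in> L2_per X"
  shows "set_integrable lborel {0..X} (\<lambda>x. f x * g x)"
proof (rule set_integrable_bound)
  note [measurable] = assms[THEN L2D(1)]
  show "set_integrable lborel {0..X} (\<lambda>x. (cmod (f x))\<^sup>2 + (cmod (g x))\<^sup>2)"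
    using assms by (auto simp: L2_per_def)
  show "set_borel_measurable lborel {0..X} (\<lambda>x. f x * g x)"
    unfolding set_borel_measurable_def by measurable
  have "a * b \<le> a\<^sup>2 + b\<^sup>2" if "a \<ge> 0" "b \<ge> 0" for a b :: real
    using sum_squares_bound[of a b] mult_nonneg_nonneg[OF that] by linarith
  then show "AE x in lborel. x \<in> {0..X} \<longrightarrow> norm (f x * g x) \<le> norm ((cmod (f x))\<^sup>2 + (cmod (g x))\<^sup>2)"
    by (simp add: norm_mult)
qed

lemma L2_periodic_continuous:
  assumes "continuous_on UNIV f" "periodic X f"
  shows "f \<in> L2_per X"
proof -
  have "continuous_on {0..X} (\<lambda>x. (cmod (f x))\<^sup>2)"
    using assms(1) by (intro continuous_intros) (rule continuous_on_subset, auto)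
  then have "set_integrable lborel {0..X} (\<lambda>x. (cmod (f x))\<^sup>2)"
    unfolding set_integrable_def by (intro borel_integrable_compact) auto
  with assms show ?thesis by (simp add: L2_per_def borel_measurable_continuous_onI)
qed

lemma L2_add [intro]:
  assumes "f \<in> L2_per X" "g \<in> L2_per X"
  shows "(\<lambda>x. f x + g x) \<in> L2_per X"
proof -
  note [measurable] = assms[THEN L2D(1)]
  have "set_integrable lborel {0..X} (\<lambda>x. (cmod (f x + g x))\<^sup>2)"
  proof (rule set_integrable_bound)
    show "set_integrable lborel {0..X} (\<lambda>x. 2 * ((cmod (f x))\<^sup>2 + (cmod (g x))\<^sup>2))"
      using assms by (intro set_integrable_mult_right set_integral_add) (auto simp: L2_per_def)
    show "set_borel_measurable lborel {0..X} (\<lambda>x. (cmod (f x + g x))\<^sup>2)"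
      unfolding set_borel_measurable_def by measurable
    have "(cmod (a + b))\<^sup>2 \<le> 2 * ((cmod a)\<^sup>2 + (cmod b)\<^sup>2)" for a b
    proof -
      have "(cmod (a + b))\<^sup>2 \<le> (cmod a + cmod b)\<^sup>2"
        by (intro power_mono norm_triangle_ineq) auto
      also have "\<dots> \<le> 2 * ((cmod a)\<^sup>2 + (cmod b)\<^sup>2)"
        using sum_squares_bound[of "cmod a" "cmod b"] by (simp add: power2_sum)
      finally show ?thesis .
    qed
    then show "AE x in lborel. x \<in> {0..X} \<longrightarrow>
        norm ((cmod (f x + g x))\<^sup>2) \<le> norm (2 * ((cmod (f x))\<^sup>2 + (cmod (g x))\<^sup>2))"
      by simp
  qed
  moreover have "(\<lambda>x. f x + g x) \<in> borel_measurable borel" by measurable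
  ultimately show ?thesis using assms by (simp add: L2_per_def periodic_def)
qed

lemma L2_bounded_mult:
  assumes f: "f \<in> L2_per X" and p: "p \<in> borel_measurable borel" "periodic X p" "\<And>x. cmod (p x) \<le> M"
  shows "(\<lambda>x. p x * f x) \<in> L2_per X"
proof -
  note [measurable] = L2D(1)[OF f] p(1)
  have "set_integrable lborel {0..X} (\<lambda>x. (cmod (p x * f x))\<^sup>2)"
  proof (rule set_integrable_bound)
    show "set_integrable lborel {0..X} (\<lambda>x. M\<^sup>2 * (cmod (f x))\<^sup>2)"
      using f by (intro set_integrable_mult_right) (auto simp: L2_per_def)
    show "set_borel_measurable lborel {0..X} (\<lambda>x. (cmod (p x * f x))\<^sup>2)"
      unfolding set_borel_measurable_def by measurable
    show "AE x in lborel. x \<in> {0..X} \<longrightarrow> norm ((cmod (p x * f x))\<^sup>2) \<le> norm (M\<^sup>2 * (cmod (f x))\<^sup>2)"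
      using p(3) by (auto simp: norm_mult power_mult_distrib intro!: mult_right_mono power_mono)
  qed
  moreover have "(\<lambda>x. p x * f x) \<in> borel_measurable borel" by measurable
  ultimately show ?thesis using f p(2) by (simp add: L2_per_def periodic_def)
qed

lemma L2_cmult [intro]: "f \<in> L2_per X \<Longrightarrow> (\<lambda>x. k * f x) \<in> L2_per X"
  by (rule L2_bounded_mult[of f X "\<lambda>_. k" "cmod k"]) (auto simp: periodic_def)

lemma L2_minus [intro]: "f \<in> L2_per X \<Longrightarrow> (\<lambda>x. - f x) \<in> L2_per X"
  using L2_cmult[of f X "-1"] by simp

lemma L2_diff [intro]: "f \<in> L2_per X \<Longrightarrow> g \<in> L2_per X \<Longrightarrow> (\<lambda>x. f x - g x) \<in> L2_per X"
  using L2_add[of f X "\<lambda>x. - g x"] by auto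

lemma L2_zero [simp]: "(\<lambda>_. 0) \<in> L2_per X"
  by (rule L2_periodic_continuous) (auto simp: periodic_def)

lemma L2_one [simp]: "(\<lambda>_. 1) \<in> L2_per X"
  by (rule L2_periodic_continuous) (auto simp: periodic_def)

lemma borel_measurable_cnj [measurable]: "cnj \<in> borel_measurable borel"
  by (intro borel_measurable_continuous_onI continuous_intros)

lemma L2_cnj: "f \<in> L2_per X \<Longrightarrow> (\<lambda>x. cnj (f x)) \<in> L2_per X"
  by (auto simp: L2_per_def periodic_def intro: measurable_compose[OF _ borel_measurable_cnj])

lemma L2_coef [intro]:
  assumes "coef X p" "X > 0" "f \<in> L2_per X"
  shows "(\<lambda>x. of_real (p x) * f x) \<in> L2_per X"
proof -
  obtain M where "\<And>x. \<bar>p x\<bar> \<le> M" using coef_bounded[OF assms(1,2)] by blast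
  moreover have "p \<in> borel_measurable borel"
    using assms(1) by (intro borel_measurable_continuous_onI coefD(4))
  ultimately show ?thesis
    by (intro L2_bounded_mult[OF assms(3), of _ M]) (use coefD(3)[OF assms(1)] in \<open>auto simp: periodic_def\<close>)
qed

lemma L2_integrable: "f \<in> L2_per X \<Longrightarrow> set_integrable lborel {0..X} f"
  using L2_mult_integrable[OF L2_one, of f X] by simp

lemma ip_integrable:
  "f \<in> L2_per X \<Longrightarrow> g \<in> L2_per X \<Longrightarrow> set_integrable lborel {0..X} (\<lambda>x. f x * cnj (g x))"
  by (intro L2_mult_integrable L2_cnj)

lemma set_integral_L2_cong:
  fixes f g :: "real \<Rightarrow> complex"
  assumes [measurable]: "f \<in> borel_measurable borel" "g \<in> borel_measurable borel" and "AE x in lborel. f x = g x"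
  shows "(LBINT x:{0..X}. f x) = (LBINT x:{0..X}. g x)"
  by (rule set_lebesgue_integral_cong_AE) (use assms(3) in auto)

lemma L2_norm_cong:
  assumes [measurable]: "f \<in> borel_measurable borel" "g \<in> borel_measurable borel"
    and "AE x in lborel. f x = g x"
  shows "L2_norm X f = L2_norm X g"
proof -
  have "(LBINT x:{0..X}. (cmod (f x))\<^sup>2) = (LBINT x:{0..X}. (cmod (g x))\<^sup>2)"
    by (rule set_lebesgue_integral_cong_AE) (use assms(3) in auto)
  then show ?thesis by (simp add: L2_norm_def)
qed

lemma ip_cong:
  assumes [measurable]: "f \<in> borel_measurable borel" "f' \<in> borel_measurable borel"
    "g \<in> borel_measurable borel" "g' \<in> borel_measurable borel"
    and "AE x in lborel. f x = f' x" "AE x in lborel. g x = g' x"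
  shows "ip X f g = ip X f' g'"
  unfolding ip_def
proof (rule set_integral_L2_cong)
  show "(\<lambda>x. f x * cnj (g x)) \<in> borel_measurable borel"
    and "(\<lambda>x. f' x * cnj (g' x)) \<in> borel_measurable borel"
    by measurable
qed (use assms(5,6) in auto)

lemma ip_add_left:
  "f \<in> L2_per X \<Longrightarrow> g \<in> L2_per X \<Longrightarrow> h \<in> L2_per X \<Longrightarrow>
    ip X (\<lambda>x. f x + g x) h = ip X f h + ip X g h"
  by (simp add: ip_def distrib_right ip_integrable)

lemma ip_add_right:
  "f \<in> L2_per X \<Longrightarrow> g \<in> L2_per X \<Longrightarrow> h \<in> L2_per X \<Longrightarrow>
    ip X h (\<lambda>x. f x + g x) = ip X h f + ip X h g"
  by (simp add: ip_def distrib_left ip_integrable)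

lemma ip_mult_left: "ip X (\<lambda>x. k * f x) g = k * ip X f g"
  by (simp add: ip_def mult.assoc)

lemma ip_mult_right: "ip X f (\<lambda>x. k * g x) = cnj k * ip X f g"
  by (simp add: ip_def mult.left_commute)

lemma ip_coef: "ip X (\<lambda>x. of_real (p x) * f x) g = ip X f (\<lambda>x. of_real (p x) * g x)"
  by (simp add: ip_def mult_ac)

lemma ip_minus_left: "ip X (\<lambda>x. - f x) g = - ip X f g"
  using ip_mult_left[of X "-1"] by simp

lemma ip_diff_left:
  "f \<in> L2_per X \<Longrightarrow> g \<in> L2_per X \<Longrightarrow> h \<in> L2_per X \<Longrightarrow>
    ip X (\<lambda>x. f x - g x) h = ip X f h - ip X g h"
  using ip_add_left[of f X "\<lambda>x. - g x" h] by (simp add: ip_minus_left L2_minus)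

lemma ip_cnj: "cnj (ip X f g) = ip X g f"
  unfolding ip_def set_lebesgue_integral_def
  by (simp add: mult.commute flip: Bochner_Integration.integral_cnj)

lemma ip_self_coef: "ip X (\<lambda>x. of_real (p x) * f x) f = of_real (LBINT x:{0..X}. p x * (cmod (f x))\<^sup>2)"
  by (simp only: ip_def mult.assoc complex_norm_square[symmetric] set_integral_complex_of_real[symmetric]
      of_real_mult of_real_power)

lemma L2_norm_sq: "(L2_norm X f)\<^sup>2 = (LBINT x:{0..X}. (cmod (f x))\<^sup>2)"
  unfolding L2_norm_def set_lebesgue_integral_def
  by (intro real_sqrt_pow2 integral_nonneg_AE) (auto simp: indicator_def)

lemma L2_norm_nonneg [simp]: "0 \<le> L2_norm X f"
  unfolding L2_norm_def set_lebesgue_integral_def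
  by (intro real_sqrt_ge_zero integral_nonneg_AE) (auto simp: indicator_def)

lemma ip_self: "ip X f f = of_real ((L2_norm X f)\<^sup>2)"
  using ip_self_coef[of X "\<lambda>_. 1" f] by (simp add: L2_norm_sq)

lemma L2_norm_cmult: "L2_norm X (\<lambda>x. k * f x) = cmod k * L2_norm X f"
  by (simp add: L2_norm_def norm_mult power_mult_distrib real_sqrt_mult)

lemma L2_norm_minus: "L2_norm X (\<lambda>x. - f x) = L2_norm X f"
  by (simp add: L2_norm_def)

lemma ip_cauchy_schwarz:
  assumes f: "f \<in> L2_per X" and g: "g \<in> L2_per X"
  shows "cmod (ip X f g) \<le> L2_norm X f * L2_norm X g"
proof -
  define z where "z = ip X f g"
  let ?a = "(L2_norm X f)\<^sup>2" and ?b = "(L2_norm X g)\<^sup>2"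
  have quad: "0 \<le> ?a - 2 * t * (cmod z)\<^sup>2 + t\<^sup>2 * (cmod z)\<^sup>2 * ?b" for t :: real
  proof -
    \<comment> \<open>The multiple of \<open>g\<close> points in the direction of \<open>z\<close>,
      which makes the two cross terms real and equal.\<close>
    define k where "k = - of_real t * z"
    define h where "h = (\<lambda>x. f x + k * g x)"
    have "ip X h h = ip X f f + cnj k * z + k * ip X g f + k * cnj k * ip X g g"
      using f g by (simp add: h_def ip_add_left ip_add_right ip_mult_left ip_mult_right L2_cmult L2_add
          z_def algebra_simps)
    also have "ip X g f = cnj z" by (simp add: z_def ip_cnj)
    finally have "ip X h h = ip X f f + cnj k * z + k * cnj z + k * cnj k * ip X g g" .
    moreover have "cnj k * z = of_real (- t * (cmod z)\<^sup>2)" "k * cnj z = of_real (- t * (cmod z)\<^sup>2)"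
      "k * cnj k = of_real (t\<^sup>2 * (cmod z)\<^sup>2)"
      unfolding of_real_mult complex_norm_square by (simp_all add: k_def power2_eq_square)
    ultimately have "of_real ((L2_norm X h)\<^sup>2) =
        complex_of_real (?a - 2 * t * (cmod z)\<^sup>2 + t\<^sup>2 * (cmod z)\<^sup>2 * ?b)"
      by (simp add: ip_self)
    then have "(L2_norm X h)\<^sup>2 = ?a - 2 * t * (cmod z)\<^sup>2 + t\<^sup>2 * (cmod z)\<^sup>2 * ?b"
      using of_real_eq_iff by blast
    then show ?thesis by (metis zero_le_power2)
  qed
  have "(cmod z)\<^sup>2 \<le> ?a * ?b"
  proof (cases "?b = 0")
    case True
    have "z = 0"
    proof (rule ccontr)
      assume "z \<noteq> 0"
      \<comment> \<open>As \<open>?b = 0\<close>, this value of \<open>t\<close> gives the quadratic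
        the value -1.\<close>
      then show False
        using quad[of "(?a + 1) / (2 * (cmod z)\<^sup>2)"] True by simp
    qed
    then show ?thesis by simp
  next
    case False
    then have b: "?b > 0" by simp
    have "a - 2 * (1 / B) * N + (1 / B)\<^sup>2 * N * B = a - N / B" if "B > 0" for a B N :: real
      using that by (simp add: power2_eq_square field_simps)
    \<comment> \<open>The value \<open>t = 1 / ?b\<close> minimises the quadratic.\<close>
    from this[OF b] have "(cmod z)\<^sup>2 / ?b \<le> ?a"
      using quad[of "1 / ?b"] by (metis diff_ge_0_iff_ge)
    then show ?thesis using b by (simp add: pos_divide_le_eq)
  qed
  then show ?thesis
    unfolding z_def power_mult_distrib[symmetric] by (rule power2_le_imp_le) simp
qed

lemma L2_norm_triangle:
  assumes f: "f \<in> L2_per X" and g: "g \<in> L2_per X"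
  shows "L2_norm X (\<lambda>x. f x + g x) \<le> L2_norm X f + L2_norm X g"
proof (rule power2_le_imp_le)
  let ?h = "\<lambda>x. f x + g x"
  have "ip X ?h ?h = ip X f f + ip X f g + cnj (ip X f g) + ip X g g"
    using f g by (simp add: ip_add_left ip_add_right L2_add ip_cnj)
  then have "Re (ip X ?h ?h) = Re (ip X f f + ip X f g + cnj (ip X f g) + ip X g g)" by simp
  then have "(L2_norm X ?h)\<^sup>2 = (L2_norm X f)\<^sup>2 + 2 * Re (ip X f g) + (L2_norm X g)\<^sup>2"
    by (simp add: ip_self)
  also have "Re (ip X f g) \<le> L2_norm X f * L2_norm X g"
    using ip_cauchy_schwarz[OF f g] complex_Re_le_cmod order_trans by blast
  finally show "(L2_norm X ?h)\<^sup>2 \<le> (L2_norm X f + L2_norm X g)\<^sup>2"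
    by (simp add: power2_sum)
qed simp

lemma L2_norm_triangle_diff:
  assumes "f \<in> L2_per X" "g \<in> L2_per X"
  shows "L2_norm X (\<lambda>x. f x - g x) \<le> L2_norm X f + L2_norm X g"
  using L2_norm_triangle[OF assms(1) L2_minus[OF assms(2)]] by (simp add: L2_norm_minus)

lemma L2_norm_mult_le:
  assumes f: "f \<in> L2_per X" and p: "coef X p" "\<And>x. \<bar>p x\<bar> \<le> M" "X > 0"
  shows "L2_norm X (\<lambda>x. of_real (p x) * f x) \<le> M * L2_norm X f"
proof (rule power2_le_imp_le)
  have M: "M \<ge> 0" using p(2)[of 0] by linarith
  have "(LBINT x:{0..X}. (cmod (of_real (p x) * f x))\<^sup>2) \<le> (LBINT x:{0..X}. M\<^sup>2 * (cmod (f x))\<^sup>2)"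
  proof (rule set_integral_mono)
    show "set_integrable lborel {0..X} (\<lambda>x. (cmod (of_real (p x) * f x))\<^sup>2)"
      using L2_coef[OF p(1) p(3) f] by (simp add: L2_per_def)
    show "set_integrable lborel {0..X} (\<lambda>x. M\<^sup>2 * (cmod (f x))\<^sup>2)"
      using f by (simp add: L2_per_def)
    show "(cmod (of_real (p x) * f x))\<^sup>2 \<le> M\<^sup>2 * (cmod (f x))\<^sup>2" for x
    proof -
      have "\<bar>p x\<bar>\<^sup>2 \<le> M\<^sup>2" by (rule power_mono[OF p(2)]) simp
      then show ?thesis by (simp add: norm_mult power_mult_distrib mult_right_mono)
    qed
  qed
  then show "(L2_norm X (\<lambda>x. of_real (p x) * f x))\<^sup>2 \<le> (M * L2_norm X f)\<^sup>2"
    by (simp add: L2_norm_sq power_mult_distrib)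
  show "0 \<le> M * L2_norm X f" using M by simp
qed

lemma L2_norm_zeroD:
  assumes f: "f \<in> L2_per X" and "X > 0" "L2_norm X f = 0"
  shows "AE x in lborel. f x = 0"
proof (rule AE_periodic)
  note [measurable] = L2D(1)[OF f]
  have "(\<integral>x. indicator {0..X} x *\<^sub>R (cmod (f x))\<^sup>2 \<partial>lborel) = 0"
    using assms L2_norm_sq[of X f] by (simp add: set_lebesgue_integral_def)
  then have "AE x in lborel. indicator {0..X} x *\<^sub>R (cmod (f x))\<^sup>2 = 0"
    using f by (subst (asm) integral_nonneg_eq_0_iff_AE) (auto simp: L2_per_def set_integrable_def)
  then show "AE x in lborel. x \<in> {0..X} \<longrightarrow> f x = 0" by eventually_elim auto
  show "{x. f x \<noteq> 0} \<in> sets borel" by measurable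
  show "f (x + X) = 0 \<longleftrightarrow> f x = 0" for x using L2D(3)[OF f] by simp
qed (use assms(2) in simp)

section \<open>Weak derivatives on the circle\<close>

text \<open>The half planes \<open>y \<le> x\<close> and \<open>x \<le> y\<close> cover the plane
  and overlap only in the diagonal; Fubini on each of them turns the double integral of
  \<open>f x * g y\<close> into the left side. This is integration by parts for primitives of merely
  integrable functions.\<close>

lemma fubini_triangle:
  fixes f g :: "real \<Rightarrow> complex"
  assumes f: "integrable lborel f" and g: "integrable lborel g"
  shows "integrable lborel (\<lambda>x. f x * (LBINT y:{..x}. g y))"
    and "(LBINT x. f x * (LBINT y:{..x}. g y)) + (LBINT x. (LBINT y:{..x}. f y) * g x) =
      (LBINT x. f x) * (LBINT x. g x)" (is "?L = ?R")
proof -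
  let ?k = "\<lambda>x y. indicator {..x} y *\<^sub>R (f x * g y)" and ?l = "\<lambda>x y. indicator {..y} x *\<^sub>R (f x * g y)"
  note [measurable] = borel_measurable_integrable[OF f] borel_measurable_integrable[OF g]
  have *: "integrable (lborel \<Otimes>\<^sub>M lborel) (\<lambda>(x, y). f x * g y)"
  proof (rule lborel_pair.Fubini_integrable)
    show "(\<lambda>(x, y). f x * g y) \<in> borel_measurable (lborel \<Otimes>\<^sub>M lborel)" by measurable
    show "integrable lborel (\<lambda>x. LBINT y. norm (case (x, y) of (x, y) \<Rightarrow> f x * g y))"
      using f g by (simp add: norm_mult)
    show "AE x in lborel. integrable lborel (\<lambda>y. case (x, y) of (x, y) \<Rightarrow> f x * g y)"
      using g by simp
  qed
  have le: "integrable (lborel \<Otimes>\<^sub>M lborel) (\<lambda>(x, y). ?k x y)"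
    by (rule Bochner_Integration.integrable_bound[OF *]) (auto simp: indicator_def)
  have ge: "integrable (lborel \<Otimes>\<^sub>M lborel) (\<lambda>(x, y). ?l x y)"
    by (rule Bochner_Integration.integrable_bound[OF *]) (auto simp: indicator_def)
  have 1: "(LBINT y. ?k x y) = f x * (LBINT y:{..x}. g y)" for x
    by (simp add: set_lebesgue_integral_def flip: integral_mult_right_zero)
  have 2: "(LBINT x. ?l x y) = (LBINT x:{..y}. f x) * g y" for y
    by (simp add: set_lebesgue_integral_def flip: integral_mult_left_zero)
  show "integrable lborel (\<lambda>x. f x * (LBINT y:{..x}. g y))"
    using lborel_pair.integrable_fst'[OF le] by (simp add: 1)
  have "(LBINT x. (LBINT y:{..x}. f y) * g x) = (LBINT y. LBINT x. ?l x y)"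
    by (simp add: 2)
  also have "\<dots> = (LBINT x. LBINT y. ?l x y)"
    using ge by (rule lborel_pair.Fubini_integral)
  finally have 3: "(LBINT x. (LBINT y:{..x}. f y) * g x) = \<dots>" .
  have "?L =
      (LBINT x. (LBINT y. ?k x y) +
        (LBINT y. ?l x y))"
    unfolding 3 1[symmetric]
    using lborel_pair.integrable_fst'[OF le] lborel_pair.integrable_fst'[OF ge]
    by (intro Bochner_Integration.integral_add[symmetric]) simp_all
  also have "\<dots> = (LBINT x. f x * (LBINT y. g y))"
  proof (rule Bochner_Integration.integral_cong[OF refl])
    fix x
    have [simp]: "integrable lborel (\<lambda>y. ?k x y)"
      "integrable lborel (\<lambda>y. ?l x y)"
      by (rule Bochner_Integration.integrable_bound[of lborel "\<lambda>y. f x * g y"];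
          use g in \<open>auto simp: indicator_def\<close>)+
    have "(LBINT y. ?k x y) + (LBINT y. ?l x y) =
        (LBINT y. ?k x y + ?l x y)"
      by simp
    also have "\<dots> = (LBINT y. f x * g y)"
    proof (rule integral_cong_AE)
      show "AE y in lborel. ?k x y + ?l x y = f x * g y"
        using AE_lborel_singleton[of x] by eventually_elim (auto simp: indicator_def)
      show "(\<lambda>y. ?k x y + ?l x y) \<in> borel_measurable lborel"
        by (intro borel_measurable_integrable Bochner_Integration.integrable_add) simp_all
      show "(\<lambda>y. f x * g y) \<in> borel_measurable lborel"
        using g by (intro borel_measurable_integrable) simp
    qed
    finally show "(LBINT y. ?k x y) +
        (LBINT y. ?l x y) = f x * (LBINT y. g y)" by simp
  qed
  finally show "?L = ?R" by simp
qed

lemma integration_by_parts_primitive: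
  fixes f g :: "real \<Rightarrow> complex"
  assumes f: "set_integrable lborel {0..X} f" and g: "set_integrable lborel {0..X} g"
  shows "set_integrable lborel {0..X} (\<lambda>x. f x * (LBINT y:{0..x}. g y))"
    and "(LBINT x:{0..X}. f x * (LBINT y:{0..x}. g y)) + (LBINT x:{0..X}. (LBINT y:{0..x}. f y) * g x) =
      (LBINT x:{0..X}. f x) * (LBINT x:{0..X}. g x)"
proof -
  \<comment> \<open>On the period interval the primitive of \<open>k\<close> from 0 equals the
    integral over the left half line of \<open>k\<close> cut off outside \<open>{0..X}\<close>,
    which is the form treated by \<open>fubini_triangle\<close>.\<close>
  have *: "indicator {0..X} x *\<^sub>R (h x * (LBINT y:{0..x}. k y)) =
      (indicator {0..X} x *\<^sub>R h x) * (LBINT y:{..x}. indicator {0..X} y *\<^sub>R k y)"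
    for h k :: "real \<Rightarrow> complex" and x
  proof (cases "x \<in> {0..X}")
    case True
    then have "(\<lambda>y. indicator {0..x} y *\<^sub>R k y) = (\<lambda>y. indicator {..x} y *\<^sub>R indicator {0..X} y *\<^sub>R k y)"
      by (auto simp: indicator_def)
    then show ?thesis by (simp add: set_lebesgue_integral_def)
  qed simp
  note tri = fubini_triangle[OF f[unfolded set_integrable_def] g[unfolded set_integrable_def]]
  show "set_integrable lborel {0..X} (\<lambda>x. f x * (LBINT y:{0..x}. g y))"
    using tri(1) by (simp only: set_integrable_def *)
  have "(LBINT x:{0..X}. f x * (LBINT y:{0..x}. g y)) + (LBINT x:{0..X}. (LBINT y:{0..x}. f y) * g x) =
      (LBINT x. indicator {0..X} x *\<^sub>R (f x * (LBINT y:{0..x}. g y))) +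
      (LBINT x. indicator {0..X} x *\<^sub>R (g x * (LBINT y:{0..x}. f y)))"
    by (simp add: set_lebesgue_integral_def mult.commute)
  also have "\<dots> = (LBINT x. indicator {0..X} x *\<^sub>R f x) * (LBINT x. indicator {0..X} x *\<^sub>R g x)"
    unfolding * tri(2)[symmetric] by (simp add: mult.commute)
  finally show "(LBINT x:{0..X}. f x * (LBINT y:{0..x}. g y)) +
      (LBINT x:{0..X}. (LBINT y:{0..x}. f y) * g x) = (LBINT x:{0..X}. f x) * (LBINT x:{0..X}. g x)"
    by (simp add: set_lebesgue_integral_def)
qed

text \<open>The measures whose densities are the positive and the negative part of \<open>k\<close>
  are finite and equal on all half lines \<open>{a<..}\<close>, hence coincide; and densities are
  unique up to null sets.\<close>

lemma AE_zero_if_tail_integrals_zero: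
  fixes k :: "real \<Rightarrow> real"
  assumes k: "integrable lborel k" and z: "\<And>a. (LBINT x:{a<..}. k x) = 0"
  shows "AE x in lborel. k x = 0"
proof -
  note [measurable] = borel_measurable_integrable[OF k]
  let ?p = "\<lambda>x. max 0 (k x)" and ?n = "\<lambda>x. max 0 (- k x)"
  let ?M = "density lborel (\<lambda>x. ennreal (?p x))" and ?N = "density lborel (\<lambda>x. ennreal (?n x))"
  have int: "integrable lborel (\<lambda>x. indicator {a<..} x *\<^sub>R ?p x)"
    "integrable lborel (\<lambda>x. indicator {a<..} x *\<^sub>R ?n x)" for a
    by (rule Bochner_Integration.integrable_bound[OF k]; auto simp: indicator_def)+
  have em: "emeasure (density lborel (\<lambda>x. ennreal (q x))) {a<..} = ennreal (LBINT x. indicator {a<..} x *\<^sub>R q x)"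
    if [measurable]: "q \<in> borel_measurable borel" and q: "\<And>x. q x \<ge> 0"
      "integrable lborel (\<lambda>x. indicator {a<..} x *\<^sub>R q x)" for q :: "real \<Rightarrow> real" and a
  proof -
    have "emeasure (density lborel (\<lambda>x. ennreal (q x))) {a<..} =
        (\<integral>\<^sup>+ x. ennreal (indicator {a<..} x *\<^sub>R q x) \<partial>lborel)"
      by (subst emeasure_density) (auto intro!: nn_integral_cong simp: indicator_def)
    also have "\<dots> = ennreal (LBINT x. indicator {a<..} x *\<^sub>R q x)"
      using q by (intro nn_integral_eq_integral) auto
    finally show ?thesis .
  qed
  note em = em[of ?p, OF _ _ int(1)] em[of ?n, OF _ _ int(2)]
  have "?M = ?N"
  proof (rule measure_eqI_lessThan)
    fix a
    show "emeasure ?M {a<..} < \<infinity>" by (simp add: em)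
    have "(LBINT x. indicator {a<..} x *\<^sub>R ?p x) - (LBINT x. indicator {a<..} x *\<^sub>R ?n x) =
        (LBINT x. indicator {a<..} x *\<^sub>R ?p x - indicator {a<..} x *\<^sub>R ?n x)"
      using int by (rule Bochner_Integration.integral_diff[symmetric])
    also have "\<dots> = (LBINT x:{a<..}. k x)"
      unfolding set_lebesgue_integral_def
      by (intro Bochner_Integration.integral_cong refl) (auto simp: indicator_def)
    finally show "emeasure ?M {a<..} = emeasure ?N {a<..}" using z[of a] by (simp add: em)
  qed simp_all
  then have "AE x in lborel. ennreal (?p x) = ennreal (?n x)"
    by (intro sigma_finite_measure.density_unique[OF sigma_finite_lborel]) simp_all
  then show ?thesis by eventually_elim (auto simp: max_def split: if_splits)
qed

lemma logistic_limit:
  fixes h :: real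
  shows "h > 0 \<Longrightarrow> (\<lambda>n. 1 / (1 + exp (- real n * h))) \<longlonglongrightarrow> 1"
    and "h < 0 \<Longrightarrow> (\<lambda>n. 1 / (1 + exp (- real n * h))) \<longlonglongrightarrow> 0"
proof -
  show "(\<lambda>n. 1 / (1 + exp (- real n * h))) \<longlonglongrightarrow> 1" if "h > 0"
  proof -
    have "filterlim (\<lambda>n. - real n * h) at_bot sequentially"
      using that unfolding filterlim_uminus_at_bot
      by (simp add: filterlim_at_top_mult_tendsto_pos[OF tendsto_const _ filterlim_real_sequentially])
    then have "(\<lambda>n. exp (- real n * h)) \<longlonglongrightarrow> 0"
      by (rule filterlim_compose[OF exp_at_bot])
    then have "(\<lambda>n. 1 / (1 + exp (- real n * h))) \<longlonglongrightarrow> 1 / (1 + 0)"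
      by (intro tendsto_intros) auto
    then show ?thesis by simp
  qed
  show "(\<lambda>n. 1 / (1 + exp (- real n * h))) \<longlonglongrightarrow> 0" if "h < 0"
  proof -
    have "filterlim (\<lambda>n. real n * (- h)) at_top sequentially"
      using that by (intro filterlim_at_top_mult_tendsto_pos[OF tendsto_const]
          filterlim_real_sequentially) simp
    then have "filterlim (\<lambda>n. 1 + exp (real n * (- h))) at_top sequentially"
      by (intro filterlim_tendsto_add_at_top[OF tendsto_const] filterlim_compose[OF exp_at_top])
    then have "(\<lambda>n. inverse (1 + exp (real n * (- h)))) \<longlonglongrightarrow> 0"
      by (rule tendsto_inverse_0_at_top)
    then show ?thesis by (simp add: field_simps)
  qed
qed

text \<open>
  The logistic functions of large multiples of \<open>sin (\<pi>(t - a)/X) sin (\<pi>t/X)\<close> are smooth and periodic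
  and approximate the indicator function of \<open>(a, X)\<close> on the period interval.
\<close>

lemma AE_zero_if_orthogonal:
  assumes h: "h \<in> L2_per X" and X: "X > 0"
    and orth: "\<And>\<phi>. smooth \<phi> \<Longrightarrow> periodic X \<phi> \<Longrightarrow> (LBINT x:{0..X}. h x * \<phi> x) = 0"
  shows "AE x in lborel. h x = 0"
proof -
  note [measurable] = L2D(1)[OF h]
  let ?h = "\<lambda>x. indicator {0..X} x *\<^sub>R h x"
  have int: "integrable lborel ?h"
    using L2_integrable[OF h] by (simp add: set_integrable_def)
  have tail0: "(LBINT x. indicator {a<..} x *\<^sub>R ?h x) = 0" if a: "0 \<le> a" "a < X" for a
  proof -
    \<comment> \<open>Each sine changes sign under a shift by \<open>X\<close>, so the product has
      period \<open>X\<close>. On \<open>(0, X)\<close> the second factor is positive and the first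
      has the sign of \<open>t - a\<close>.\<close>
    define s where "s = (\<lambda>t. sin (pi / X * t + (- pi * a / X)) * sin (pi / X * t + 0))"
    define \<phi> where "\<phi> = (\<lambda>n t. 1 / (1 + exp (- real n * s t)))"
    have ne: "1 + exp y \<noteq> 0" for y :: real using exp_gt_zero[of y] by linarith
    have "smooth s" unfolding s_def by (intro smooth_mult smooth_sin)
    then have sm: "smooth (\<phi> n)" for n
      unfolding \<phi>_def
      by (intro smooth_divide smooth_add smooth_exp smooth_mult smooth_const)
        (use ne in auto)
    have "s (x + X) = s x" for x
    proof -
      have "pi / X * (x + X) + b = (pi / X * x + b) + pi" for b using X by (simp add: field_simps)
      then show ?thesis by (simp only: s_def sin_periodic_pi minus_mult_minus)
    qed
    then have per: "periodic X (\<phi> n)" for n by (simp add: periodic_def \<phi>_def)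
    have sgn: "s t > 0 \<longleftrightarrow> t > a" "s t < 0 \<longleftrightarrow> t < a" if t: "0 < t" "t < X" "t \<noteq> a" for t
    proof -
      have sinpos: "sin (pi * d / X) > 0" if "0 < d" "d < X" for d
        using that X by (intro sin_gt_zero) (simp_all add: pos_divide_less_eq)
      have pos: "sin (pi / X * t + 0) > 0" using sinpos[OF t(1,2)] by simp
      have eq: "pi / X * t + (- pi * a / X) = pi * (t - a) / X"
        by (simp add: diff_divide_distrib right_diff_distrib)
      have "sin (pi / X * t + (- pi * a / X)) > 0" if "t > a"
        unfolding eq using that t a by (intro sinpos) auto
      moreover have "sin (pi / X * t + (- pi * a / X)) < 0" if "t < a"
      proof -
        have "pi * (t - a) / X = - (pi * (a - t) / X)" by (simp add: diff_divide_distrib right_diff_distrib)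
        then have "sin (pi * (t - a) / X) = - sin (pi * (a - t) / X)" by (simp only: sin_minus)
        then show ?thesis unfolding eq using sinpos[of "a - t"] that t a by simp
      qed
      ultimately show "s t > 0 \<longleftrightarrow> t > a" "s t < 0 \<longleftrightarrow> t < a"
        using pos t(3) unfolding s_def by (smt (verit) zero_less_mult_iff mult_less_0_iff)+
    qed
    have "(\<lambda>n. LBINT x. indicator {0..X} x *\<^sub>R (h x * of_real (\<phi> n x))) \<longlonglongrightarrow>
        (LBINT x. indicator {a<..} x *\<^sub>R ?h x)"
    proof (rule integral_dominated_convergence)
      have [measurable]: "\<phi> n \<in> borel_measurable borel" for n
        using sm by (intro borel_measurable_continuous_onI smooth_continuous_on)
      show "(\<lambda>x. indicator {a<..} x *\<^sub>R ?h x) \<in> borel_measurable lborel" by measurable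
      show "(\<lambda>x. indicator {0..X} x *\<^sub>R (h x * of_real (\<phi> n x))) \<in> borel_measurable lborel" for n by measurable
      show "integrable lborel (\<lambda>x. norm (?h x))"
        using int by (rule integrable_norm)
      show "AE x in lborel. norm (indicator {0..X} x *\<^sub>R (h x * of_real (\<phi> n x))) \<le>
          norm (?h x)" for n
      proof (rule AE_I2)
        fix x
        have "\<bar>\<phi> n x\<bar> \<le> 1" by (simp add: \<phi>_def field_simps add_pos_pos)
        then show "norm (indicator {0..X} x *\<^sub>R (h x * of_real (\<phi> n x))) \<le>
          norm (?h x)"
          by (auto simp: norm_mult indicator_def intro: mult_left_le)
      qed
      show "AE x in lborel. (\<lambda>n. indicator {0..X} x *\<^sub>R (h x * of_real (\<phi> n x))) \<longlonglongrightarrow>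
          indicator {a<..} x *\<^sub>R ?h x"
        using AE_lborel_singleton[of 0] AE_lborel_singleton[of a] AE_lborel_singleton[of X]
      proof eventually_elim
        case (elim x)
        show ?case
        proof (cases "x \<in> {0..X}")
          case True
          then have x: "0 < x" "x < X" "x \<noteq> a" using elim by auto
          have "(\<lambda>n. \<phi> n x) \<longlonglongrightarrow> indicator {a<..} x"
            using logistic_limit[of "s x"] sgn[OF x] x unfolding \<phi>_def
            by (auto simp: indicator_def split: if_splits)
          then have "(\<lambda>n. h x * of_real (\<phi> n x)) \<longlonglongrightarrow> h x * of_real (indicator {a<..} x)"
            by (intro tendsto_intros)
          with True show ?thesis by (cases "a < x") simp_all
        qed simp
      qed
    qed
    moreover have "(LBINT x. indicator {0..X} x *\<^sub>R (h x * of_real (\<phi> n x))) = 0" for n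
      using orth[of "\<lambda>x. of_real (\<phi> n x)"] sm per
      by (simp add: smooth_of_real set_lebesgue_integral_def periodic_def)
    ultimately show ?thesis by (simp add: LIMSEQ_const_iff)
  qed
  have tail: "(LBINT x. indicator {a<..} x *\<^sub>R ?h x) = 0" for a
  proof -
    \<comment> \<open>Half lines starting left of the period interval contain all of it, which is
      the test function 1; those starting at or right of \<open>X\<close> contribute
      nothing.\<close>
    consider "a < 0" | "0 \<le> a" "a < X" | "a \<ge> X" by linarith
    then show ?thesis
    proof cases
      case 1
      then have "(\<lambda>x. indicator {a<..} x *\<^sub>R ?h x) = ?h"
        by (auto simp: indicator_def)
      then show ?thesis using orth[of "\<lambda>_. 1"] by (simp add: set_lebesgue_integral_def periodic_def)
    next
      case 2 then show ?thesis by (rule tail0)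
    next
      case 3
      then have "(\<lambda>x. indicator {a<..} x *\<^sub>R ?h x) = (\<lambda>_. 0)"
        by (auto simp: indicator_def)
      then show ?thesis by simp
    qed
  qed
  have int2: "integrable lborel (\<lambda>x. indicator {a<..} x *\<^sub>R ?h x)" for a
    using int by (rule Bochner_Integration.integrable_bound) (auto simp: indicator_def)
  have "AE x in lborel. Re (?h x) = 0"
  proof (rule AE_zero_if_tail_integrals_zero)
    show "(LBINT x:{a<..}. Re (?h x)) = 0" for a
      using integral_Re[OF int2[of a]] tail[of a] by (simp add: set_lebesgue_integral_def mult.assoc)
  qed (use int in \<open>rule integrable_Re\<close>)
  moreover have "AE x in lborel. Im (?h x) = 0"
  proof (rule AE_zero_if_tail_integrals_zero)
    show "(LBINT x:{a<..}. Im (?h x)) = 0" for a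
      using integral_Im[OF int2[of a]] tail[of a] by (simp add: set_lebesgue_integral_def mult.assoc)
  qed (use int in \<open>rule integrable_Im\<close>)
  ultimately have "AE x in lborel. x \<in> {0..X} \<longrightarrow> h x = 0"
    by eventually_elim (auto simp: complex_eq_iff)
  then show ?thesis
  proof (rule AE_periodic[rotated -1])
    show "{x. h x \<noteq> 0} \<in> sets borel" by measurable
    show "h (x + X) = 0 \<longleftrightarrow> h x = 0" for x using L2D(3)[OF h] by simp
  qed (use X in auto)
qed

lemma smooth_bounded_linear:
  assumes "smooth f" "bounded_linear T"
  shows "smooth (\<lambda>x. T (f x))"
proof -
  obtain D where D: "D 0 = f" "\<And>n x. (D n has_vector_derivative D (Suc n) x) (at x)"
    using assms(1) unfolding smooth_def by blast
  show ?thesis unfolding smooth_def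
    by (rule exI[of _ "\<lambda>n x. T (D n x)"])
      (use D bounded_linear.has_vector_derivative[OF assms(2)] in auto)
qed

lemma set_integral_vector_derivative:
  fixes F :: "real \<Rightarrow> 'a::euclidean_space"
  assumes "\<And>x. (F has_vector_derivative f x) (at x)" "continuous_on UNIV f" "a \<le> b"
  shows "(LBINT x:{a..b}. f x) = F b - F a"
  unfolding set_lebesgue_integral_def
  by (rule integral_FTC_atLeastAtMost)
    (use assms in \<open>auto intro: has_vector_derivative_at_within continuous_on_subset\<close>)

lemma continuous_on_shift_Icc:
  fixes f :: "real \<Rightarrow> 'a::topological_space"
  assumes "continuous_on {0..X} f" "\<And>x. x \<in> {c..c + X} \<Longrightarrow> g x = f (x - c)"
  shows "continuous_on {c..c + X} g"
proof -
  have "continuous_on {c..c + X} (\<lambda>x. f (x - c))"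
    by (rule continuous_on_compose2[OF assms(1)]) (auto intro!: continuous_intros)
  then show ?thesis by (rule continuous_on_eq) (simp add: assms(2))
qed

lemma periodic_continuous_extension:
  fixes f :: "real \<Rightarrow> 'a::topological_space"
  assumes f: "continuous_on {0..X} f" "f 0 = f X" and X: "X > 0"
  obtains g where "continuous_on UNIV g" "periodic X g" "\<And>x. x \<in> {0..X} \<Longrightarrow> g x = f x"
proof
  define g where "g = (\<lambda>x. f (x - of_int \<lfloor>x / X\<rfloor> * X))"
  \<comment> \<open>The condition \<open>f 0 = f X\<close> makes the formula valid on the closed
    period, including the right endpoint, where the floor has already jumped.\<close>
  have g: "g x = f (x - of_int n * X)" if "x \<in> {of_int n * X..of_int n * X + X}" for n :: int and x
  proof (cases "x = of_int n * X + X")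
    case True
    then have "x / X = of_int (n + 1)" using X by (simp add: field_simps)
    then have "\<lfloor>x / X\<rfloor> = n + 1" by (metis floor_of_int)
    with True f(2) show ?thesis by (simp add: g_def algebra_simps)
  next
    case False
    with that have "of_int n \<le> x / X" "x / X < of_int n + 1"
      using X by (auto simp: pos_le_divide_eq pos_divide_less_eq algebra_simps)
    then have "\<lfloor>x / X\<rfloor> = n" by linarith
    then show ?thesis by (simp add: g_def)
  qed
  show "g x = f x" if "x \<in> {0..X}" for x using g[of x 0] that by simp
  show "periodic X g"
  proof -
    have "(x + X) / X = x / X + 1" for x using X by (simp add: field_simps)
    then show ?thesis by (simp add: periodic_def g_def algebra_simps)
  qed
  have "isCont g x" for x
  proof -
    define n where "n = \<lfloor>x / X\<rfloor>"
    have cont: "continuous_on {of_int m * X..of_int m * X + X} g" for m :: int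
      by (rule continuous_on_shift_Icc[OF f(1)]) (rule g)
    have "of_int (n - 1) * X + X = of_int n * X" by (simp add: algebra_simps)
    \<comment> \<open>Two adjacent closed periods are glued so that \<open>x\<close>, which may be a
      multiple of \<open>X\<close>, becomes an interior point.\<close>
    then have "continuous_on ({of_int (n - 1) * X..of_int n * X} \<union> {of_int n * X..of_int n * X + X}) g"
      using cont[of n] cont[of "n - 1"] by (intro continuous_on_closed_Un) auto
    moreover have "{of_int (n - 1) * X..of_int n * X} \<union> {of_int n * X..of_int n * X + X} =
        {of_int n * X - X..of_int n * X + X}" using X by (auto simp: algebra_simps)
    moreover have "of_int n * X \<le> x" "x < (of_int n + 1) * X"
      using X floor_divide_lower floor_divide_upper unfolding n_def by blast+
    then have "x \<in> interior {of_int n * X - X..of_int n * X + X}"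
      using X by (simp add: algebra_simps)
    ultimately show ?thesis by (metis continuous_on_interior)
  qed
  then show "continuous_on UNIV g" by (simp add: continuous_on_eq_continuous_at)
qed

section \<open>Calculus rules for weak derivatives\<close>

lemma has_weak_deriv_L2:
  assumes "has_weak_deriv X f g"
  shows "f \<in> L2_per X" "g \<in> L2_per X"
  using assms by (auto simp: has_weak_deriv_def)

lemma L2_smooth: "smooth \<phi> \<Longrightarrow> periodic X \<phi> \<Longrightarrow> \<phi> \<in> L2_per X"
  by (intro L2_periodic_continuous smooth_continuous_on)

lemma test_derivative:
  fixes \<phi> :: "real \<Rightarrow> complex"
  assumes "smooth \<phi>" "periodic X \<phi>"
  shows "smooth (\<lambda>x. vector_derivative \<phi> (at x))" "periodic X (\<lambda>x. vector_derivative \<phi> (at x))"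
    "(\<lambda>x. vector_derivative \<phi> (at x)) \<in> L2_per X"
proof -
  show 1: "smooth (\<lambda>x. vector_derivative \<phi> (at x))" using assms(1) by (rule smooth_vector_derivative)
  show 2: "periodic X (\<lambda>x. vector_derivative \<phi> (at x))"
    using smooth_vector_derivative(2)[OF assms(1)] assms(2) by (rule periodic_deriv)
  show "(\<lambda>x. vector_derivative \<phi> (at x)) \<in> L2_per X" using 1 2 by (rule L2_smooth)
qed

lemma has_weak_deriv_cong:
  assumes fg: "has_weak_deriv X f g" and ae: "AE x in lborel. f x = f' x" "AE x in lborel. g x = g' x"
    and L2: "f' \<in> L2_per X" "g' \<in> L2_per X"
  shows "has_weak_deriv X f' g'"
  unfolding has_weak_deriv_def
proof (intro conjI L2 allI impI)
  fix \<phi> :: "real \<Rightarrow> complex" assume \<phi>: "smooth \<phi> \<and> periodic X \<phi>"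
  have [measurable]: "\<phi> \<in> borel_measurable borel"
    "(\<lambda>x. vector_derivative \<phi> (at x)) \<in> borel_measurable borel"
    using \<phi> test_derivative(3)[of \<phi> X] L2_smooth[of \<phi> X] L2D(1) by blast+
  note [measurable] = has_weak_deriv_L2(1)[OF fg, THEN L2D(1)] has_weak_deriv_L2(2)[OF fg, THEN L2D(1)]
    L2(1)[THEN L2D(1)] L2(2)[THEN L2D(1)]
  have "(LBINT x:{0..X}. f' x * vector_derivative \<phi> (at x)) = (LBINT x:{0..X}. f x * vector_derivative \<phi> (at x))"
    by (rule set_integral_L2_cong) (use ae(1) in auto)
  moreover have "(LBINT x:{0..X}. g' x * \<phi> x) = (LBINT x:{0..X}. g x * \<phi> x)"
    by (rule set_integral_L2_cong) (use ae(2) in auto)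
  ultimately show "(LBINT x:{0..X}. f' x * vector_derivative \<phi> (at x)) = - (LBINT x:{0..X}. g' x * \<phi> x)"
    using fg \<phi> by (simp add: has_weak_deriv_def)
qed

lemma has_weak_deriv_unique:
  assumes X: "X > 0" and fg: "has_weak_deriv X f g" "has_weak_deriv X f' g'"
    and ae: "AE x in lborel. f x = f' x"
  shows "AE x in lborel. g x = g' x"
proof -
  note L2 = fg[THEN has_weak_deriv_L2(1)] fg[THEN has_weak_deriv_L2(2)]
  have fg': "has_weak_deriv X f g'"
    using fg(2) by (rule has_weak_deriv_cong) (use ae L2 in \<open>auto elim!: eventually_mono\<close>)
  have "AE x in lborel. g x - g' x = 0"
  proof (rule AE_zero_if_orthogonal[OF _ X])
    show "(\<lambda>x. g x - g' x) \<in> L2_per X" using L2 by blast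
    fix \<phi> :: "real \<Rightarrow> complex" assume \<phi>: "smooth \<phi>" "periodic X \<phi>"
    have "(LBINT x:{0..X}. g x * \<phi> x) = (LBINT x:{0..X}. g' x * \<phi> x)"
      using fg(1) fg' \<phi> by (simp add: has_weak_deriv_def)
    then show "(LBINT x:{0..X}. (g x - g' x) * \<phi> x) = 0"
      using L2 L2_smooth[OF \<phi>] by (simp add: left_diff_distrib L2_mult_integrable)
  qed
  then show ?thesis by eventually_elim simp
qed

lemma has_weak_deriv_add:
  assumes "has_weak_deriv X f f'" "has_weak_deriv X g g'"
  shows "has_weak_deriv X (\<lambda>x. f x + g x) (\<lambda>x. f' x + g' x)"
  unfolding has_weak_deriv_def
proof (intro conjI allI impI)
  note L2 = assms[THEN has_weak_deriv_L2(1)] assms[THEN has_weak_deriv_L2(2)]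
  show "(\<lambda>x. f x + g x) \<in> L2_per X" "(\<lambda>x. f' x + g' x) \<in> L2_per X" using L2 by blast+
  fix \<phi> :: "real \<Rightarrow> complex" assume \<phi>: "smooth \<phi> \<and> periodic X \<phi>"
  then show "(LBINT x:{0..X}. (f x + g x) * vector_derivative \<phi> (at x)) =
      - (LBINT x:{0..X}. (f' x + g' x) * \<phi> x)"
    using assms L2 L2_smooth[of \<phi> X] test_derivative(3)[of \<phi> X]
    by (simp add: distrib_right L2_mult_integrable has_weak_deriv_def)
qed

lemma has_weak_deriv_cmult:
  assumes "has_weak_deriv X f f'"
  shows "has_weak_deriv X (\<lambda>x. k * f x) (\<lambda>x. k * f' x)"
  using assms by (auto simp: has_weak_deriv_def mult.assoc)

lemma has_weak_deriv_coef:
  assumes X: "X > 0" and p: "coef X p" and f: "has_weak_deriv X f f'"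
  shows "has_weak_deriv X (\<lambda>x. of_real (p x) * f x) (\<lambda>x. of_real (deriv p x) * f x + of_real (p x) * f' x)"
  unfolding has_weak_deriv_def
proof (intro conjI allI impI)
  note L2 = has_weak_deriv_L2[OF f]
  have L2': "(\<lambda>x. of_real (deriv p x) * f x) \<in> L2_per X" "(\<lambda>x. of_real (p x) * f x) \<in> L2_per X"
     "(\<lambda>x. of_real (p x) * f' x) \<in> L2_per X"
    using X p L2 by blast+
  show "(\<lambda>x. of_real (p x) * f x) \<in> L2_per X" by (rule L2'(2))
  show "(\<lambda>x. of_real (deriv p x) * f x + of_real (p x) * f' x) \<in> L2_per X"
    using L2'(1,3) by (rule L2_add)
  fix \<phi> :: "real \<Rightarrow> complex" assume \<phi>: "smooth \<phi> \<and> periodic X \<phi>"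
  \<comment> \<open>The product rule is transferred to the test function: \<open>?\<psi>\<close> is
    again smooth and periodic, and the weak derivative of \<open>f\<close> is tested against
    it.\<close>
  let ?\<psi> = "\<lambda>x. of_real (p x) * \<phi> x"
  have \<psi>: "smooth ?\<psi>" "periodic X ?\<psi>"
    using p \<phi> by (auto intro!: smooth_mult smooth_of_real simp: coef_def periodic_def)
  have "vector_derivative ?\<psi> (at x) = of_real (p x) * vector_derivative \<phi> (at x) + of_real (deriv p x) * \<phi> x" for x
    using \<phi> coefD(5)[OF p]
    by (intro vector_derivative_at has_vector_derivative_mult has_vector_derivative_of_real
        smooth_vector_derivative(2))
      (auto simp: real_vector_deriv)
  moreover have "(LBINT x:{0..X}. f x * vector_derivative ?\<psi> (at x)) = - (LBINT x:{0..X}. f' x * ?\<psi> x)"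
    using f \<psi> by (simp add: has_weak_deriv_def)
  ultimately have "(LBINT x:{0..X}. (of_real (p x) * f x) * vector_derivative \<phi> (at x) +
      (of_real (deriv p x) * f x) * \<phi> x) = - (LBINT x:{0..X}. (of_real (p x) * f' x) * \<phi> x)"
    by (simp add: algebra_simps)
  then have 1: "(LBINT x:{0..X}. (of_real (p x) * f x) * vector_derivative \<phi> (at x)) +
      (LBINT x:{0..X}. (of_real (deriv p x) * f x) * \<phi> x) = - (LBINT x:{0..X}. (of_real (p x) * f' x) * \<phi> x)"
    using L2' L2_smooth[of \<phi> X] test_derivative(3)[of \<phi> X] \<phi> by (simp add: L2_mult_integrable)
  have 2: "(LBINT x:{0..X}. (of_real (deriv p x) * f x + of_real (p x) * f' x) * \<phi> x) =
      (LBINT x:{0..X}. (of_real (deriv p x) * f x) * \<phi> x) + (LBINT x:{0..X}. (of_real (p x) * f' x) * \<phi> x)"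
    using L2' L2_smooth[of \<phi> X] \<phi> by (simp add: distrib_right L2_mult_integrable)
  show "(LBINT x:{0..X}. (of_real (p x) * f x) * vector_derivative \<phi> (at x)) =
      - (LBINT x:{0..X}. (of_real (deriv p x) * f x + of_real (p x) * f' x) * \<phi> x)"
    unfolding 2 using 1 by algebra
qed

lemma has_weak_deriv_cnj:
  assumes "has_weak_deriv X f f'"
  shows "has_weak_deriv X (\<lambda>x. cnj (f x)) (\<lambda>x. cnj (f' x))"
  unfolding has_weak_deriv_def
proof (intro conjI allI impI)
  show "(\<lambda>x. cnj (f x)) \<in> L2_per X" "(\<lambda>x. cnj (f' x)) \<in> L2_per X"
    using has_weak_deriv_L2[OF assms] by (auto intro: L2_cnj)
  fix \<phi> :: "real \<Rightarrow> complex" assume \<phi>: "smooth \<phi> \<and> periodic X \<phi>"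
  have sm: "smooth (\<lambda>x. cnj (\<phi> x))" using \<phi> by (intro smooth_bounded_linear[OF _ bounded_linear_cnj]) auto
  have cnj_int: "cnj (LBINT x:{0..X}. h x) = (LBINT x:{0..X}. cnj (h x))" for h
    unfolding set_lebesgue_integral_def by (simp flip: Bochner_Integration.integral_cnj)
  have "vector_derivative (\<lambda>x. cnj (\<phi> x)) (at x) = cnj (vector_derivative \<phi> (at x))" for x
    using \<phi> by (intro vector_derivative_at bounded_linear.has_vector_derivative[OF bounded_linear_cnj]
        smooth_vector_derivative(2)) auto
  moreover have "(LBINT x:{0..X}. f x * vector_derivative (\<lambda>x. cnj (\<phi> x)) (at x)) =
      - (LBINT x:{0..X}. f' x * cnj (\<phi> x))"
    using assms \<phi> sm by (simp add: has_weak_deriv_def periodic_def)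
  ultimately have "cnj (LBINT x:{0..X}. f x * cnj (vector_derivative \<phi> (at x))) =
      cnj (- (LBINT x:{0..X}. f' x * cnj (\<phi> x)))" by simp
  then show "(LBINT x:{0..X}. cnj (f x) * vector_derivative \<phi> (at x)) = - (LBINT x:{0..X}. cnj (f' x) * \<phi> x)"
    by (simp add: cnj_int)
qed

lemma has_weak_deriv_classical:
  fixes f :: "real \<Rightarrow> complex"
  assumes X: "X > 0" and f: "\<And>x. (f has_vector_derivative f' x) (at x)" "continuous_on UNIV f'" "periodic X f"
  shows "has_weak_deriv X f f'"
  unfolding has_weak_deriv_def
proof (intro conjI allI impI)
  have contf: "continuous_on UNIV f"
    using f(1) by (meson continuous_at_imp_continuous_on has_vector_derivative_continuous)
  have L2: "f \<in> L2_per X" "f' \<in> L2_per X"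
    using f contf periodic_deriv[OF f(1,3)] by (auto intro: L2_periodic_continuous)
  then show "f \<in> L2_per X" "f' \<in> L2_per X" .
  fix \<phi> :: "real \<Rightarrow> complex" assume \<phi>: "smooth \<phi> \<and> periodic X \<phi>"
  have "(LBINT x:{0..X}. f x * vector_derivative \<phi> (at x) + f' x * \<phi> x) = f X * \<phi> X - f 0 * \<phi> 0"
    using f(2) \<phi> contf X smooth_continuous_on[of \<phi> UNIV]
      smooth_continuous_on[OF smooth_vector_derivative(1), of \<phi> UNIV]
    by (intro set_integral_vector_derivative[of "\<lambda>x. f x * \<phi> x"] has_vector_derivative_mult f(1)
        smooth_vector_derivative(2) continuous_intros) auto
  also have "\<dots> = 0" using f(3) \<phi> unfolding periodic_def by (metis add_0 diff_self)
  finally show "(LBINT x:{0..X}. f x * vector_derivative \<phi> (at x)) = - (LBINT x:{0..X}. f' x * \<phi> x)"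
    using L2 \<phi> L2_smooth[of \<phi> X] test_derivative(3)[of \<phi> X]
    by (simp add: L2_mult_integrable eq_neg_iff_add_eq_0)
qed

section \<open>Primitives, continuous representatives and integration by parts\<close>

lemma has_weak_deriv_mean_zero:
  assumes "has_weak_deriv X f g"
  shows "(LBINT x:{0..X}. g x) = 0"
  using assms unfolding has_weak_deriv_def
  by (auto dest!: spec[of _ "\<lambda>_. 1"] simp: periodic_def)

text \<open>Vanishing mean makes the integral from 0 take equal values at 0 and \<open>X\<close>, so
  it extends continuously and periodically; integration by parts against test functions identifies
  its weak derivative.\<close>

lemma has_weak_deriv_primitive:
  assumes X: "X > 0" and g: "g \<in> L2_per X" "(LBINT x:{0..X}. g x) = 0"
  obtains G where "continuous_on UNIV G" "has_weak_deriv X G g"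
    "\<And>x. x \<in> {0..X} \<Longrightarrow> G x = (LBINT y:{0..x}. g y)"
proof -
  note gi = L2_integrable[OF g(1)]
  define P where "P = (\<lambda>x. LBINT y:{0..x}. g y)"
  have "P x = integral {0..x} g" if "x \<in> {0..X}" for x
    unfolding P_def using that
    by (intro set_borel_integral_eq_integral set_integrable_subset[OF gi]) auto
  then have "continuous_on {0..X} P"
    by (intro continuous_on_eq[OF indefinite_integral_continuous_1[OF set_borel_integral_eq_integral(1)[OF gi]]]) simp
  moreover have "P 0 = P X"
  proof -
    have "(LBINT y:{0..0}. g y) = 0"
      unfolding set_lebesgue_integral_def
    proof (rule integral_eq_zero_AE)
      show "AE y in lborel. indicator {0..0} y *\<^sub>R g y = 0"
        using AE_lborel_singleton[of "0::real"] by eventually_elim simp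
    qed
    then show ?thesis using g(2) by (simp add: P_def)
  qed
  ultimately obtain G where G: "continuous_on UNIV G" "periodic X G" "\<And>x. x \<in> {0..X} \<Longrightarrow> G x = P x"
    using periodic_continuous_extension[of X P] X by metis
  have "has_weak_deriv X G g"
    unfolding has_weak_deriv_def
  proof (intro conjI allI impI g(1) L2_periodic_continuous G)
    fix \<phi> :: "real \<Rightarrow> complex" assume \<phi>: "smooth \<phi> \<and> periodic X \<phi>"
    let ?d = "\<lambda>x. vector_derivative \<phi> (at x)"
    have d: "(LBINT y:{0..x}. ?d y) = \<phi> x - \<phi> 0" if "x \<ge> 0" for x
      using \<phi> that by (intro set_integral_vector_derivative smooth_vector_derivative(2)
          smooth_continuous_on smooth_vector_derivative(1)) auto
    have dX: "(LBINT y:{0..X}. ?d y) = 0"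
      using d[of X] X \<phi> unfolding periodic_def by (metis add_0 diff_self less_imp_le)
    have "(LBINT x:{0..X}. g x * (LBINT y:{0..x}. ?d y)) + (LBINT x:{0..X}. (LBINT y:{0..x}. g y) * ?d x) = 0"
      using integration_by_parts_primitive(2)[OF gi L2_integrable[OF test_derivative(3)[of \<phi> X]]] \<phi> dX
      by simp
    also have "(LBINT x:{0..X}. (LBINT y:{0..x}. g y) * ?d x) = (LBINT x:{0..X}. G x * ?d x)"
      using G(3) by (intro set_lebesgue_integral_cong) (auto simp: P_def)
    also have "(LBINT x:{0..X}. g x * (LBINT y:{0..x}. ?d y)) = (LBINT x:{0..X}. g x * \<phi> x - g x * \<phi> 0)"
      by (intro set_lebesgue_integral_cong) (auto simp: d right_diff_distrib)
    also have "\<dots> = (LBINT x:{0..X}. g x * \<phi> x)"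
      using g gi L2_smooth[of \<phi> X] \<phi> by (simp add: L2_mult_integrable)
    finally show "(LBINT x:{0..X}. G x * ?d x) = - (LBINT x:{0..X}. g x * \<phi> x)"
      by (simp add: eq_neg_iff_add_eq_0 add.commute)
  qed
  with G that show thesis unfolding P_def by blast
qed

text \<open>Du Bois-Reymond's argument: a test function \<psi> minus its mean \<open>m\<close> is
  the derivative of a periodic \<phi>, so \<open>f\<close> is orthogonal to
  \<open>\<psi> - m\<close>. With \<open>c\<close> the mean of \<open>f\<close> this says that
  \<open>f - c\<close> is orthogonal to every \<psi>.\<close>

lemma has_weak_deriv_zero:
  assumes X: "X > 0" and f: "has_weak_deriv X f (\<lambda>_. 0)"
  obtains c where "AE x in lborel. f x = c"
proof -
  define c where "c = (LBINT x:{0..X}. f x) / of_real X"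
  note L2 = has_weak_deriv_L2(1)[OF f]
  have one: "(LBINT x:{0..X}. 1 :: complex) = of_real X"
    using set_integral_vector_derivative[of "\<lambda>x. complex_of_real x" "\<lambda>_. 1" 0 X] X
    by (auto intro!: derivative_eq_intros has_vector_derivative_of_real[of "\<lambda>x. x" 1, simplified])
  have cL2: "(\<lambda>_. c) \<in> L2_per X" using L2_cmult[OF L2_one[of X], of c] by simp
  have "AE x in lborel. f x - c = 0"
  proof (rule AE_zero_if_orthogonal[OF _ X])
    show L2c: "(\<lambda>x. f x - c) \<in> L2_per X" using L2_diff[OF L2 cL2] .
    fix \<psi> :: "real \<Rightarrow> complex" assume \<psi>: "smooth \<psi>" "periodic X \<psi>"
    define m where "m = (LBINT x:{0..X}. \<psi> x) / of_real X"
    obtain P where P: "P 0 = 0" "\<And>x. (P has_vector_derivative \<psi> x) (at x)"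
      using antiderivative_on_line[OF smooth_continuous_on[OF \<psi>(1)]] by blast
    \<comment> \<open>Subtracting the linear function removes the increment of \<open>P\<close> over
      one period.\<close>
    define \<phi> where "\<phi> = (\<lambda>x. P x - m * of_real x)"
    have d\<phi>: "(\<phi> has_vector_derivative \<psi> x - m) (at x)" for x
      unfolding \<phi>_def using P(2) has_vector_derivative_of_real[of "\<lambda>x. x" 1 "at x", where 'a=complex]
      by (auto intro!: derivative_eq_intros)
    have "smooth \<phi>" by (rule smoothI_deriv[OF _ d\<phi>]) (use \<psi> in auto)
    moreover have "periodic X \<phi>"
    proof -
      have "((\<lambda>x. \<phi> (x + X) - \<phi> x) has_vector_derivative 0) (at x)" for x
      proof -
        have "((\<lambda>x. \<phi> (x + X)) has_vector_derivative \<psi> (x + X) - m) (at x)"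
          using vector_diff_chain_at[of "\<lambda>x. x + X" 1 x \<phi> "\<psi> (x + X) - m"] d\<phi>
          by (simp add: o_def has_vector_derivative_add_const)
        from has_vector_derivative_diff[OF this d\<phi>] show ?thesis
          using \<psi>(2) by (simp add: periodic_def)
      qed
      then have "\<phi> (x + X) - \<phi> x = \<phi> (0 + X) - \<phi> 0" for x by (rule zero_deriv_const)
      moreover have "P X - P 0 = m * of_real X"
        using set_integral_vector_derivative[OF P(2) smooth_continuous_on[OF \<psi>(1)], of 0 X] X
        by (simp add: m_def)
      ultimately show ?thesis using P(1) by (simp add: periodic_def \<phi>_def)
    qed
    ultimately have "(LBINT x:{0..X}. f x * vector_derivative \<phi> (at x)) = 0"
      using f by (simp add: has_weak_deriv_def)
    moreover have "vector_derivative \<phi> (at x) = \<psi> x - m" for x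
      using d\<phi> by (rule vector_derivative_at)
    ultimately have *: "(LBINT x:{0..X}. f x * \<psi> x) = (LBINT x:{0..X}. f x) * m"
      using L2 L2_smooth[OF \<psi>] by (simp add: right_diff_distrib L2_mult_integrable L2_integrable)
    show "(LBINT x:{0..X}. (f x - c) * \<psi> x) = 0"
      using L2 L2_smooth[OF \<psi>] * X
      by (simp add: left_diff_distrib L2_mult_integrable L2_integrable c_def m_def)
  qed
  then show thesis by (intro that[of c]) (auto elim!: eventually_mono)
qed

text \<open>One-dimensional Sobolev embedding: \<open>f\<close> minus the periodic primitive of
  \<open>g\<close> has weak derivative zero and so is constant. It serves integration by parts and,
  for positive \<open>s\<close>, provides continuous data for the differential equation.\<close>

lemma has_weak_deriv_continuous_rep:
  assumes X: "X > 0" and f: "has_weak_deriv X f g"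
  obtains F c where "continuous_on UNIV F" "periodic X F" "AE x in lborel. f x = F x"
    "\<And>x. x \<in> {0..X} \<Longrightarrow> F x = c + (LBINT y:{0..x}. g y)"
proof -
  obtain G where G: "continuous_on UNIV G" "has_weak_deriv X G g"
    "\<And>x. x \<in> {0..X} \<Longrightarrow> G x = (LBINT y:{0..x}. g y)"
    using has_weak_deriv_primitive[OF X has_weak_deriv_L2(2)[OF f] has_weak_deriv_mean_zero[OF f]] by blast
  have "has_weak_deriv X (\<lambda>x. f x + (-1) * G x) (\<lambda>x. g x + (-1) * g x)"
    by (intro has_weak_deriv_add has_weak_deriv_cmult f G)
  then have "has_weak_deriv X (\<lambda>x. f x - G x) (\<lambda>_. 0)" by simp
  then obtain c where c: "AE x in lborel. f x - G x = c" using has_weak_deriv_zero[OF X] by blast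
  show thesis
  proof (rule that[of "\<lambda>x. c + G x" c])
    show "continuous_on UNIV (\<lambda>x. c + G x)" using G(1) by (intro continuous_intros)
    show "periodic X (\<lambda>x. c + G x)" using L2D(2)[OF has_weak_deriv_L2(1)[OF G(2)]] by (simp add: periodic_def)
    show "AE x in lborel. f x = c + G x" using c by eventually_elim auto
  qed (use G in auto)
qed

text \<open>Both functions are replaced by a constant plus a primitive. The constants drop out
  because \<open>f'\<close> and \<open>g'\<close> have mean zero, and so does the boundary term,
  which is the product of these means.\<close>

lemma has_weak_deriv_ibp:
  assumes X: "X > 0" and f: "has_weak_deriv X f f'" and g: "has_weak_deriv X g g'"
  shows "(LBINT x:{0..X}. f' x * g x) + (LBINT x:{0..X}. f x * g' x) = 0"
proof -
  obtain F c where F: "AE x in lborel. f x = F x" "continuous_on UNIV F"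
    "\<And>x. x \<in> {0..X} \<Longrightarrow> F x = c + (LBINT y:{0..x}. f' y)"
    using has_weak_deriv_continuous_rep[OF X f] by metis
  obtain G d where G: "AE x in lborel. g x = G x" "continuous_on UNIV G"
    "\<And>x. x \<in> {0..X} \<Longrightarrow> G x = d + (LBINT y:{0..x}. g' y)"
    using has_weak_deriv_continuous_rep[OF X g] by metis
  note L2 = has_weak_deriv_L2[OF f] has_weak_deriv_L2[OF g]
  note int = L2(2)[THEN L2_integrable] L2(4)[THEN L2_integrable]
  note z = has_weak_deriv_mean_zero[OF f] has_weak_deriv_mean_zero[OF g]
  note [measurable] = L2(1)[THEN L2D(1)] L2(2)[THEN L2D(1)] L2(3)[THEN L2D(1)] L2(4)[THEN L2D(1)]
    borel_measurable_continuous_onI[OF F(2)] borel_measurable_continuous_onI[OF G(2)]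
  note parts = integration_by_parts_primitive[OF int] integration_by_parts_primitive(1)[OF int(2,1)]
  have "(LBINT x:{0..X}. f' x * g x) = (LBINT x:{0..X}. f' x * G x)"
    by (rule set_integral_L2_cong) (use G(1) in auto)
  also have "\<dots> = (LBINT x:{0..X}. f' x * d + f' x * (LBINT y:{0..x}. g' y))"
    by (rule set_lebesgue_integral_cong) (auto simp: G(3) algebra_simps)
  also have "\<dots> = (LBINT x:{0..X}. f' x * (LBINT y:{0..x}. g' y))"
    using int parts(1) z(1) by simp
  finally have 1: "(LBINT x:{0..X}. f' x * g x) = \<dots>" .
  have "(LBINT x:{0..X}. f x * g' x) = (LBINT x:{0..X}. F x * g' x)"
    by (rule set_integral_L2_cong) (use F(1) in auto)
  also have "\<dots> = (LBINT x:{0..X}. c * g' x + (LBINT y:{0..x}. f' y) * g' x)"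
    by (rule set_lebesgue_integral_cong) (auto simp: F(3) algebra_simps)
  also have "\<dots> = (LBINT x:{0..X}. (LBINT y:{0..x}. f' y) * g' x)"
    using int parts(3) z(2) by (simp add: mult.commute)
  finally show ?thesis using 1 parts(2) z by simp
qed

section \<open>Bloch derivatives and Sobolev spaces\<close>

lemma H_per_L2: "f \<in> H_per X k \<Longrightarrow> f \<in> L2_per X"
  by (cases k) auto

lemma H_per_cong:
  assumes "f \<in> H_per X k" "AE x in lborel. f x = f' x" "f' \<in> L2_per X"
  shows "f' \<in> H_per X k"
proof (cases k)
  case (Suc j)
  then obtain g where g: "g \<in> H_per X j" "has_weak_deriv X f g" using assms(1) by auto
  then have "has_weak_deriv X f' g"
    using assms by (intro has_weak_deriv_cong[OF g(2)]) (auto simp: has_weak_deriv_def)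
  with Suc g assms(3) show ?thesis by auto
qed (use assms in auto)

text \<open>The equality holds everywhere, not just almost everywhere: both sides are the
  \<open>SOME\<close> choice from one and the same predicate.\<close>

lemma weak_deriv_cong:
  assumes "AE x in lborel. f x = f' x" "f \<in> L2_per X" "f' \<in> L2_per X"
  shows "weak_deriv X f = weak_deriv X f'"
proof -
  have ae: "AE x in lborel. f' x = f x" using assms(1) by eventually_elim simp
  have "has_weak_deriv X f g \<longleftrightarrow> has_weak_deriv X f' g" for g
  proof
    assume g: "has_weak_deriv X f g"
    show "has_weak_deriv X f' g"
      by (rule has_weak_deriv_cong[OF g assms(1) _ assms(3) has_weak_deriv_L2(2)[OF g]]) simp
  next
    assume g: "has_weak_deriv X f' g"
    show "has_weak_deriv X f g"
      by (rule has_weak_deriv_cong[OF g ae _ assms(2) has_weak_deriv_L2(2)[OF g]]) simp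
  qed
  then have "has_weak_deriv X f = has_weak_deriv X f'" by blast
  then show ?thesis by (simp add: weak_deriv_def)
qed

lemma H_per_Suc_mono: "f \<in> H_per X (Suc k) \<Longrightarrow> f \<in> H_per X k"
proof (induction k arbitrary: f)
  case (Suc k)
  then obtain g where "g \<in> H_per X (Suc k)" "has_weak_deriv X f g" "f \<in> L2_per X" by auto
  with Suc.IH[of g] show ?case by auto
qed auto

lemma H_per_mono: "f \<in> H_per X k \<Longrightarrow> j \<le> k \<Longrightarrow> f \<in> H_per X j"
  by (induction k) (auto simp del: H_per.simps simp: le_Suc_eq dest: H_per_Suc_mono)

lemma H_per_SucI: "has_weak_deriv X f g \<Longrightarrow> g \<in> H_per X k \<Longrightarrow> f \<in> H_per X (Suc k)"
  by (auto simp: has_weak_deriv_def)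

lemma H_per_SucE:
  assumes "f \<in> H_per X (Suc k)"
  obtains g where "has_weak_deriv X f g" "g \<in> H_per X k"
  using assms by auto

lemma H_per_add:
  "f \<in> H_per X k \<Longrightarrow> g \<in> H_per X k \<Longrightarrow> (\<lambda>x. f x + g x) \<in> H_per X k"
proof (induction k arbitrary: f g)
  case (Suc k)
  obtain f' g' where "has_weak_deriv X f f'" "f' \<in> H_per X k" "has_weak_deriv X g g'" "g' \<in> H_per X k"
    using Suc.prems by (blast elim: H_per_SucE)
  then show ?case by (intro H_per_SucI[OF has_weak_deriv_add] Suc.IH)
qed auto

lemma H_per_cmult:
  "f \<in> H_per X k \<Longrightarrow> (\<lambda>x. c * f x) \<in> H_per X k"
proof (induction k arbitrary: f)
  case (Suc k)
  obtain f' where "has_weak_deriv X f f'" "f' \<in> H_per X k"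
    using Suc.prems by (blast elim: H_per_SucE)
  then show ?case by (intro H_per_SucI[OF has_weak_deriv_cmult] Suc.IH)
qed auto

lemma H_per_diff:
  assumes "f \<in> H_per X k" "g \<in> H_per X k" shows "(\<lambda>x. f x - g x) \<in> H_per X k"
  using H_per_add[OF assms(1) H_per_cmult[OF assms(2), of "-1"]] by simp

lemma H_per_coef:
  "X > 0 \<Longrightarrow> coef X p \<Longrightarrow> f \<in> H_per X k \<Longrightarrow> (\<lambda>x. of_real (p x) * f x) \<in> H_per X k"
proof (induction k arbitrary: f p)
  case (Suc k)
  obtain f' where f': "has_weak_deriv X f f'" "f' \<in> H_per X k"
    using Suc.prems by (blast elim: H_per_SucE)
  then show ?case
    using Suc.prems H_per_Suc_mono[OF Suc.prems(3)]
    by (intro H_per_SucI[OF has_weak_deriv_coef] H_per_add Suc.IH coef_deriv)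
qed auto

lemmas H_per_closed = H_per_add H_per_diff H_per_cmult H_per_coef

text \<open>Relational counterpart of \<open>bloch_deriv\<close>. It admits every representative of
  the derivative, so the sum and product rules hold literally; for the choice made by
  \<open>bloch_deriv\<close> they hold only almost everywhere.\<close>

definition has_bloch_deriv :: "real \<Rightarrow> real \<Rightarrow> (real \<Rightarrow> complex) \<Rightarrow> (real \<Rightarrow> complex) \<Rightarrow> bool" where
  "has_bloch_deriv X \<xi> f g \<longleftrightarrow> has_weak_deriv X f (\<lambda>x. g x - \<i> * of_real \<xi> * f x)"

lemma has_bloch_deriv_L2:
  assumes "has_bloch_deriv X \<xi> f g"
  shows "f \<in> L2_per X" "g \<in> L2_per X"
proof -
  have *: "f \<in> L2_per X" "(\<lambda>x. g x - \<i> * of_real \<xi> * f x) \<in> L2_per X"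
    using assms has_weak_deriv_L2 unfolding has_bloch_deriv_def by blast+
  then show "f \<in> L2_per X" "g \<in> L2_per X"
    using L2_add[OF *(2) L2_cmult[OF *(1), of "\<i> * of_real \<xi>"]] by simp_all
qed

lemma bloch_derivI:
  assumes "f \<in> H_per X (Suc k)"
  shows "has_bloch_deriv X \<xi> f (bloch_deriv X \<xi> f)"
  using assms someI_ex[of "has_weak_deriv X f"]
  by (auto simp: has_bloch_deriv_def bloch_deriv_def weak_deriv_def)

lemma has_bloch_deriv_unique:
  assumes "X > 0" "has_bloch_deriv X \<xi> f g" "has_bloch_deriv X \<xi> f' g'" "AE x in lborel. f x = f' x"
  shows "AE x in lborel. g x = g' x"
proof -
  have "AE x in lborel. g x - \<i> * of_real \<xi> * f x = g' x - \<i> * of_real \<xi> * f' x"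
    by (rule has_weak_deriv_unique[OF assms(1) assms(2,3)[unfolded has_bloch_deriv_def] assms(4)])
  with assms(4) show ?thesis by eventually_elim simp
qed

lemma bloch_deriv_AE:
  assumes "X > 0" "has_bloch_deriv X \<xi> f g"
  shows "AE x in lborel. bloch_deriv X \<xi> f x = g x"
proof -
  have "has_bloch_deriv X \<xi> f (bloch_deriv X \<xi> f)"
    using assms(2) someI_ex[of "has_weak_deriv X f"]
    by (auto simp: has_bloch_deriv_def bloch_deriv_def weak_deriv_def)
  then show ?thesis using assms by (blast intro: has_bloch_deriv_unique)
qed

lemma has_bloch_deriv_add:
  assumes "has_bloch_deriv X \<xi> f f'" "has_bloch_deriv X \<xi> g g'"
  shows "has_bloch_deriv X \<xi> (\<lambda>x. f x + g x) (\<lambda>x. f' x + g' x)"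
  using has_weak_deriv_add[OF assms[unfolded has_bloch_deriv_def]]
  by (simp add: has_bloch_deriv_def algebra_simps)

lemma has_bloch_deriv_cmult:
  assumes "has_bloch_deriv X \<xi> f f'"
  shows "has_bloch_deriv X \<xi> (\<lambda>x. c * f x) (\<lambda>x. c * f' x)"
  using has_weak_deriv_cmult[OF assms[unfolded has_bloch_deriv_def], of c]
  by (simp add: has_bloch_deriv_def algebra_simps)

lemma has_bloch_deriv_diff:
  assumes "has_bloch_deriv X \<xi> f f'" "has_bloch_deriv X \<xi> g g'"
  shows "has_bloch_deriv X \<xi> (\<lambda>x. f x - g x) (\<lambda>x. f' x - g' x)"
  using has_bloch_deriv_add[OF assms(1) has_bloch_deriv_cmult[OF assms(2), of "-1"]] by simp

lemma has_bloch_deriv_coef: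
  assumes "X > 0" "coef X p" "has_bloch_deriv X \<xi> f f'"
  shows "has_bloch_deriv X \<xi> (\<lambda>x. of_real (p x) * f x) (\<lambda>x. of_real (deriv p x) * f x + of_real (p x) * f' x)"
  using has_weak_deriv_coef[OF assms(1,2) assms(3)[unfolded has_bloch_deriv_def]]
  by (simp add: has_bloch_deriv_def algebra_simps)

lemma ip_diff_right:
  assumes "f \<in> L2_per X" "g \<in> L2_per X" "h \<in> L2_per X"
  shows "ip X h (\<lambda>x. f x - g x) = ip X h f - ip X h g"
  using ip_add_right[OF assms(1) L2_cmult[OF assms(2), of "-1"] assms(3)] ip_mult_right[of X h "-1" g] by simp

text \<open>Skew-adjointness: \<open>\<i> * \<xi>\<close> is purely imaginary, so its two
  contributions cancel after conjugation. All energy estimates rest on this identity, which has the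
  same form for every \<xi>.\<close>

lemma ip_bloch_deriv:
  assumes X: "X > 0" and f: "has_bloch_deriv X \<xi> f f'" and g: "has_bloch_deriv X \<xi> g g'"
  shows "ip X f' g = - ip X f g'"
proof -
  note L2 = has_bloch_deriv_L2[OF f] has_bloch_deriv_L2[OF g]
  have "(LBINT x:{0..X}. (f' x - \<i> * of_real \<xi> * f x) * cnj (g x)) +
      (LBINT x:{0..X}. f x * cnj (g' x - \<i> * of_real \<xi> * g x)) = 0"
    using X f g unfolding has_bloch_deriv_def by (intro has_weak_deriv_ibp has_weak_deriv_cnj)
  then have "ip X (\<lambda>x. f' x - (\<i> * of_real \<xi>) * f x) g + ip X f (\<lambda>x. g' x - (\<i> * of_real \<xi>) * g x) = 0"
    by (simp add: ip_def)
  then show ?thesis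
    using L2 by (simp add: ip_diff_left ip_diff_right L2_cmult ip_mult_left ip_mult_right
        eq_neg_iff_add_eq_0)
qed

lemma bloch_deriv_H_per:
  assumes "f \<in> H_per X (Suc k)" "X > 0"
  shows "bloch_deriv X \<xi> f \<in> H_per X k"
proof -
  obtain g where g: "has_weak_deriv X f g" "g \<in> H_per X k" using assms(1) by (rule H_per_SucE)
  have h: "(\<lambda>x. g x + \<i> * of_real \<xi> * f x) \<in> H_per X k"
    using g(2) H_per_Suc_mono[OF assms(1)] by (intro H_per_add H_per_cmult)
  have "has_bloch_deriv X \<xi> f (\<lambda>x. g x + \<i> * of_real \<xi> * f x)"
    using g by (simp add: has_bloch_deriv_def)
  then have "AE x in lborel. bloch_deriv X \<xi> f x = g x + \<i> * of_real \<xi> * f x"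
    by (rule bloch_deriv_AE[OF assms(2)])
  then show ?thesis
    using h has_bloch_deriv_L2(2)[OF bloch_derivI[OF assms(1), of \<xi>]]
    by (intro H_per_cong[OF h]) (auto elim!: eventually_mono)
qed

lemma H_per_SucI_bloch:
  assumes "has_bloch_deriv X \<xi> f g" "f \<in> H_per X k" "g \<in> H_per X k"
  shows "f \<in> H_per X (Suc k)"
  using assms(1) unfolding has_bloch_deriv_def
  by (rule H_per_SucI) (intro H_per_closed assms)

lemma bloch_deriv_cong:
  assumes "X > 0" "AE x in lborel. f x = f' x" "f \<in> L2_per X" "f' \<in> L2_per X"
  shows "AE x in lborel. bloch_deriv X \<xi> f x = bloch_deriv X \<xi> f' x"
  using assms(2) weak_deriv_cong[OF assms(2-4)] by (auto simp: bloch_deriv_def elim!: eventually_mono)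

text \<open>A sum of norms, where \<open>state_norm\<close> has the root of a sum of squares; the
  recursion passes to the derivative, so inductions on \<open>k\<close> apply their hypothesis
  directly to \<open>bloch_deriv\<close>. The two norms are equivalent with constants depending on
  the order alone.\<close>

fun H_norm :: "real \<Rightarrow> real \<Rightarrow> nat \<Rightarrow> (real \<Rightarrow> complex) \<Rightarrow> real" where
  "H_norm X \<xi> 0 f = L2_norm X f"
| "H_norm X \<xi> (Suc k) f = L2_norm X f + H_norm X \<xi> k (bloch_deriv X \<xi> f)"

lemma H_norm_nonneg [simp]: "0 \<le> H_norm X \<xi> k f"
  by (induction k arbitrary: f) auto

lemma H_norm_cong:
  assumes "X > 0" "AE x in lborel. f x = f' x" "f \<in> H_per X k" "f' \<in> H_per X k"
  shows "H_norm X \<xi> k f = H_norm X \<xi> k f'"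
  using assms(2-)
proof (induction k arbitrary: f f')
  case 0
  then show ?case by (auto intro: L2_norm_cong dest: L2D(1))
next
  case (Suc k)
  note L2 = Suc.prems(2,3)[THEN H_per_L2]
  have "L2_norm X f = L2_norm X f'"
    using Suc.prems(1) L2 by (intro L2_norm_cong) (auto dest: L2D(1))
  moreover have "H_norm X \<xi> k (bloch_deriv X \<xi> f) = H_norm X \<xi> k (bloch_deriv X \<xi> f')"
    using Suc.prems L2 assms(1) by (intro Suc.IH bloch_deriv_cong bloch_deriv_H_per)
  ultimately show ?case by simp
qed

lemma H_norm_eq_bloch_deriv:
  assumes "X > 0" "has_bloch_deriv X \<xi> f g" "f \<in> H_per X (Suc k)" "g \<in> H_per X k"
  shows "H_norm X \<xi> (Suc k) f = L2_norm X f + H_norm X \<xi> k g"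
  using H_norm_cong[OF assms(1) bloch_deriv_AE[OF assms(1,2)] bloch_deriv_H_per[OF assms(3,1)] assms(4)]
  by simp

lemma H_norm_Suc_mono: "H_norm X \<xi> k f \<le> H_norm X \<xi> (Suc k) f"
  by (induction k arbitrary: f) auto

lemma H_norm_add:
  assumes X: "X > 0"
  shows "f \<in> H_per X k \<Longrightarrow> g \<in> H_per X k \<Longrightarrow>
    H_norm X \<xi> k (\<lambda>x. f x + g x) \<le> H_norm X \<xi> k f + H_norm X \<xi> k g"
proof (induction k arbitrary: f g)
  case 0
  then show ?case by (simp add: L2_norm_triangle)
next
  case (Suc k)
  note D = bloch_derivI[OF Suc.prems(1), of \<xi>] bloch_derivI[OF Suc.prems(2), of \<xi>]
  note H = bloch_deriv_H_per[OF Suc.prems(1) X, of \<xi>] bloch_deriv_H_per[OF Suc.prems(2) X, of \<xi>]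
  have "H_norm X \<xi> (Suc k) (\<lambda>x. f x + g x) = L2_norm X (\<lambda>x. f x + g x) +
      H_norm X \<xi> k (\<lambda>x. bloch_deriv X \<xi> f x + bloch_deriv X \<xi> g x)"
    by (intro H_norm_eq_bloch_deriv X has_bloch_deriv_add D H_per_add H Suc.prems)
  also have "\<dots> \<le> (L2_norm X f + L2_norm X g) +
      (H_norm X \<xi> k (bloch_deriv X \<xi> f) + H_norm X \<xi> k (bloch_deriv X \<xi> g))"
    using Suc.prems[THEN H_per_L2] H by (intro add_mono L2_norm_triangle Suc.IH)
  finally show ?case by simp
qed

lemma H_norm_cmult:
  assumes X: "X > 0"
  shows "f \<in> H_per X k \<Longrightarrow> H_norm X \<xi> k (\<lambda>x. c * f x) = cmod c * H_norm X \<xi> k f"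
proof (induction k arbitrary: f)
  case 0
  then show ?case by (simp add: L2_norm_cmult)
next
  case (Suc k)
  note D = bloch_derivI[OF Suc.prems, of \<xi>]
  note H = bloch_deriv_H_per[OF Suc.prems X, of \<xi>]
  have "H_norm X \<xi> (Suc k) (\<lambda>x. c * f x) = L2_norm X (\<lambda>x. c * f x) + H_norm X \<xi> k (\<lambda>x. c * bloch_deriv X \<xi> f x)"
    by (intro H_norm_eq_bloch_deriv X has_bloch_deriv_cmult D H_per_cmult H Suc.prems)
  then show ?case by (simp add: Suc.IH[OF H] L2_norm_cmult distrib_left)
qed

lemma H_norm_diff:
  assumes X: "X > 0" and f: "f \<in> H_per X k" "g \<in> H_per X k"
  shows "H_norm X \<xi> k (\<lambda>x. f x - g x) \<le> H_norm X \<xi> k f + H_norm X \<xi> k g"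
  using H_norm_add[OF X f(1) H_per_cmult[OF f(2), of "-1"], of \<xi>] H_norm_cmult[OF X f(2), of \<xi> "-1"]
  by simp

text \<open>The order of quantifiers matters: one \<open>M\<close> serves all \<xi>. The induction
  runs over all coefficients at once because the product rule brings in
  \<open>deriv p\<close>.\<close>

lemma H_norm_coef_le:
  assumes X: "X > 0" and p: "coef X p"
  obtains M where "M > 0"
    "\<And>\<xi> f. f \<in> H_per X k \<Longrightarrow> H_norm X \<xi> k (\<lambda>x. of_real (p x) * f x) \<le> M * H_norm X \<xi> k f"
proof -
  have "\<exists>M>0. \<forall>\<xi> f. f \<in> H_per X k \<longrightarrow> H_norm X \<xi> k (\<lambda>x. of_real (p x) * f x) \<le> M * H_norm X \<xi> k f"
    using p
  proof (induction k arbitrary: p)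
    case 0
    obtain M where "M > 0" "\<And>x. \<bar>p x\<bar> \<le> M" using coef_bounded[OF 0 X] by blast
    then show ?case using L2_norm_mult_le[OF _ 0 _ X, of _ M] by (intro exI[of _ M]) auto
  next
    case (Suc k)
    obtain M where M: "M > 0" "\<And>x. \<bar>p x\<bar> \<le> M" using coef_bounded[OF Suc.prems X] by blast
    obtain M1 where M1: "M1 > 0"
      "\<And>\<xi> f. f \<in> H_per X k \<Longrightarrow> H_norm X \<xi> k (\<lambda>x. of_real (p x) * f x) \<le> M1 * H_norm X \<xi> k f"
      using Suc.IH[OF Suc.prems] by blast
    obtain M2 where M2: "M2 > 0"
      "\<And>\<xi> f. f \<in> H_per X k \<Longrightarrow> H_norm X \<xi> k (\<lambda>x. of_real (deriv p x) * f x) \<le> M2 * H_norm X \<xi> k f"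
      using Suc.IH[OF coef_deriv[OF Suc.prems]] by blast
    show ?case
    proof (intro exI[of _ "M + M1 + M2"] conjI allI impI)
      show "M + M1 + M2 > 0" using M M1 M2 by simp
      fix \<xi> f assume f: "f \<in> H_per X (Suc k)"
      let ?D = "bloch_deriv X \<xi> f"
      note D = bloch_derivI[OF f, of \<xi>]
      note H = bloch_deriv_H_per[OF f X, of \<xi>] H_per_Suc_mono[OF f]
      have "H_norm X \<xi> (Suc k) (\<lambda>x. of_real (p x) * f x) = L2_norm X (\<lambda>x. of_real (p x) * f x) +
          H_norm X \<xi> k (\<lambda>x. of_real (deriv p x) * f x + of_real (p x) * ?D x)"
        by (intro H_norm_eq_bloch_deriv X has_bloch_deriv_coef D H_per_add H_per_coef coef_deriv H f Suc.prems)
      also have "\<dots> \<le> M * L2_norm X f + (M2 * H_norm X \<xi> k f + M1 * H_norm X \<xi> k ?D)"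
      proof (intro add_mono)
        show "L2_norm X (\<lambda>x. of_real (p x) * f x) \<le> M * L2_norm X f"
          by (rule L2_norm_mult_le[OF H_per_L2[OF f] Suc.prems M(2) X])
        show "H_norm X \<xi> k (\<lambda>x. of_real (deriv p x) * f x + of_real (p x) * ?D x) \<le>
            M2 * H_norm X \<xi> k f + M1 * H_norm X \<xi> k ?D"
          by (rule order_trans[OF H_norm_add add_mono[OF M2(2) M1(2)]])
            (intro X H H_per_coef coef_deriv Suc.prems)+
      qed
      also have "\<dots> \<le> M * L2_norm X f + (M2 * (L2_norm X f + H_norm X \<xi> k ?D) + M1 * H_norm X \<xi> k ?D)"
        using H_norm_Suc_mono[of X \<xi> k f] M2(1) by (intro add_mono mult_left_mono order_refl) auto
      also have "\<dots> \<le> (M + M1 + M2) * H_norm X \<xi> (Suc k) f"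
        using M(1) M1(1) M2(1) by (simp add: algebra_simps)
      finally show "H_norm X \<xi> (Suc k) (\<lambda>x. of_real (p x) * f x) \<le> (M + M1 + M2) * H_norm X \<xi> (Suc k) f" .
    qed
  qed
  with that show thesis by blast
qed

lemma H_norm_eq_sum: "H_norm X \<xi> k f = (\<Sum>j\<le>k. L2_norm X ((bloch_deriv X \<xi> ^^ j) f))"
proof (induction k arbitrary: f)
  case (Suc k)
  then show ?case
    by (simp add: sum.atMost_Suc_shift funpow_swap1 del: sum.atMost_Suc)
qed simp

section \<open>The resolvent estimate in the square-integrable setting\<close>

lemma ip_cong_left:
  assumes "f \<in> L2_per X" "f' \<in> L2_per X" "g \<in> L2_per X" "AE x in lborel. f x = f' x"
  shows "ip X f g = ip X f' g"
  using assms by (intro ip_cong) (auto dest: L2D(1))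

lemma ip_bound:
  assumes "f \<in> L2_per X" "g \<in> L2_per X" "L2_norm X f \<le> a" "L2_norm X g \<le> b"
  shows "cmod (ip X f g) \<le> a * b"
  by (rule order_trans[OF ip_cauchy_schwarz[OF assms(1,2)] mult_mono[OF assms(3,4)]])
    (use assms(3) order_trans[OF L2_norm_nonneg] in auto)

lemma L2_norm_sq_coef_ge:
  assumes f: "f \<in> L2_per X" and p: "coef X p" "\<And>x. m \<le> p x" and X: "X > 0"
  shows "m * (L2_norm X f)\<^sup>2 \<le> Re (ip X (\<lambda>x. of_real (p x) * f x) f)"
proof -
  have "(LBINT x:{0..X}. m * (cmod (f x))\<^sup>2) \<le> (LBINT x:{0..X}. p x * (cmod (f x))\<^sup>2)"
  proof (rule set_integral_mono)
    show "set_integrable lborel {0..X} (\<lambda>x. m * (cmod (f x))\<^sup>2)"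
      using f by (auto simp: L2_per_def)
    have "set_integrable lborel {0..X} (\<lambda>x. (of_real (p x) * f x) * cnj (f x))"
      by (intro ip_integrable L2_coef p f X)
    then have "set_integrable lborel {0..X} (\<lambda>x. Re ((of_real (p x) * f x) * cnj (f x)))"
      unfolding set_integrable_def by (drule_tac integrable_Re) simp
    moreover have "Re ((of_real (p x) * f x) * cnj (f x)) = p x * (cmod (f x))\<^sup>2" for x
      by (simp only: mult.assoc complex_norm_square[symmetric] of_real_mult[symmetric] Re_complex_of_real)
    ultimately show "set_integrable lborel {0..X} (\<lambda>x. p x * (cmod (f x))\<^sup>2)" by simp
  qed (use p(2) in \<open>auto intro: mult_right_mono\<close>)
  then show ?thesis by (simp add: ip_self_coef L2_norm_sq)
qed

lemma Im_ip_coef_self: "Im (ip X (\<lambda>x. of_real (p x) * f x) f) = 0"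
  by (simp add: ip_self_coef)

text \<open>
  The weight \<open>\<psi>\<close> replaces the zeroth order coefficient \<open>a\<close>, which may change sign, by its mean \<open>m\<close>.
\<close>

lemma damping_estimate:
  assumes X: "X > 0" and p: "coef X a" "coef X \<psi>" and m: "m > 0"
    and \<psi>: "\<And>x. c / 2 * deriv \<psi> x + a x * \<psi> x = m * \<psi> x" "\<psi>0 > 0" "\<And>x. \<psi>0 \<le> \<psi> x" "\<And>x. \<bar>\<psi> x\<bar> \<le> M"
    and z: "Re z \<ge> - m / 2"
    and T: "has_bloch_deriv X \<xi> T T1" and H: "H \<in> L2_per X"
    and eq: "AE x in lborel. z * T x - of_real c * T1 x + of_real (a x) * T x = H x"
  shows "m * \<psi>0 * L2_norm X T \<le> 2 * M * L2_norm X H"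
proof -
  note L2 = has_bloch_deriv_L2[OF T]
  let ?\<psi> = "\<lambda>f x. of_real (\<psi> x) * f x" and ?d = "\<lambda>x. of_real (deriv \<psi> x) * T x" and ?a = "\<lambda>x. of_real (a x) * T x"
  have L2\<psi>: "?\<psi> T \<in> L2_per X" "?\<psi> T1 \<in> L2_per X" "?a \<in> L2_per X"
    "?d \<in> L2_per X" "?\<psi> ?a \<in> L2_per X"
    by (intro L2_coef coef_deriv X p L2)+
  have "(\<lambda>x. z * T x - of_real c * T1 x + of_real (a x) * T x) \<in> L2_per X"
    using L2 L2\<psi> by (intro L2_add L2_diff L2_cmult)
  from ip_cong_left[OF this H L2\<psi>(1) eq]
  have 1: "ip X H (?\<psi> T) = z * ip X T (?\<psi> T) - of_real c * ip X T1 (?\<psi> T) +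
      ip X ?a (?\<psi> T)"
    using L2 L2\<psi> by (simp add: ip_add_left ip_diff_left ip_mult_left L2_add L2_diff L2_cmult)
  have "ip X T1 (?\<psi> T) = - ip X T (\<lambda>x. of_real (deriv \<psi> x) * T x + of_real (\<psi> x) * T1 x)"
    by (intro ip_bloch_deriv[OF X T] has_bloch_deriv_coef X p T)
  also have "\<dots> = - ip X ?d T - cnj (ip X T1 (?\<psi> T))"
    using L2 L2\<psi> by (simp add: ip_add_right ip_coef ip_cnj)
  finally have "ip X T1 (?\<psi> T) + cnj (ip X T1 (?\<psi> T)) = - ip X ?d T"
    by algebra
  \<comment> \<open>The real part is half a commutator, so the transport term \<open>- c D T\<close>
    contributes only \<open>c / 2\<close> times the integral of \<open>deriv \<psi>\<close> against
    \<open>|T|^2\<close>. Together with the term from \<open>a\<close> this is the left side of the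
    equation for \<psi>.\<close>
  from arg_cong[OF this, of Re] have 2: "Re (ip X T1 (?\<psi> T)) = - Re (ip X ?d T) / 2"
    by simp
  have "ip X (\<lambda>x. of_real (c / 2) * (of_real (deriv \<psi> x) * T x) + of_real (\<psi> x) * (of_real (a x) * T x)) T =
      ip X (\<lambda>x. of_real m * ?\<psi> T x) T"
  proof -
    have "of_real (c / 2) * (of_real (deriv \<psi> x) * T x) + of_real (\<psi> x) * (of_real (a x) * T x) =
      of_real (c / 2 * deriv \<psi> x + a x * \<psi> x) * T x" for x by (simp add: algebra_simps)
    then show ?thesis unfolding \<psi>(1) by (simp add: mult.assoc)
  qed
  then have "of_real (c / 2) * ip X ?d T + ip X ?a (?\<psi> T) =
      of_real m * ip X (?\<psi> T) T"
    using L2 L2\<psi> by (simp add: ip_add_left ip_mult_left L2_cmult flip: ip_coef[of X \<psi>] del: of_real_divide)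
  from arg_cong[OF this, of Re]
  have 3: "c / 2 * Re (ip X ?d T) + Re (ip X ?a (?\<psi> T)) =
      m * Re (ip X (?\<psi> T) T)" by simp
  have 4: "ip X T (?\<psi> T) = ip X (?\<psi> T) T" by (simp add: ip_coef)
  have "Re (ip X H (?\<psi> T)) = Re z * Re (ip X (?\<psi> T) T) + m * Re (ip X (?\<psi> T) T)"
    using 3 unfolding 1 4 by (simp add: 2 Im_ip_coef_self)
  also have "\<dots> = (Re z + m) * Re (ip X (?\<psi> T) T)" by (simp add: algebra_simps)
  \<comment> \<open>This fixes the size of the gap: for \<open>Re z \<ge> - m / 2\<close> the sum
    \<open>Re z + m\<close> is still at least \<open>m / 2\<close>.\<close>
  also have "\<dots> \<ge> (m / 2) * (\<psi>0 * (L2_norm X T)\<^sup>2)"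
    using z m \<psi>(2) by (intro mult_mono L2_norm_sq_coef_ge[OF L2(1) p(2) \<psi>(3) X]) auto
  finally have "m / 2 * (\<psi>0 * (L2_norm X T)\<^sup>2) \<le> cmod (ip X H (?\<psi> T))"
    using complex_Re_le_cmod order_trans by blast
  also have "\<dots> \<le> L2_norm X H * (M * L2_norm X T)"
    by (intro ip_bound H L2\<psi> order_refl L2_norm_mult_le L2 p \<psi> X)
  finally have "(m * \<psi>0 * L2_norm X T) * L2_norm X T \<le> (2 * M * L2_norm X H) * L2_norm X T"
    by (simp add: power2_eq_square algebra_simps)
  moreover have "M \<ge> 0" using \<psi>(4)[of 0] by linarith
  ultimately show ?thesis
    by (cases "L2_norm X T = 0") (auto intro: mult_right_le_imp_le[of _ "L2_norm X T"] simp: less_le)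
qed

text \<open>
  The flux \<open>W\<close> satisfies a heat equation: pairing \<open>U1 = b W - a T\<close> with \<open>z W\<close> and eliminating \<open>z T\<close>
  and \<open>z U\<close> by the other two equations leaves no term of order \<open>z\<close> on the right.
\<close>

lemma flux_estimate:
  assumes X: "X > 0" and p: "coef X a" "coef X b" "coef X r" "coef X p" "coef X q"
    and b: "b0 > 0" "\<And>x. b0 \<le> b x"
    and M: "M \<ge> 1" "\<And>x. \<bar>a x\<bar> \<le> M" "\<And>x. \<bar>b x\<bar> \<le> M" "\<And>x. \<bar>r x\<bar> \<le> M" "\<And>x. \<bar>p x\<bar> \<le> M"
      "\<And>x. \<bar>q x\<bar> \<le> M" "\<And>x. \<bar>deriv a x\<bar> \<le> M" "\<bar>c\<bar> \<le> M"
    and m: "m > 0" and z: "Re z \<ge> - m / 2" "cmod z \<ge> 2 * m"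
    and T: "has_bloch_deriv X \<xi> T T1" and U: "has_bloch_deriv X \<xi> U U1" and W: "has_bloch_deriv X \<xi> W W1"
    and FG: "F \<in> L2_per X" "G \<in> L2_per X"
    and eqs: "AE x in lborel. z * T x - of_real c * T1 x - U1 x = F x"
      "AE x in lborel. U1 x = of_real (b x) * W x - of_real (a x) * T x"
      "AE x in lborel. W1 x = z * U x + of_real (r x) * U1 x + of_real (p x) * T x + of_real (q x) * U x - G x"
    and Q: "Q = L2_norm X T + L2_norm X U + L2_norm X W + L2_norm X F + L2_norm X G"
    and K: "K = 3 * M\<^sup>2"
  shows "cmod z * b0 * (L2_norm X W)\<^sup>2 \<le> 2 * (K\<^sup>2 + 2 * K) * Q\<^sup>2"
    and "cmod z * (L2_norm X U)\<^sup>2 \<le> K * Q\<^sup>2"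
proof -
  note L2 = has_bloch_deriv_L2[OF T] has_bloch_deriv_L2[OF U] has_bloch_deriv_L2[OF W] FG
  let ?n = "L2_norm X"
  \<comment> \<open>The remainder in \<open>z U = W1 - e\<close>. It is bounded by a multiple of
    \<open>Q\<close>, since \<open>U1\<close> is a combination of \<open>W\<close> and
    \<open>T\<close>.\<close>
  define e where "e = (\<lambda>x. of_real (r x) * U1 x + of_real (p x) * T x + of_real (q x) * U x - G x)"
  define A where "A = (\<lambda>f x. of_real (a x) * f x :: complex)"
  define B where "B = (\<lambda>f x. of_real (b x) * f x :: complex)"
  define A' where "A' = (\<lambda>f x. of_real (deriv a x) * f x :: complex)"
  have AB: "A f \<in> L2_per X" "B f \<in> L2_per X" "A' f \<in> L2_per X" if "f \<in> L2_per X" for f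
    unfolding A_def B_def A'_def using X p that by (blast intro: L2_coef coef_deriv)+
  have nAB: "?n (A f) \<le> M * ?n f" "?n (B f) \<le> M * ?n f" "?n (A' f) \<le> M * ?n f" if "f \<in> L2_per X" for f
    unfolding A_def B_def A'_def using X p that M by (blast intro: L2_norm_mult_le coef_deriv)+
  have rpq: "(\<lambda>x. of_real (r x) * U1 x) \<in> L2_per X" "(\<lambda>x. of_real (p x) * T x) \<in> L2_per X"
    "(\<lambda>x. of_real (q x) * U x) \<in> L2_per X"
    using X p L2 by (blast intro: L2_coef)+
  have e: "e \<in> L2_per X" unfolding e_def by (intro L2_add L2_diff rpq FG)
  have nn: "0 \<le> ?n T" "0 \<le> ?n U" "0 \<le> ?n W" "0 \<le> ?n F" "0 \<le> ?n G" "0 \<le> ?n W1" by simp_all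
  have Q0: "0 \<le> Q" "?n W \<le> Q" "?n U \<le> Q" "?n T \<le> Q" "?n F \<le> Q" unfolding Q using nn by linarith+
  have M2: "M \<le> M\<^sup>2" "1 \<le> M\<^sup>2" using M(1) by (simp_all add: power2_eq_square mult_le_cancel_left1 mult_mono[of 1 M 1 M, simplified])
  have U1Q: "?n U1 \<le> M * (?n W + ?n T)"
  proof -
    have "?n U1 = ?n (\<lambda>x. B W x - A T x)"
      using eqs(2) by (intro L2_norm_cong L2D(1)[of _ X] L2_diff AB L2) (simp add: A_def B_def)
    also have "\<dots> \<le> ?n (B W) + ?n (A T)" by (intro L2_norm_triangle_diff AB L2)
    also have "\<dots> \<le> M * ?n W + M * ?n T" by (intro add_mono nAB L2)
    finally show ?thesis by (simp add: algebra_simps)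
  qed
  have U1Q': "?n U1 \<le> M * Q"
    by (rule order_trans[OF U1Q]) (use M(1) nn in \<open>auto simp: Q\<close>)
  have ne: "?n e \<le> 2 * M\<^sup>2 * Q"
  proof -
    have "?n e \<le> ?n (\<lambda>x. of_real (r x) * U1 x) + ?n (\<lambda>x. of_real (p x) * T x) + ?n (\<lambda>x. of_real (q x) * U x) + ?n G"
      using L2_norm_triangle[OF rpq(1,2)] L2_norm_triangle[OF L2_add[OF rpq(1,2)] rpq(3)]
        L2_norm_triangle_diff[OF L2_add[OF L2_add[OF rpq(1,2)] rpq(3)] FG(2)]
      unfolding e_def by linarith
    also have "\<dots> \<le> M * ?n U1 + M * ?n T + M * ?n U + ?n G"
      by (intro add_mono order_refl L2_norm_mult_le L2 p M X)
    also have "\<dots> \<le> M * (M * Q) + (M * ?n T + M * ?n U + M * ?n G)"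
      using mult_left_mono[OF U1Q' order_trans[OF zero_le_one M(1)]] mult_right_mono[OF M(1) nn(5)] by linarith
    finally have "?n e \<le> M * (M * Q) + (M * ?n T + M * ?n U + M * ?n G)" .
    moreover have "M * ?n T + M * ?n U + M * ?n G \<le> M * Q"
      unfolding Q using M(1) nn by (simp add: algebra_simps)
    moreover have "M * Q \<le> M\<^sup>2 * Q" using M2(1) Q0(1) by (rule mult_right_mono)
    moreover have "M * (M * Q) = M\<^sup>2 * Q" by (simp add: power2_eq_square)
    ultimately show ?thesis by linarith
  qed
  define E where "E = ip X e W1 + ip X (A F) W + (- of_real c * (ip X T (A' W) + ip X T (A W1))) + ip X (A U1) W"
  have zU: "AE x in lborel. z * U x = W1 x - e x"
    using eqs(3) by eventually_elim (simp add: e_def)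
  have main: "z * ip X (B W) W + of_real ((?n W1)\<^sup>2) = E"
  proof -
    have "AE x in lborel. z * B W x = z * U1 x + A (\<lambda>x. F x + of_real c * T1 x + U1 x) x"
      using eqs(1,2)
    proof eventually_elim
      case (elim x)
      have "z * B W x = z * U1 x + of_real (a x) * (z * T x)"
        unfolding elim(2) B_def by (simp add: algebra_simps)
      also have "z * T x = F x + of_real c * T1 x + U1 x" unfolding elim(1)[symmetric] by simp
      finally show ?case by (simp add: A_def)
    qed
    then have "ip X (\<lambda>x. z * B W x) W = ip X (\<lambda>x. z * U1 x + A (\<lambda>x. F x + of_real c * T1 x + U1 x) x) W"
      by (intro ip_cong_left L2_add L2_cmult AB L2)
    also have "A (\<lambda>x. F x + of_real c * T1 x + U1 x) = (\<lambda>x. A F x + of_real c * A T1 x + A U1 x)"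
      by (simp add: A_def algebra_simps)
    finally have "z * ip X (B W) W = z * ip X U1 W + ip X (A F) W + of_real c * ip X (A T1) W + ip X (A U1) W"
      by (simp add: ip_add_left ip_mult_left L2_add L2_cmult AB L2 L2)
    \<comment> \<open>\<open>T1\<close> is not controlled by \<open>Q\<close>; the derivative is
      moved to \<open>A W\<close>, at the price of a \<open>W1\<close> that the left side of
      \<open>main\<close> controls.\<close>
    also have "ip X (A T1) W = - ip X T (A' W) - ip X T (A W1)"
    proof -
      have "ip X (A T1) W = ip X T1 (A W)" unfolding A_def by (rule ip_coef)
      also have "\<dots> = - ip X T (\<lambda>x. A' W x + A W1 x)"
        unfolding A_def A'_def by (intro ip_bloch_deriv[OF X T] has_bloch_deriv_coef X p W)
      finally show ?thesis by (simp add: ip_add_right AB L2)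
    qed
    \<comment> \<open>Parabolicity enters here: integration by parts and the replacement of
      \<open>z U\<close> by \<open>W1 - e\<close> yield \<open>- ||W1||^2\<close>, which has the
      good sign.\<close>
    also have "z * ip X U1 W = - of_real ((?n W1)\<^sup>2) + ip X e W1"
    proof -
      have "z * ip X U1 W = - ip X (\<lambda>x. z * U x) W1"
        by (simp add: ip_bloch_deriv[OF X U W] ip_mult_left)
      also have "ip X (\<lambda>x. z * U x) W1 = ip X (\<lambda>x. W1 x - e x) W1"
        by (intro ip_cong_left L2_cmult L2_diff L2 e zU)
      finally show ?thesis by (simp add: ip_diff_left e L2 ip_self)
    qed
    finally show ?thesis by (simp add: E_def algebra_simps)
  qed
  \<comment> \<open>No term of \<open>E\<close> contains \<open>W1\<close> more than once, so the
    square of its norm on the left can absorb it.\<close>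
  have nE: "cmod E \<le> K * Q * (?n W1 + ?n W)"
  proof -
    have "cmod E \<le> cmod (ip X e W1) + cmod (ip X (A F) W) + \<bar>c\<bar> * (cmod (ip X T (A' W)) + cmod (ip X T (A W1))) + cmod (ip X (A U1) W)"
      unfolding E_def by (intro order_trans[OF norm_triangle_ineq] add_mono order_refl)
        (auto simp: norm_mult intro!: mult_left_mono norm_triangle_ineq)
    also have "\<dots> \<le> (2 * M\<^sup>2 * Q) * ?n W1 + (M * Q) * ?n W + M * (Q * (M * ?n W) + Q * (M * ?n W1)) + (M * (M * Q)) * ?n W"
    proof (intro add_mono mult_mono M(8))
      show "cmod (ip X e W1) \<le> (2 * M\<^sup>2 * Q) * ?n W1" by (intro ip_bound e L2 ne order_refl)
      show "cmod (ip X (A F) W) \<le> (M * Q) * ?n W"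
        by (intro ip_bound AB L2 order_refl order_trans[OF nAB(1)] mult_left_mono Q0) (use M(1) in auto)
      show "cmod (ip X T (A' W)) \<le> Q * (M * ?n W)" by (intro ip_bound AB L2 Q0 nAB)
      show "cmod (ip X T (A W1)) \<le> Q * (M * ?n W1)" by (intro ip_bound AB L2 Q0 nAB)
      show "cmod (ip X (A U1) W) \<le> (M * (M * Q)) * ?n W"
        by (intro ip_bound AB L2 order_refl order_trans[OF nAB(1)] mult_left_mono U1Q') (use M(1) in auto)
    qed (use M(1) in auto)
    also have "\<dots> = 3 * M\<^sup>2 * Q * ?n W1 + (2 * M\<^sup>2 * (Q * ?n W) + M * (Q * ?n W))"
      by (simp add: power2_eq_square algebra_simps)
    also have "\<dots> \<le> 3 * M\<^sup>2 * Q * ?n W1 + (2 * M\<^sup>2 * (Q * ?n W) + M\<^sup>2 * (Q * ?n W))"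
      using M2(1) Q0(1) nn by (intro add_left_mono mult_right_mono) auto
    also have "\<dots> = K * Q * (?n W1 + ?n W)" by (simp add: K algebra_simps)
    finally show ?thesis .
  qed
  define \<beta> where "\<beta> = Re (ip X (B W) W)"
  have \<beta>: "ip X (B W) W = of_real \<beta>"
    by (simp add: \<beta>_def complex_eq_iff Im_ip_coef_self B_def)
  have \<beta>0: "b0 * (?n W)\<^sup>2 \<le> \<beta>" unfolding \<beta>_def B_def by (rule L2_norm_sq_coef_ge[OF L2(5) p(2) b(2) X])
  then have \<beta>nn: "0 \<le> \<beta>" using b(1) by (smt (verit) mult_nonneg_nonneg zero_le_power2)
  \<comment> \<open>Since \<beta> is real and nonnegative, \<open>main\<close> reads
    \<open>z \<beta> + ||W1||^2 = E\<close>. The imaginary part bounds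
    \<open>|Im z| \<beta>\<close>, the real part bounds
    \<open>Re z \<beta> + ||W1||^2\<close>.\<close>
  have Im: "\<bar>Im z\<bar> * \<beta> \<le> cmod E"
    using abs_Im_le_cmod[of E] \<beta>nn by (simp add: main[symmetric] \<beta> abs_mult)
  have Re: "Re z * \<beta> + (?n W1)\<^sup>2 \<le> cmod E"
    using complex_Re_le_cmod[of E] by (simp add: main[symmetric] \<beta>)
  have "cmod z * \<beta> \<le> \<bar>Re z\<bar> * \<beta> + \<bar>Im z\<bar> * \<beta>"
    using mult_right_mono[OF cmod_le \<beta>nn, of z] by (simp add: algebra_simps)
  \<comment> \<open>For negative \<open>Re z\<close> the wrong sign costs at most
    \<open>m \<beta>\<close>, because \<open>Re z \<ge> - m / 2\<close>; by
    \<open>|z| \<ge> 2 m\<close> this is at most half of \<open>|z| \<beta>\<close> and is absorbed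
    below.\<close>
  moreover have "\<bar>Re z\<bar> * \<beta> + (?n W1)\<^sup>2 \<le> cmod E + m * \<beta>"
  proof (cases "Re z \<ge> 0")
    case True
    then show ?thesis using Re m \<beta>nn by (simp add: add_increasing2)
  next
    case False
    then have "\<bar>Re z\<bar> * \<beta> \<le> (m / 2) * \<beta>" using z(1) \<beta>nn by (intro mult_right_mono) auto
    moreover have "- (Re z * \<beta>) = \<bar>Re z\<bar> * \<beta>" using False by simp
    ultimately show ?thesis using Re by (simp add: field_simps)
  qed
  moreover have "2 * m * \<beta> \<le> cmod z * \<beta>" using z(2) \<beta>nn by (rule mult_right_mono)
  ultimately have "cmod z * \<beta> + 2 * (?n W1)\<^sup>2 \<le> 4 * cmod E" using Im by linarith
  also have "\<dots> \<le> 4 * (K * Q * ?n W1) + 4 * (K * Q * ?n W)" using nE by (simp add: algebra_simps)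
  \<comment> \<open>Young's inequality, balanced so that exactly the \<open>2 ||W1||^2\<close>
    available on the left is consumed.\<close>
  also have "4 * (K * Q * ?n W1) \<le> 2 * (?n W1)\<^sup>2 + 2 * (K * Q)\<^sup>2"
    using sum_squares_bound[of "?n W1" "K * Q"] by (simp add: mult_ac)
  also have "K * Q * ?n W \<le> K * Q * Q" using Q0 by (intro mult_left_mono) (auto simp: K)
  finally have "cmod z * \<beta> \<le> 2 * (K * Q)\<^sup>2 + 4 * (K * Q * Q)" by simp
  moreover have "cmod z * (b0 * (?n W)\<^sup>2) \<le> cmod z * \<beta>" using \<beta>0 by (rule mult_left_mono) simp
  ultimately show "cmod z * b0 * (?n W)\<^sup>2 \<le> 2 * (K\<^sup>2 + 2 * K) * Q\<^sup>2"
    by (simp add: power2_eq_square algebra_simps)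
  \<comment> \<open>For \<open>U\<close>, the identity \<open>z U = W1 - e\<close> is paired with
    \<open>U\<close>. Moving the derivative from \<open>W\<close> to \<open>U\<close> leaves
    \<open>U1\<close>, whose norm is at most \<open>M * Q\<close>.\<close>
  have "ip X (\<lambda>x. z * U x) U = ip X (\<lambda>x. W1 x - e x) U"
    by (intro ip_cong_left L2_cmult L2_diff L2 e zU)
  then have "z * of_real ((?n U)\<^sup>2) = - ip X W U1 - ip X e U"
    by (simp add: ip_mult_left ip_diff_left ip_self L2 e ip_bloch_deriv[OF X W U])
  from arg_cong[OF this, of cmod] have "cmod z * (?n U)\<^sup>2 = cmod (- ip X W U1 - ip X e U)"
    by (simp add: norm_mult norm_power)
  also have "\<dots> \<le> cmod (ip X W U1) + cmod (ip X e U)"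
    using norm_triangle_ineq4[of "- ip X W U1"] by simp
  also have "\<dots> \<le> Q * (M * Q) + (2 * M\<^sup>2 * Q) * Q" by (intro add_mono ip_bound L2 e ne Q0 U1Q')
  also have "Q * (M * Q) \<le> M\<^sup>2 * (Q * Q)" using mult_right_mono[OF M2(1), of "Q * Q"] Q0(1) by (simp add: mult.left_commute)
  finally show "cmod z * (?n U)\<^sup>2 \<le> K * Q\<^sup>2" by (simp add: K power2_eq_square algebra_simps)
qed

text \<open>Here \<open>x\<close>, \<open>y\<close>, \<open>w\<close> stand for the norms of
  \<open>T\<close>, \<open>U\<close>, \<open>W\<close>, and \<open>h\<close> for the data. Only
  \<open>x\<close> has no small factor of its own, but it is dominated by \<open>w\<close> and
  \<open>h\<close>. The threshold for \<open>R\<close> makes \<open>w\<close> and \<open>y\<close>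
  at most \<open>Q / (2 * (C + 2))\<close>, so \<open>(C + 1) * w + y\<close> is at most half of
  \<open>Q\<close> and can be subtracted.\<close>

lemma absorb_small:
  fixes x y w h C N L R Q :: real
  assumes x: "x \<le> C * (w + h)" and Q: "Q = x + y + w + h"
    and w: "R * w\<^sup>2 \<le> L * Q\<^sup>2" and y: "R * y\<^sup>2 \<le> L * Q\<^sup>2"
    and R: "R \<ge> 4 * (C + 2)\<^sup>2 * L" and pos: "C \<ge> 0" "L > 0" "x \<ge> 0" "y \<ge> 0" "w \<ge> 0" "h \<ge> 0"
  shows "x + y \<le> 2 * (C + 1) * h"
proof -
  have Q0: "Q \<ge> 0" using pos Q by simp
  have small: "v \<le> Q / (2 * (C + 2))" if "R * v\<^sup>2 \<le> L * Q\<^sup>2" for v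
  proof -
    have "(4 * (C + 2)\<^sup>2 * L) * v\<^sup>2 \<le> L * Q\<^sup>2" using mult_right_mono[OF R zero_le_power2[of v]] that by linarith
    then have "L * (4 * (C + 2)\<^sup>2 * v\<^sup>2) \<le> L * Q\<^sup>2" by (simp add: mult_ac)
    then have "4 * (C + 2)\<^sup>2 * v\<^sup>2 \<le> Q\<^sup>2" using pos(2) by simp
    then have "(2 * (C + 2) * v)\<^sup>2 \<le> Q\<^sup>2" by (simp only: power_mult_distrib) simp
    then have "2 * (C + 2) * v \<le> Q" using Q0 by (rule power2_le_imp_le)
    then show ?thesis using pos(1) by (simp add: pos_le_divide_eq mult.commute)
  qed
  have "Q \<le> (C + 1) * w + y + (C + 1) * h" using x Q by (simp add: algebra_simps)
  also have "\<dots> \<le> (C + 1) * (Q / (2 * (C + 2))) + Q / (2 * (C + 2)) + (C + 1) * h"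
    using small[OF w] small[OF y] pos(1) by (intro add_mono mult_left_mono order_refl) auto
  also have "(C + 1) * (Q / (2 * (C + 2))) + Q / (2 * (C + 2)) = (C + 2) * (Q / (2 * (C + 2)))"
    by algebra
  also have "\<dots> = Q / 2"
  proof -
    have "N * (Q / (2 * N)) = Q / 2" if "N > 0" for N :: real using that by simp
    from this[of "C + 2"] pos(1) show ?thesis by simp
  qed
  finally have "Q \<le> 2 * ((C + 1) * h)" by simp
  then have "x + y \<le> 2 * ((C + 1) * h)" using Q pos by linarith
  then show ?thesis by (simp only: mult.assoc)
qed

text \<open>In the application \<open>al\<close> is \<alpha>, \<open>nb\<close> is
  \<open>\<nu> / \<tau>b^2\<close>, \<open>r\<close> is \<open>- c\<close>, \<open>p\<close> is
  \<open>ub^2\<close> and \<open>q\<close> is \<open>2 * ub * \<tau>b\<close>. Passing to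
  derivatives changes \<open>r\<close>, \<open>p\<close>, \<open>q\<close>, while \<open>c\<close>,
  \<open>al\<close>, \<open>nb\<close>, and with them the damping, stay the same.\<close>

definition resolvent_eq ::
    "real \<Rightarrow> real \<Rightarrow> (real \<Rightarrow> real) \<Rightarrow> (real \<Rightarrow> real) \<Rightarrow> (real \<Rightarrow> real) \<Rightarrow> (real \<Rightarrow> real) \<Rightarrow> (real \<Rightarrow> real) \<Rightarrow>
      complex \<Rightarrow> real \<Rightarrow> (real \<Rightarrow> complex) \<Rightarrow> (real \<Rightarrow> complex) \<Rightarrow> (real \<Rightarrow> complex) \<Rightarrow> (real \<Rightarrow> complex) \<Rightarrow> bool" where
  "resolvent_eq X c al nb r p q z \<xi> T U f g \<longleftrightarrow>
    (AE x in lborel. z * T x - of_real c * bloch_deriv X \<xi> T x - bloch_deriv X \<xi> U x = f x) \<and>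
    (AE x in lborel. z * U x + of_real (r x) * bloch_deriv X \<xi> U x
        - bloch_deriv X \<xi> (\<lambda>x. of_real (al x) * T x + of_real (nb x) * bloch_deriv X \<xi> U x) x
        + of_real (p x) * T x + of_real (q x) * U x = g x)"

text \<open>An a priori estimate for given solutions, with \<open>C\<close> and \<open>R\<close>
  fixed before \<open>z\<close> and \<xi>; solvability is deduced from it afterwards.\<close>

definition resolvent_bound ::
    "real \<Rightarrow> real \<Rightarrow> (real \<Rightarrow> real) \<Rightarrow> (real \<Rightarrow> real) \<Rightarrow> (real \<Rightarrow> real) \<Rightarrow> (real \<Rightarrow> real) \<Rightarrow> (real \<Rightarrow> real) \<Rightarrow>
      real \<Rightarrow> nat \<Rightarrow> real \<Rightarrow> real \<Rightarrow> bool" where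
  "resolvent_bound X c al nb r p q m k C R \<longleftrightarrow> (\<forall>z \<xi> T U f g.
    cmod z \<ge> R \<longrightarrow> Re z \<ge> - m / 2 \<longrightarrow>
    T \<in> H_per X (Suc k) \<longrightarrow> U \<in> H_per X (Suc (Suc k)) \<longrightarrow> f \<in> H_per X k \<longrightarrow> g \<in> H_per X k \<longrightarrow>
    resolvent_eq X c al nb r p q z \<xi> T U f g \<longrightarrow>
    H_norm X \<xi> k T + H_norm X \<xi> k U \<le> C * (H_norm X \<xi> k f + H_norm X \<xi> k g))"

lemma L2_resolvent_estimate:
  assumes X: "X > 0" and al: "coef X al" and nb: "coef X nb" "\<And>x. nb x > 0"
    and \<psi>: "coef X \<psi>" "\<And>x. \<psi> x > 0" and m: "m > 0"
      "\<And>x. c / 2 * deriv \<psi> x + al x / nb x * \<psi> x = m * \<psi> x"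
    and rpq: "coef X r" "coef X p" "coef X q"
  shows "\<exists>C>0. \<exists>R>0. resolvent_bound X c al nb r p q m 0 C R"
proof -
  define a where "a = (\<lambda>x. al x / nb x)"
  define b where "b = (\<lambda>x. 1 / nb x)"
  have nb0: "nb x \<noteq> 0" for x using nb(2)[of x] by simp
  have ab: "coef X a" "coef X b"
    unfolding a_def b_def by (intro coef_divide al nb(1) nb0 coef_const)+
  note p = ab \<psi>(1) rpq
  have pos: "b x > 0" for x using nb(2) by (simp add: b_def)
  have weight: "c / 2 * deriv \<psi> x + a x * \<psi> x = m * \<psi> x" for x using m(2) by (simp add: a_def)
  have "\<exists>M>0. \<forall>x. \<bar>f x\<bar> \<le> M" if "coef X f" for f using coef_bounded[OF that X] by metis
  then obtain Ma Mb M\<psi> Mr Mp Mq Ma' where bounds: "Ma > 0" "\<And>x. \<bar>a x\<bar> \<le> Ma" "Mb > 0" "\<And>x. \<bar>b x\<bar> \<le> Mb"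
    "M\<psi> > 0" "\<And>x. \<bar>\<psi> x\<bar> \<le> M\<psi>" "Mr > 0" "\<And>x. \<bar>r x\<bar> \<le> Mr" "Mp > 0" "\<And>x. \<bar>p x\<bar> \<le> Mp" "Mq > 0" "\<And>x. \<bar>q x\<bar> \<le> Mq"
    "Ma' > 0" "\<And>x. \<bar>deriv a x\<bar> \<le> Ma'"
    using p coef_deriv[OF p(1)] by metis
  define M where "M = 1 + \<bar>c\<bar> + Ma + Mb + M\<psi> + Mr + Mp + Mq + Ma'"
  have M: "M \<ge> 1" "\<bar>c\<bar> \<le> M" using bounds by (auto simp: M_def)
  have M': "\<bar>a x\<bar> \<le> M" "\<bar>b x\<bar> \<le> M" "\<bar>\<psi> x\<bar> \<le> M" "\<bar>r x\<bar> \<le> M" "\<bar>p x\<bar> \<le> M" "\<bar>q x\<bar> \<le> M" "\<bar>deriv a x\<bar> \<le> M" for x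
    using bounds(2)[of x] bounds(4)[of x] bounds(6)[of x] bounds(8)[of x] bounds(10)[of x] bounds(12)[of x]
      bounds(14)[of x] bounds(1,3,5,7,9,11,13) by (auto simp: M_def)
  obtain b0 where b0: "b0 > 0" "\<And>x. b0 \<le> b x"
    using periodic_positive_lower_bound[of b X] p(2) X pos coefD(2,4) by metis
  obtain \<psi>0 where \<psi>0: "\<psi>0 > 0" "\<And>x. \<psi>0 \<le> \<psi> x"
    using periodic_positive_lower_bound[of \<psi> X] p(3) X \<psi>(2) coefD(2,4) by metis
  \<comment> \<open>The factor with which \<open>damping_estimate\<close> bounds \<open>T\<close> by
    the flux and the data.\<close>
  define C1 where "C1 = 2 * M\<^sup>2 / (m * \<psi>0)"
  define K where "K = 3 * M\<^sup>2"
  \<comment> \<open>One constant for both outcomes of \<open>flux_estimate\<close>: the first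
    summand serves the flux, after division by \<open>b0\<close>, the second serves
    \<open>U\<close>. In \<open>R\<close>, the summand \<open>2 * m\<close> is what
    \<open>flux_estimate\<close> demands of \<open>|z|\<close>, and the other one is the threshold
    of \<open>absorb_small\<close>.\<close>
  define L where "L = 2 * (K\<^sup>2 + 2 * K) / b0 + K"
  define R where "R = 2 * m + 4 * (C1 + 2)\<^sup>2 * L"
  have M2: "M \<le> M\<^sup>2" using M(1) by (simp add: power2_eq_square)
  have C1: "C1 \<ge> 0" using m(1) \<psi>0(1) by (simp add: C1_def)
  have K: "K > 0" using M(1) by (simp add: K_def)
  have L: "L > 0" "2 * (K\<^sup>2 + 2 * K) / b0 \<le> L" "K \<le> L" using K b0(1) by (simp_all add: L_def add_nonneg_pos)
  have "resolvent_bound X c al nb r p q m 0 (2 * (C1 + 1)) R"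
    unfolding resolvent_bound_def resolvent_eq_def
  proof (intro allI impI, elim conjE)
    fix z \<xi> T U F G
    let ?D = "bloch_deriv X \<xi>"
    let ?W = "\<lambda>x. of_real (al x) * T x + of_real (nb x) * ?D U x"
    assume z: "cmod z \<ge> R" "Re z \<ge> - m / 2"
      and H: "T \<in> H_per X (Suc 0)" "U \<in> H_per X (Suc (Suc 0))"
      and "F \<in> H_per X 0" "G \<in> H_per X 0"
      and eq1: "AE x in lborel. z * T x - of_real c * ?D T x - ?D U x = F x"
      and eq2: "AE x in lborel. z * U x + of_real (r x) * ?D U x - ?D ?W x + of_real (p x) * T x + of_real (q x) * U x = G x"
    then have FG: "F \<in> L2_per X" "G \<in> L2_per X" by simp_all
    have W: "?W \<in> H_per X (Suc 0)"
      by (intro H_per_add H_per_coef X al nb(1) H(1) bloch_deriv_H_per[OF H(2) X])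
    note D = H[THEN bloch_derivI, of \<xi>] W[THEN bloch_derivI, of \<xi>]
    have eq3: "AE x in lborel. ?D U x = of_real (b x) * ?W x - of_real (a x) * T x"
      using nb0 by (intro AE_I2) (simp add: a_def b_def field_simps)
    have eq4: "AE x in lborel. ?D ?W x = z * U x + of_real (r x) * ?D U x + of_real (p x) * T x + of_real (q x) * U x - G x"
      using eq2 by eventually_elim (simp add: algebra_simps)
    note eqs = eq1 eq3 eq4
    note L2 = has_bloch_deriv_L2[OF D(1)] has_bloch_deriv_L2[OF D(2)] has_bloch_deriv_L2[OF D(3)] FG
    let ?n = "L2_norm X"
    have R: "R \<ge> 2 * m" "R \<ge> 4 * (C1 + 2)\<^sup>2 * L" using m(1) L(1) by (simp_all add: R_def)
    have bW: "(\<lambda>x. of_real (b x) * ?W x) \<in> L2_per X" by (rule L2_coef[OF p(2) X L2(5)])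
    have "m * \<psi>0 * ?n T \<le> 2 * M * ?n (\<lambda>x. F x + of_real (b x) * ?W x)"
    proof (rule damping_estimate[OF X p(1,3) m(1) weight \<psi>0 M'(3) z(2) D(1)])
      show "(\<lambda>x. F x + of_real (b x) * ?W x) \<in> L2_per X" by (intro L2_add FG bW)
      show "AE x in lborel. z * T x - of_real c * ?D T x + of_real (a x) * T x = F x + of_real (b x) * ?W x"
        using eqs(1,2) by eventually_elim (simp add: algebra_simps)
    qed
    also have "\<dots> \<le> 2 * M * (?n F + M * ?n ?W)"
      using M(1) by (intro mult_left_mono order_trans[OF L2_norm_triangle] add_left_mono
          L2_norm_mult_le p M' X L2 bW) auto
    also have "\<dots> = 2 * (M * ?n F + M\<^sup>2 * ?n ?W)" by (simp add: power2_eq_square algebra_simps)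
    also have "\<dots> \<le> 2 * (M\<^sup>2 * ?n F + M\<^sup>2 * ?n ?W)"
      using M2 by (simp add: mult_right_mono)
    also have "\<dots> \<le> 2 * M\<^sup>2 * (?n ?W + (?n F + ?n G))" by (simp add: algebra_simps)
    finally have x: "?n T \<le> C1 * (?n ?W + (?n F + ?n G))"
      using m(1) \<psi>0(1) by (simp add: C1_def pos_le_divide_eq mult_ac)
    define Q where "Q = ?n T + ?n U + ?n ?W + ?n F + ?n G"
    have z2: "2 * m \<le> cmod z" using z(1) R(1) by linarith
    note flux = flux_estimate[OF X p(1,2,4,5,6) b0 M(1) M'(1,2,4,5,6,7) M(2) m(1) z(2) z2 D FG eqs Q_def K_def]
    have w: "cmod z * (?n ?W)\<^sup>2 \<le> L * Q\<^sup>2"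
    proof -
      have "cmod z * (?n ?W)\<^sup>2 \<le> 2 * (K\<^sup>2 + 2 * K) / b0 * Q\<^sup>2"
        using flux(1) b0(1) by (simp add: pos_le_divide_eq mult_ac)
      also have "\<dots> \<le> L * Q\<^sup>2" using L(2) by (intro mult_right_mono) auto
      finally show ?thesis .
    qed
    have y: "cmod z * (?n U)\<^sup>2 \<le> L * Q\<^sup>2"
      using flux(2) mult_right_mono[OF L(3), of "Q\<^sup>2"] by simp
    have "?n T + ?n U \<le> 2 * (C1 + 1) * (?n F + ?n G)"
    proof (rule absorb_small[OF x _ w y _ C1 L(1)])
      show "Q = ?n T + ?n U + ?n ?W + (?n F + ?n G)" by (simp add: Q_def)
      show "4 * (C1 + 2)\<^sup>2 * L \<le> cmod z" using R(2) z(1) by linarith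
    qed simp_all
    then show "H_norm X \<xi> 0 T + H_norm X \<xi> 0 U \<le> 2 * (C1 + 1) * (H_norm X \<xi> 0 F + H_norm X \<xi> 0 G)" by simp
  qed
  moreover have "2 * (C1 + 1) > 0" "R > 0" using C1 m(1) L(1) by (simp_all add: R_def add_pos_nonneg)
  ultimately show ?thesis by blast
qed

lemma L2_norm_le_H_norm: "L2_norm X f \<le> H_norm X \<xi> k f"
  by (cases k) simp_all

text \<open>
  Differentiating the system yields a system of the same form for the derivatives, with other
  coefficients \<open>r\<close>, \<open>p\<close>, \<open>q\<close> and a right-hand side containing only undifferentiated unknowns.
\<close>

lemma sobolev_resolvent_estimate:
  assumes X: "X > 0" and al: "coef X al" and nb: "coef X nb" "\<And>x. nb x > 0"
    and \<psi>: "coef X \<psi>" "\<And>x. \<psi> x > 0" and m: "m > 0"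
      "\<And>x. c / 2 * deriv \<psi> x + al x / nb x * \<psi> x = m * \<psi> x"
  shows "coef X r \<Longrightarrow> coef X p \<Longrightarrow> coef X q \<Longrightarrow> \<exists>C>0. \<exists>R>0. resolvent_bound X c al nb r p q m k C R"
proof (induction k arbitrary: r p q)
  case 0
  then show ?case by (rule L2_resolvent_estimate[OF X al nb \<psi> m])
next
  case (Suc k)
  \<comment> \<open>Applying \<open>D\<close> to the flux term \<open>D W\<close> of the second
    equation gives \<open>al'' T + al' D T + nb'' D U + nb' D (D U) + D W'\<close>, where
    \<open>W'\<close> is the flux formed from \<open>D T\<close> and \<open>D U\<close>, and primes
    on coefficients are derivatives. Collecting the factors of \<open>D (D U)\<close>,
    \<open>D T\<close> and \<open>D U\<close> gives \<open>r'\<close>, \<open>p'\<close> and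
    \<open>q'\<close>; \<open>s\<close> and \<open>t\<close> are the factors of the undifferentiated
    \<open>T\<close> and \<open>U\<close>.\<close>
  define r' where "r' = (\<lambda>x. r x - deriv nb x)"
  define p' where "p' = (\<lambda>x. p x - deriv al x)"
  define q' where "q' = (\<lambda>x. q x + deriv r x - deriv (deriv nb) x)"
  define s where "s = (\<lambda>x. deriv p x - deriv (deriv al) x)"
  define t where "t = deriv q"
  have coefs: "coef X r'" "coef X p'" "coef X q'" "coef X s" "coef X t"
    unfolding r'_def p'_def q'_def s_def t_def
    by (intro coef_add coef_diff coef_deriv Suc.prems al nb(1))+
  obtain C1 R1 where C1: "C1 > 0" "R1 > 0" and est1: "resolvent_bound X c al nb r' p' q' m k C1 R1"
    using Suc.IH[OF coefs(1-3)] by blast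
  obtain C2 R2 where C2: "C2 > 0" "R2 > 0" and est2: "resolvent_bound X c al nb r p q m k C2 R2"
    using Suc.IH[OF Suc.prems] by blast
  obtain Ms where Ms: "Ms > 0"
    "\<And>\<xi> f. f \<in> H_per X k \<Longrightarrow> H_norm X \<xi> k (\<lambda>x. of_real (s x) * f x) \<le> Ms * H_norm X \<xi> k f"
    using H_norm_coef_le[OF X coefs(4), of k] by blast
  obtain Mt where Mt: "Mt > 0"
    "\<And>\<xi> f. f \<in> H_per X k \<Longrightarrow> H_norm X \<xi> k (\<lambda>x. of_real (t x) * f x) \<le> Mt * H_norm X \<xi> k f"
    using H_norm_coef_le[OF X coefs(5), of k] by blast
  define C where "C = C2 + C1 * (Ms + Mt) * C2 + C1"
  have C: "C > 0" "R1 + R2 > 0" using C1 C2 Ms(1) Mt(1) by (simp_all add: C_def add_pos_pos)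
  show ?case
  proof (rule exI[of _ C], intro conjI C(1), rule exI[of _ "R1 + R2"], intro conjI C(2))
    show "resolvent_bound X c al nb r p q m (Suc k) C (R1 + R2)"
      unfolding resolvent_bound_def resolvent_eq_def[of _ _ _ _ r p q]
    proof (intro allI impI, elim conjE)
      fix z \<xi> T U f g
      let ?D = "bloch_deriv X \<xi>"
      assume z: "cmod z \<ge> R1 + R2" "Re z \<ge> - m / 2"
        and H: "T \<in> H_per X (Suc (Suc k))" "U \<in> H_per X (Suc (Suc (Suc k)))" "f \<in> H_per X (Suc k)" "g \<in> H_per X (Suc k)"
        and eqs: "AE x in lborel. z * T x - of_real c * ?D T x - ?D U x = f x"
          "AE x in lborel. z * U x + of_real (r x) * ?D U x
          - ?D (\<lambda>x. of_real (al x) * T x + of_real (nb x) * ?D U x) x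
          + of_real (p x) * T x + of_real (q x) * U x = g x"
      have z12: "cmod z \<ge> R1" "cmod z \<ge> R2" using z(1) C1 C2 by linarith+
      note H1 = bloch_deriv_H_per[OF H(1) X, of \<xi>] bloch_deriv_H_per[OF H(2) X, of \<xi>]
        bloch_deriv_H_per[OF H(3) X, of \<xi>] bloch_deriv_H_per[OF H(4) X, of \<xi>]
      note H2 = bloch_deriv_H_per[OF H1(2) X, of \<xi>]
      note H0 = H_per_Suc_mono[OF H(1)] H_per_Suc_mono[OF H(2)]
      note Hk = H0(1)[THEN H_per_Suc_mono] H0(2)[THEN H_per_Suc_mono, THEN H_per_Suc_mono]
        H(3)[THEN H_per_Suc_mono] H(4)[THEN H_per_Suc_mono]
      let ?W = "\<lambda>x. of_real (al x) * T x + of_real (nb x) * ?D U x"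
      let ?W' = "\<lambda>x. of_real (al x) * ?D T x + of_real (nb x) * ?D (?D U) x"
      have W': "?W' \<in> H_per X (Suc k)"
        by (intro H_per_add H_per_coef X al nb(1) H1 H2)
      note D = bloch_derivI[OF H(1), of \<xi>] bloch_derivI[OF H(2), of \<xi>]
        bloch_derivI[OF H(3), of \<xi>] bloch_derivI[OF H(4), of \<xi>]
        bloch_derivI[OF H1(1), of \<xi>] bloch_derivI[OF H1(2), of \<xi>]
        bloch_derivI[OF W', of \<xi>]
      have eq1: "AE x in lborel. z * ?D T x - of_real c * ?D (?D T) x - ?D (?D U) x = ?D f x"
        by (rule has_bloch_deriv_unique[OF X _ D(3) eqs(1)]) (intro has_bloch_deriv_diff has_bloch_deriv_cmult D)
      have dW: "has_bloch_deriv X \<xi> ?W (\<lambda>x. (of_real (deriv al x) * T x + of_real (al x) * ?D T x) +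
          (of_real (deriv nb x) * ?D U x + of_real (nb x) * ?D (?D U) x))"
        by (intro has_bloch_deriv_add has_bloch_deriv_coef X al nb(1) D)
      let ?w = "\<lambda>x. of_real (deriv al x) * T x + of_real (deriv nb x) * ?D U x + ?W' x"
      have eqW: "AE x in lborel. z * U x + of_real (r x) * ?D U x - ?w x + of_real (p x) * T x + of_real (q x) * U x = g x"
        using eqs(2) bloch_deriv_AE[OF X dW] by eventually_elim (simp add: algebra_simps)
      have "AE x in lborel. z * ?D U x + (of_real (deriv r x) * ?D U x + of_real (r x) * ?D (?D U) x)
        - ((of_real (deriv (deriv al) x) * T x + of_real (deriv al x) * ?D T x) +
           (of_real (deriv (deriv nb) x) * ?D U x + of_real (deriv nb x) * ?D (?D U) x) + ?D ?W' x)
        + (of_real (deriv p x) * T x + of_real (p x) * ?D T x) + (of_real (deriv q x) * U x + of_real (q x) * ?D U x) = ?D g x"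
        by (rule has_bloch_deriv_unique[OF X _ D(4) eqW])
          (intro has_bloch_deriv_add has_bloch_deriv_diff has_bloch_deriv_cmult has_bloch_deriv_coef D X
            coef_deriv al nb(1) Suc.prems)
      then have eq2: "AE x in lborel. z * ?D U x + of_real (r' x) * ?D (?D U) x - ?D ?W' x
          + of_real (p' x) * ?D T x + of_real (q' x) * ?D U x = ?D g x - (of_real (s x) * T x + of_real (t x) * U x)"
        by eventually_elim (simp add: r'_def p'_def q'_def s_def t_def algebra_simps)
      let ?g' = "\<lambda>x. ?D g x - (of_real (s x) * T x + of_real (t x) * U x)"
      have sT: "(\<lambda>x. of_real (s x) * T x) \<in> H_per X k" "(\<lambda>x. of_real (t x) * U x) \<in> H_per X k"
        by (intro H_per_coef X coefs Hk)+
      have g': "?g' \<in> H_per X k" by (intro H_per_diff H_per_add sT H1)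
      let ?N = "H_norm X \<xi> k"
      \<comment> \<open>The induction hypothesis is used twice: in \<open>a1\<close> for the
        differentiated system with its new coefficients, in \<open>a2\<close> for the original one,
        which controls the terms with \<open>s\<close> and \<open>t\<close> in
        \<open>?g'\<close>.\<close>
      have a1: "?N (?D T) + ?N (?D U) \<le> C1 * (?N (?D f) + ?N ?g')"
        using est1 z12(1) z(2) H1(1,2,3) g' eq1 eq2 unfolding resolvent_bound_def resolvent_eq_def by blast
      have a2: "?N T + ?N U \<le> C2 * (?N f + ?N g)"
        using est2 z12(2) z(2) H0(1,2) Hk(3,4) eqs unfolding resolvent_bound_def resolvent_eq_def by blast
      have "?N ?g' \<le> ?N (?D g) + ?N (\<lambda>x. of_real (s x) * T x + of_real (t x) * U x)"
        by (intro H_norm_diff X H1 H_per_add sT)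
      also have "\<dots> \<le> ?N (?D g) + (?N (\<lambda>x. of_real (s x) * T x) + ?N (\<lambda>x. of_real (t x) * U x))"
        by (intro add_left_mono H_norm_add X sT)
      also have "\<dots> \<le> ?N (?D g) + (Ms * ?N T + Mt * ?N U)"
        by (intro add_left_mono add_mono Ms Mt Hk)
      also have "\<dots> \<le> ?N (?D g) + (Ms + Mt) * (?N T + ?N U)"
        using Ms(1) Mt(1) by (simp add: algebra_simps)
      also have "\<dots> \<le> ?N (?D g) + (Ms + Mt) * (C2 * (?N f + ?N g))"
        using Ms(1) Mt(1) by (intro add_left_mono mult_left_mono a2) simp
      finally have "C1 * (?N (?D f) + ?N ?g') \<le> C1 * (?N (?D f) + (?N (?D g) + (Ms + Mt) * (C2 * (?N f + ?N g))))"
        using C1(1) by (intro mult_left_mono add_left_mono) auto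
      with a1 have a3: "?N (?D T) + ?N (?D U) \<le> C1 * (?N (?D f) + ?N (?D g)) + C1 * (Ms + Mt) * C2 * (?N f + ?N g)"
        by (simp add: algebra_simps)
      have "L2_norm X T + L2_norm X U \<le> C2 * (?N f + ?N g)"
        using a2 L2_norm_le_H_norm[of X T \<xi> k] L2_norm_le_H_norm[of X U \<xi> k] by linarith
      with a3 have "H_norm X \<xi> (Suc k) T + H_norm X \<xi> (Suc k) U \<le>
          (C2 + C1 * (Ms + Mt) * C2) * (?N f + ?N g) + C1 * (?N (?D f) + ?N (?D g))"
        by (simp add: algebra_simps)
      also have "\<dots> \<le> (C2 + C1 * (Ms + Mt) * C2) * (H_norm X \<xi> (Suc k) f + H_norm X \<xi> (Suc k) g) +
          C1 * (H_norm X \<xi> (Suc k) f + H_norm X \<xi> (Suc k) g)"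
      proof (intro add_mono mult_left_mono H_norm_Suc_mono)
        show "0 \<le> C2 + C1 * (Ms + Mt) * C2" using C1 C2 Ms(1) Mt(1) by simp
      qed (use C1 in auto)
      also have "\<dots> = C * (H_norm X \<xi> (Suc k) f + H_norm X \<xi> (Suc k) g)"
        by (simp add: C_def algebra_simps)
      finally show "H_norm X \<xi> (Suc k) T + H_norm X \<xi> (Suc k) U \<le> C * (H_norm X \<xi> (Suc k) f + H_norm X \<xi> (Suc k) g)" .
    qed
  qed
qed

section \<open>Periodic solutions of linear differential equations\<close>

text \<open>Integrating \<open>exp (K * |x|)\<close> gains a factor \<open>1 / K\<close>, the source
  of contraction for Picard iteration in an exponentially weighted norm. Negative \<open>x\<close>
  is treated by reflection.\<close>

lemma exp_weighted_primitive_bound: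
  fixes G :: "real \<Rightarrow> 'a::real_normed_vector"
  assumes G: "G 0 = 0" "\<And>x. (G has_vector_derivative g x) (at x)"
    and K: "K > 0" and g: "\<And>x. norm (g x) \<le> N * exp (K * \<bar>x\<bar>)"
  shows "norm (G x) \<le> N / K * exp (K * \<bar>x\<bar>)"
proof -
  have N: "N \<ge> 0" using order_trans[OF norm_ge_zero g[of 0]] by simp
  have *: "norm (H x) \<le> N / K * exp (K * x)"
    if H: "H 0 = 0" "\<And>x. (H has_vector_derivative h x) (at x)" "\<And>x. norm (h x) \<le> N * exp (K * \<bar>x\<bar>)"
      and x: "x \<ge> 0" for H h :: "real \<Rightarrow> 'a" and x
  proof (cases "x = 0")
    case True
    then show ?thesis using H(1) N K by simp
  next
    case False
    have "continuous_on {0..x} H"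
      using H(2) by (meson continuous_at_imp_continuous_on has_vector_derivative_continuous)
    moreover have "((\<lambda>x. N / K * exp (K * x)) has_vector_derivative N * exp (K * t)) (at t)" for t
      unfolding real_vector_deriv[symmetric]
      using K by (auto intro!: derivative_eq_intros)
    moreover have "norm (h t) \<le> N * exp (K * t)" if "0 < t" for t using H(3)[of t] that by simp
    ultimately have "norm (H x - H 0) \<le> N / K * exp (K * x) - N / K * exp (K * 0)"
      using False x
      by (intro differentiable_bound_general[where f' = h and \<phi>' = "\<lambda>t. N * exp (K * t)"] H(2))
        (auto intro!: continuous_intros simp: K less_imp_neq[OF K, symmetric])
    also have "\<dots> \<le> N / K * exp (K * x)" using N K by simp
    finally show ?thesis using H(1) by simp
  qed
  show ?thesis
  proof (cases "x \<ge> 0")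
    case True
    then show ?thesis using *[OF G g] by simp
  next
    case False
    have "((\<lambda>x. G (- x)) has_vector_derivative - g (- x)) (at x)" for x
      using vector_diff_chain_at[of uminus "-1" x G "g (- x)"] G(2)
      by (simp add: o_def has_vector_derivative_minus[OF has_vector_derivative_id])
    then have "norm (G (- (- x))) \<le> N / K * exp (K * (- x))"
      using False g G(1) by (intro *[of "\<lambda>x. G (- x)" "\<lambda>x. - g (- x)"]) (auto, metis abs_minus_cancel)
    then show ?thesis using False by simp
  qed
qed

text \<open>Picard iteration on the whole line at once, in Bielecki's weighted supremum norm. The
  unknown is \<open>v x = exp (- K * |x|) * y x\<close>, which lies in the complete space of bounded
  continuous functions.\<close>

lemma linear_ode_exists:
  fixes A :: "real \<Rightarrow> 'a::euclidean_space \<Rightarrow> 'a" and h :: "real \<Rightarrow> 'a"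
  assumes lin: "\<And>x. linear (A x)" and bnd: "\<And>x y. norm (A x y) \<le> M * norm y"
    and cont: "\<And>y. continuous_on UNIV y \<Longrightarrow> continuous_on UNIV (\<lambda>x. A x (y x))"
    and h: "continuous_on UNIV h" "\<And>x. norm (h x) \<le> B"
  obtains y where "y 0 = y0" "\<And>x. (y has_vector_derivative A x (y x) + h x) (at x)"
proof -
  have M: "M \<ge> 0"
  proof -
    obtain b :: 'a where "b \<in> Basis" using nonempty_Basis by blast
    then show ?thesis using order_trans[OF norm_ge_zero bnd[of 0 b]] by simp
  qed
  \<comment> \<open>The summand \<open>2 * M\<close> makes the contraction factor
    \<open>M / K\<close> at most one half; the summand 1 keeps \<open>K\<close> positive when
    \<open>M = 0\<close>.\<close>
  define K where "K = 2 * M + 1"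
  have K: "K > 0" "K \<ge> 2 * M" using M by (simp_all add: K_def)
  define rhs where "rhs = (\<lambda>(v :: real \<Rightarrow>\<^sub>C 'a) t. A t (exp (K * \<bar>t\<bar>) *\<^sub>R v t) + h t)"
  have contrhs: "continuous_on UNIV (rhs v)" for v
    unfolding rhs_def by (intro continuous_on_add cont h) (auto intro!: continuous_intros)
  have "\<exists>F. F 0 = 0 \<and> (\<forall>x. (F has_vector_derivative rhs v x) (at x))" for v
    using antiderivative_on_line[OF contrhs[of v]] by blast
  then obtain P where P: "\<And>v. P v 0 = 0" "\<And>v x. (P v has_vector_derivative rhs v x) (at x)"
    by metis
  define \<Phi> where "\<Phi> = (\<lambda>v x. exp (- (K * \<bar>x\<bar>)) *\<^sub>R (y0 + P v x))"
  have \<Phi>: "\<Phi> v \<in> bcontfun" for v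
  proof (rule bcontfun_normI)
    have "continuous_on UNIV (P v)"
      using P(2) by (meson continuous_at_imp_continuous_on has_vector_derivative_continuous)
    then show "continuous_on UNIV (\<Phi> v)" unfolding \<Phi>_def by (intro continuous_intros)
    fix x
    have "norm (rhs v t) \<le> (M * norm v + B) * exp (K * \<bar>t\<bar>)" for t
    proof -
      have "norm (rhs v t) \<le> M * (exp (K * \<bar>t\<bar>) * norm (v t)) + B"
        unfolding rhs_def using bnd[of t "exp (K * \<bar>t\<bar>) *\<^sub>R v t"] h(2)[of t]
        by (intro order_trans[OF norm_triangle_ineq] add_mono) simp_all
      also have "\<dots> \<le> M * (exp (K * \<bar>t\<bar>) * norm v) + B * exp (K * \<bar>t\<bar>)"
      proof (intro add_mono mult_left_mono norm_bounded M)
        have "B \<ge> 0" using order_trans[OF norm_ge_zero h(2)] .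
        moreover have "1 \<le> exp (K * \<bar>t\<bar>)" using K(1) by simp
        ultimately show "B \<le> B * exp (K * \<bar>t\<bar>)" by (metis mult_left_mono mult.right_neutral)
      qed simp
      finally show ?thesis by (simp add: algebra_simps)
    qed
    from exp_weighted_primitive_bound[OF P(1) P(2) K(1) this]
    have "norm (y0 + P v x) \<le> norm y0 + (M * norm v + B) / K * exp (K * \<bar>x\<bar>)"
      by (intro order_trans[OF norm_triangle_ineq] add_left_mono)
    then have "norm (\<Phi> v x) \<le> exp (- (K * \<bar>x\<bar>)) * (norm y0 + (M * norm v + B) / K * exp (K * \<bar>x\<bar>))"
      unfolding \<Phi>_def by simp
    also have "\<dots> = exp (- (K * \<bar>x\<bar>)) * norm y0 + (M * norm v + B) / K"
      by (simp add: distrib_left mult.left_commute exp_minus_inverse mult.commute flip: exp_add)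
    also have "\<dots> \<le> norm y0 + (M * norm v + B) / K"
      using K(1) by (simp add: mult_left_le_one_le)
    finally show "norm (\<Phi> v x) \<le> norm y0 + (M * norm v + B) / K" .
  qed
  have "\<exists>!v. Bcontfun (\<Phi> v) = v"
  proof (rule banach_fix_type[of "1 / 2"]; (intro allI)?)
    fix v w
    show "dist (Bcontfun (\<Phi> v)) (Bcontfun (\<Phi> w)) \<le> 1 / 2 * dist v w"
    proof (rule dist_bound)
      fix x
      have "((\<lambda>x. P v x - P w x) has_vector_derivative rhs v x - rhs w x) (at x)" for x
        by (intro has_vector_derivative_diff P)
      moreover have "norm (rhs v t - rhs w t) \<le> (M * dist v w) * exp (K * \<bar>t\<bar>)" for t
      proof -
        have "rhs v t - rhs w t = A t (exp (K * \<bar>t\<bar>) *\<^sub>R (v t - w t))"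
          by (simp add: rhs_def linear_diff[OF lin] scaleR_diff_right)
        also have "norm \<dots> \<le> M * (exp (K * \<bar>t\<bar>) * norm (v t - w t))"
          using bnd[of t "exp (K * \<bar>t\<bar>) *\<^sub>R (v t - w t)"] by simp
        also have "\<dots> \<le> M * (exp (K * \<bar>t\<bar>) * dist v w)"
          using dist_bounded[of v t w] M by (intro mult_left_mono) (simp_all add: dist_norm)
        finally show ?thesis by (simp add: mult_ac)
      qed
      ultimately have "norm (P v x - P w x) \<le> (M * dist v w) / K * exp (K * \<bar>x\<bar>)"
        using P(1) by (intro exp_weighted_primitive_bound[OF _ _ K(1)]) auto
      then have "exp (- (K * \<bar>x\<bar>)) * norm (P v x - P w x) \<le>
          exp (- (K * \<bar>x\<bar>)) * ((M * dist v w) / K * exp (K * \<bar>x\<bar>))"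
        by (rule mult_left_mono) simp
      also have "\<dots> = (M * dist v w) / K" by (simp add: exp_minus)
      also have "\<dots> \<le> 1 / 2 * dist v w"
        using K M mult_right_mono[OF K(2), of "dist v w"] by (simp add: pos_divide_le_eq field_simps)
      finally have "norm (\<Phi> v x - \<Phi> w x) \<le> 1 / 2 * dist v w"
        by (simp add: \<Phi>_def flip: scaleR_diff_right)
      then show "dist (Bcontfun (\<Phi> v) x) (Bcontfun (\<Phi> w) x) \<le> 1 / 2 * dist v w"
        by (simp add: Bcontfun_inverse[OF \<Phi>] dist_norm)
    qed
  qed simp_all
  then obtain v where "Bcontfun (\<Phi> v) = v" by blast
  then have v: "apply_bcontfun v = \<Phi> v" by (metis Bcontfun_inverse[OF \<Phi>])
  define y where "y = (\<lambda>x. y0 + P v x)"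
  have y: "exp (K * \<bar>x\<bar>) *\<^sub>R v x = y x" for x
    unfolding v by (simp add: \<Phi>_def y_def exp_minus)
  show thesis
  proof (rule that[of y])
    show "y 0 = y0" by (simp add: y_def P)
    have "(y has_vector_derivative 0 + rhs v x) (at x)" for x
      unfolding y_def by (intro has_vector_derivative_add has_vector_derivative_const P)
    then show "(y has_vector_derivative A x (y x) + h x) (at x)" for x
      by (simp add: rhs_def y)
  qed
qed

text \<open>Gronwall's argument for the squared norm: weighted by \<open>exp (- 2 * M * x)\<close>
  it does not increase to the right of 0, weighted by \<open>exp (2 * M * x)\<close> it does not
  decrease to the left of 0, and it vanishes at 0.\<close>

lemma linear_ode_unique:
  fixes A :: "real \<Rightarrow> 'a::euclidean_space \<Rightarrow> 'a"
  assumes bnd: "\<And>x y. norm (A x y) \<le> M * norm y"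
    and y: "y 0 = 0" "\<And>x. (y has_vector_derivative A x (y x)) (at x)"
  shows "y x = 0"
proof -
  have D: "((\<lambda>x. y x \<bullet> y x) has_real_derivative 2 * (y x \<bullet> A x (y x))) (at x)" for x
    using has_derivative_inner[OF y(2)[of x, unfolded has_vector_derivative_def] y(2)[of x, unfolded has_vector_derivative_def]]
    by (simp add: has_field_derivative_def inner_commute algebra_simps mult_commute_abs)
  have b: "\<bar>y x \<bullet> A x (y x)\<bar> \<le> M * (y x \<bullet> y x)" for x
  proof -
    have "\<bar>y x \<bullet> A x (y x)\<bar> \<le> norm (y x) * norm (A x (y x))" by (rule Cauchy_Schwarz_ineq2)
    also have "\<dots> \<le> norm (y x) * (M * norm (y x))" by (intro mult_left_mono bnd) simp
    finally show ?thesis by (simp add: dot_square_norm power2_eq_square mult_ac)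
  qed
  have E: "((\<lambda>x. exp (s * x) * (y x \<bullet> y x)) has_real_derivative
      exp (s * x) * (s * (y x \<bullet> y x) + 2 * (y x \<bullet> A x (y x)))) (at x)" for s x
    by (rule derivative_eq_intros D | simp add: algebra_simps)+
  have "y x \<bullet> y x \<le> 0"
  proof (cases "x \<ge> 0")
    case True
    have "exp (- 2 * M * x) * (y x \<bullet> y x) \<le> exp (- 2 * M * 0) * (y 0 \<bullet> y 0)"
    proof (rule DERIV_nonpos_imp_nonincreasing[OF True])
      fix t
      have "exp (- 2 * M * t) * (- 2 * M * (y t \<bullet> y t) + 2 * (y t \<bullet> A t (y t))) \<le> 0"
        using b[of t] by (intro mult_nonneg_nonpos) auto
      then show "\<exists>d. ((\<lambda>x. exp (- 2 * M * x) * (y x \<bullet> y x)) has_real_derivative d) (at t) \<and> d \<le> 0"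
        using E[of "- 2 * M" t] by blast
    qed
    then show ?thesis by (simp add: y(1) mult_le_0_iff)
  next
    case False
    then have "x \<le> 0" by simp
    have "exp (2 * M * x) * (y x \<bullet> y x) \<le> exp (2 * M * 0) * (y 0 \<bullet> y 0)"
    proof (rule DERIV_nonneg_imp_nondecreasing[OF \<open>x \<le> 0\<close>])
      fix t
      have "exp (2 * M * t) * (2 * M * (y t \<bullet> y t) + 2 * (y t \<bullet> A t (y t))) \<ge> 0"
        using b[of t] by (intro mult_nonneg_nonneg) auto
      then show "\<exists>d. ((\<lambda>x. exp (2 * M * x) * (y x \<bullet> y x)) has_real_derivative d) (at t) \<and> 0 \<le> d"
        using E[of "2 * M" t] by blast
    qed
    then show ?thesis by (simp add: y(1) mult_le_0_iff)
  qed
  then show ?thesis by (metis inner_gt_zero_iff not_le)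
qed

text \<open>Fredholm alternative: \<open>L\<close> is the monodromy map minus the identity on
  initial values. Uniqueness of periodic solutions makes it injective, finite dimension makes it
  surjective, and a particular solution \<open>p\<close> is corrected by the homogeneous one
  starting at \<open>y0\<close> with \<open>L y0 = - p X\<close>.\<close>

lemma periodic_linear_ode_exists:
  fixes A :: "real \<Rightarrow> 'a::euclidean_space \<Rightarrow> 'a" and h :: "real \<Rightarrow> 'a"
  assumes X: "X > 0"
    and lin: "\<And>x. linear (A x)" and bnd: "\<And>x y. norm (A x y) \<le> M * norm y"
    and cont: "\<And>y. continuous_on UNIV y \<Longrightarrow> continuous_on UNIV (\<lambda>x. A x (y x))"
    and per: "\<And>x. A (x + X) = A x" "periodic X h" and h: "continuous_on UNIV h"
    and uniq: "\<And>y x. (\<And>x. (y has_vector_derivative A x (y x)) (at x)) \<Longrightarrow> periodic X y \<Longrightarrow> y x = 0"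
  obtains y where "periodic X y" "\<And>x. (y has_vector_derivative A x (y x) + h x) (at x)"
proof -
  obtain B where B: "\<And>x. norm (h x) \<le> B" using periodic_bounded[OF h per(2) X] by blast
  have shift: "((\<lambda>x. y (x + X)) has_vector_derivative d (x + X)) (at x)"
    if "\<And>x. (y has_vector_derivative d x) (at x)" for y d x
    using vector_diff_chain_at[of "\<lambda>x. x + X" 1 x y "d (x + X)"] that
    by (simp add: o_def has_vector_derivative_add_const)
  \<comment> \<open>Equal values at 0 and \<open>X\<close> suffice: the shifted solution minus the
    solution solves the homogeneous equation with initial value zero.\<close>
  have perI: "periodic X y"
    if y: "\<And>x. (y has_vector_derivative A x (y x) + k x) (at x)" "y X = y 0" "periodic X k" for y k
  proof -
    have "((\<lambda>x. y (x + X) - y x) has_vector_derivative A x (y (x + X) - y x)) (at x)" for x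
      using has_vector_derivative_diff[OF shift[OF y(1)] y(1)] y(3)
      by (simp add: per(1) linear_diff[OF lin] periodic_def)
    from linear_ode_unique[OF bnd _ this] y(2) show ?thesis by (simp add: periodic_def)
  qed
  have "\<exists>y. y 0 = y0 \<and> (\<forall>x. (y has_vector_derivative A x (y x)) (at x))" for y0
  proof -
    obtain y where "y 0 = y0" "\<And>x. (y has_vector_derivative A x (y x) + 0) (at x)"
      by (rule linear_ode_exists[OF lin bnd cont, of "\<lambda>_. 0" 0 y0]) auto
    then show ?thesis by auto
  qed
  then have "\<exists>S. \<forall>y0. S y0 0 = y0 \<and> (\<forall>x. (S y0 has_vector_derivative A x (S y0 x)) (at x))"
    by (rule choice[OF allI])
  then obtain S where S: "\<And>y0. S y0 0 = y0" "\<And>y0 x. (S y0 has_vector_derivative A x (S y0 x)) (at x)"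
    by auto
  have S_unique: "y x = S (y 0) x" if "\<And>x. (y has_vector_derivative A x (y x)) (at x)" for y x
  proof -
    have "((\<lambda>x. y x - S (y 0) x) has_vector_derivative A x (y x - S (y 0) x)) (at x)" for x
      using has_vector_derivative_diff[OF that S(2)] by (simp add: linear_diff[OF lin])
    then have "y x - S (y 0) x = 0" by (rule linear_ode_unique[OF bnd, rotated]) (simp add: S(1))
    then show ?thesis by simp
  qed
  define L where "L = (\<lambda>y0. S y0 X - y0)"
  have "linear L"
  proof
    fix u v :: 'a and r :: real
    have "((\<lambda>x. S u x + S v x) has_vector_derivative A x (S u x + S v x)) (at x)" for x
      using has_vector_derivative_add[OF S(2) S(2)] by (simp add: linear_add[OF lin])
    from S_unique[OF this, of X] show "L (u + v) = L u + L v" by (simp add: L_def S(1))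
    have "((\<lambda>x. r *\<^sub>R S u x) has_vector_derivative A x (r *\<^sub>R S u x)) (at x)" for x
      using has_vector_derivative_scaleR[OF DERIV_const S(2), of r] by (simp add: linear_scale[OF lin])
    from S_unique[OF this, of X] show "L (r *\<^sub>R u) = r *\<^sub>R L u" by (simp add: L_def S(1) scaleR_diff_right)
  qed
  moreover have "inj L"
  proof (rule linear_injective_0[OF \<open>linear L\<close>, THEN iffD2], intro allI impI)
    fix v assume "L v = 0"
    then have "periodic X (S v)"
      using S by (intro perI[of "S v" "\<lambda>_. 0"]) (auto simp: L_def periodic_def)
    from uniq[OF S(2) this, of 0] S(1) show "v = 0" by simp
  qed
  ultimately have "surj L" by (rule linear_injective_imp_surjective) simp
  obtain p where p: "p 0 = 0" "\<And>x. (p has_vector_derivative A x (p x) + h x) (at x)"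
    using linear_ode_exists[OF lin bnd cont h B, of 0] by blast
  obtain y0 where y0: "L y0 = - p X" using \<open>surj L\<close> by (metis surjD)
  have y: "((\<lambda>x. S y0 x + p x) has_vector_derivative A x (S y0 x + p x) + h x) (at x)" for x
    using has_vector_derivative_add[OF S(2) p(2)] by (simp add: linear_add[OF lin] add.assoc)
  moreover have "periodic X (\<lambda>x. S y0 x + p x)"
    using y0 S(1) p(1) per(2) by (intro perI[OF y]) (auto simp: L_def algebra_simps)
  ultimately show thesis using that by blast
qed

text \<open>The entries of the 3 by 3 matrix are \<open>k 0\<close> to \<open>k 8\<close>, row by
  row. The system is spelled out in scalar components because the resolvent equation is matched with
  it one equation at a time.\<close>

lemma periodic_linear_system_exists:
  fixes k :: "nat \<Rightarrow> real \<Rightarrow> complex" and f g h :: "real \<Rightarrow> complex"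
  assumes X: "X > 0"
    and k: "\<And>i. continuous_on UNIV (k i)" "\<And>i. periodic X (k i)"
    and fgh: "continuous_on UNIV f" "periodic X f" "continuous_on UNIV g" "periodic X g"
      "continuous_on UNIV h" "periodic X h"
    and uniq: "\<And>t u w x.
      (\<And>x. (t has_vector_derivative k 0 x * t x + k 1 x * u x + k 2 x * w x) (at x)) \<Longrightarrow>
      (\<And>x. (u has_vector_derivative k 3 x * t x + k 4 x * u x + k 5 x * w x) (at x)) \<Longrightarrow>
      (\<And>x. (w has_vector_derivative k 6 x * t x + k 7 x * u x + k 8 x * w x) (at x)) \<Longrightarrow>
      periodic X t \<Longrightarrow> periodic X u \<Longrightarrow> periodic X w \<Longrightarrow> t x = 0 \<and> u x = 0 \<and> w x = 0"
  obtains t u w where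
    "\<And>x. (t has_vector_derivative k 0 x * t x + k 1 x * u x + k 2 x * w x + f x) (at x)"
    "\<And>x. (u has_vector_derivative k 3 x * t x + k 4 x * u x + k 5 x * w x + g x) (at x)"
    "\<And>x. (w has_vector_derivative k 6 x * t x + k 7 x * u x + k 8 x * w x + h x) (at x)"
    "periodic X t" "periodic X u" "periodic X w"
proof -
  define A where "A = (\<lambda>x (y :: complex \<times> complex \<times> complex).
    (k 0 x * fst y + k 1 x * fst (snd y) + k 2 x * snd (snd y),
     k 3 x * fst y + k 4 x * fst (snd y) + k 5 x * snd (snd y),
     k 6 x * fst y + k 7 x * fst (snd y) + k 8 x * snd (snd y)))"
  have "\<exists>M. \<forall>x. norm (k i x) \<le> M" for i
    using periodic_bounded[OF k(1)[of i] k(2)[of i] X] by metis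
  then obtain M where M: "\<And>i x. norm (k i x) \<le> M i" by metis
  have "M i \<ge> 0" for i using order_trans[OF norm_ge_zero M] .
  define N where "N = (\<Sum>i<9. M i)"
  have N: "norm (k i x) \<le> N" if "i < 9" for i x
    using M[of i x] member_le_sum[of i "{..<9}" M] that \<open>\<And>i. M i \<ge> 0\<close> by (simp add: N_def)
  have comp: "norm (fst y) \<le> norm y" "norm (fst (snd y)) \<le> norm y" "norm (snd (snd y)) \<le> norm y"
    for y :: "complex \<times> complex \<times> complex"
    by (cases y, use norm_fst_le norm_snd_le order_trans in \<open>metis fst_conv snd_conv prod.collapse\<close>)+
  have row: "norm (k i x * fst y + k j x * fst (snd y) + k l x * snd (snd y)) \<le> 3 * N * norm y"
    if "i < 9" "j < 9" "l < 9" for i j l x and y :: "complex \<times> complex \<times> complex"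
  proof -
    have *: "norm (k i x * v) \<le> N * norm y" if "i < 9" "norm v \<le> norm y" for i v
      using mult_mono[OF N[OF that(1), of x] that(2)] order_trans[OF norm_ge_zero N[OF that(1), of x]]
      by (simp add: norm_mult)
    have "norm (k i x * fst y + k j x * fst (snd y) + k l x * snd (snd y)) \<le> N * norm y + N * norm y + N * norm y"
      by (intro norm_triangle_le add_mono * that comp)
    then show ?thesis by simp
  qed
  have "norm (A x y) \<le> (9 * N) * norm y" for x y
  proof -
    have "norm (A x y) \<le> norm (fst (A x y)) + (norm (fst (snd (A x y))) + norm (snd (snd (A x y))))"
      using norm_Pair_le[of "fst (A x y)" "snd (A x y)"] norm_Pair_le[of "fst (snd (A x y))" "snd (snd (A x y))"]
      by simp
    also have "\<dots> \<le> 3 * N * norm y + (3 * N * norm y + 3 * N * norm y)"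
      unfolding A_def fst_conv snd_conv by (intro add_mono row) simp_all
    finally show ?thesis by simp
  qed
  note bnd = this
  have lin: "linear (A x)" for x
    by (rule linearI) (simp_all add: A_def algebra_simps scaleR_conv_of_real)
  have cont: "continuous_on UNIV (\<lambda>x. A x (y x))" if "continuous_on UNIV y" for y
    unfolding A_def using that k(1) by (intro continuous_intros) auto
  have comps: "((\<lambda>x. fst (y x)) has_vector_derivative fst d) (at x)"
    "((\<lambda>x. fst (snd (y x))) has_vector_derivative fst (snd d)) (at x)"
    "((\<lambda>x. snd (snd (y x))) has_vector_derivative snd (snd d)) (at x)"
    if "(y has_vector_derivative d) (at x)" for y :: "real \<Rightarrow> complex \<times> complex \<times> complex" and d x
    using that by (intro bounded_linear.has_vector_derivative[OF bounded_linear_fst]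
        bounded_linear.has_vector_derivative[OF bounded_linear_snd]; simp)+
  have percomps: "periodic X (\<lambda>x. fst (y x))" "periodic X (\<lambda>x. fst (snd (y x)))" "periodic X (\<lambda>x. snd (snd (y x)))"
    if "periodic X y" for y :: "real \<Rightarrow> complex \<times> complex \<times> complex"
    using that by (simp_all add: periodic_def)
  obtain y where y: "periodic X y" "\<And>x. (y has_vector_derivative A x (y x) + (f x, g x, h x)) (at x)"
  proof (rule periodic_linear_ode_exists[OF X lin bnd cont])
    show "A (x + X) = A x" for x using k(2) by (simp add: A_def periodic_def)
    show "periodic X (\<lambda>x. (f x, g x, h x))" using fgh by (simp add: periodic_def)
    show "continuous_on UNIV (\<lambda>x. (f x, g x, h x))" using fgh by (intro continuous_intros)
    fix y :: "real \<Rightarrow> complex \<times> complex \<times> complex" and x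
    assume y: "\<And>x. (y has_vector_derivative A x (y x)) (at x)" "periodic X y"
    have "fst (y x) = 0 \<and> fst (snd (y x)) = 0 \<and> snd (snd (y x)) = 0"
      using comps[OF y(1)] percomps[OF y(2)]
      by (intro uniq[of "\<lambda>x. fst (y x)" "\<lambda>x. fst (snd (y x))" "\<lambda>x. snd (snd (y x))"]) (simp_all add: A_def)
    then show "y x = 0" by (simp add: prod_eq_iff)
  qed auto
  show thesis
    using comps[OF y(2)] percomps[OF y(1)]
    by (intro that[of "\<lambda>x. fst (y x)" "\<lambda>x. fst (snd (y x))" "\<lambda>x. snd (snd (y x))"]) (simp_all add: A_def)
qed

section \<open>Solvability of the resolvent equation\<close>

lemma H_norm_zeroD:
  assumes "f \<in> L2_per X" "X > 0" "H_norm X \<xi> k f = 0"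
  shows "AE x in lborel. f x = 0"
proof -
  have "L2_norm X f = 0"
    using assms(3) L2_norm_le_H_norm[of X f \<xi> k] L2_norm_nonneg[of X f] by linarith
  then show ?thesis using assms by (intro L2_norm_zeroD)
qed

lemma H_per_zero: "(\<lambda>_. 0) \<in> H_per X k"
proof (induction k)
  case (Suc k)
  have "has_weak_deriv X (\<lambda>_. 0) (\<lambda>_. 0)" by (simp add: has_weak_deriv_def)
  then show ?case using Suc by (rule H_per_SucI)
qed simp

lemma H_norm_zero: "X > 0 \<Longrightarrow> H_norm X \<xi> k (\<lambda>_. 0) = 0"
  using H_norm_cmult[of X "\<lambda>_. 0" k \<xi> 0] H_per_zero by simp

text \<open>\<open>resolvent_eq\<close> is stated with the arbitrary choice made by
  \<open>bloch_deriv\<close>; this allows any representatives of the derivatives and of the flux in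
  its place.\<close>

lemma resolvent_eq_iff:
  assumes X: "X > 0" and coefs: "coef X al" "coef X nb"
    and H: "T \<in> H_per X (Suc 0)" "U \<in> H_per X (Suc (Suc 0))"
    and D: "has_bloch_deriv X \<xi> T T1" "has_bloch_deriv X \<xi> U U1" "has_bloch_deriv X \<xi> W W1"
    and W: "AE x in lborel. W x = of_real (al x) * T x + of_real (nb x) * U1 x"
  shows "resolvent_eq X c al nb r p q z \<xi> T U f g \<longleftrightarrow>
    (AE x in lborel. z * T x - of_real c * T1 x - U1 x = f x) \<and>
    (AE x in lborel. z * U x + of_real (r x) * U1 x - W1 x + of_real (p x) * T x + of_real (q x) * U x = g x)"
proof -
  let ?D = "bloch_deriv X \<xi>" and ?W = "\<lambda>x. of_real (al x) * T x + of_real (nb x) * bloch_deriv X \<xi> U x"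
  have TU: "AE x in lborel. ?D T x = T1 x" "AE x in lborel. ?D U x = U1 x"
    using D X by (blast intro: bloch_deriv_AE)+
  have "?W \<in> H_per X (Suc 0)"
    by (intro H_per_add H_per_coef X coefs H(1) bloch_deriv_H_per[OF H(2) X])
  moreover have "AE x in lborel. ?W x = W x" using TU(2) W by eventually_elim simp
  ultimately have WW: "AE x in lborel. ?D ?W x = W1 x"
    by (intro has_bloch_deriv_unique[OF X bloch_derivI D(3)])
  have "(AE x in lborel. z * T x - of_real c * ?D T x - ?D U x = f x) \<longleftrightarrow>
      (AE x in lborel. z * T x - of_real c * T1 x - U1 x = f x)"
    by (rule eventually_subst) (use TU in \<open>eventually_elim, simp\<close>)
  moreover have "(AE x in lborel. z * U x + of_real (r x) * ?D U x - ?D ?W x + of_real (p x) * T x + of_real (q x) * U x = g x) \<longleftrightarrow>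
      (AE x in lborel. z * U x + of_real (r x) * U1 x - W1 x + of_real (p x) * T x + of_real (q x) * U x = g x)"
    by (rule eventually_subst) (use TU WW in \<open>eventually_elim, simp\<close>)
  ultimately show ?thesis by (simp add: resolvent_eq_def)
qed

lemma resolvent_eq_diff:
  assumes X: "X > 0" and coefs: "coef X al" "coef X nb"
    and H: "T \<in> H_per X (Suc 0)" "U \<in> H_per X (Suc (Suc 0))" "T' \<in> H_per X (Suc 0)" "U' \<in> H_per X (Suc (Suc 0))"
    and eq: "resolvent_eq X c al nb r p q z \<xi> T U f g" "resolvent_eq X c al nb r p q z \<xi> T' U' f' g'"
  shows "resolvent_eq X c al nb r p q z \<xi> (\<lambda>x. T x - T' x) (\<lambda>x. U x - U' x) (\<lambda>x. f x - f' x) (\<lambda>x. g x - g' x)"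
proof -
  let ?D = "bloch_deriv X \<xi>" and ?W = "\<lambda>T U x. of_real (al x) * T x + of_real (nb x) * bloch_deriv X \<xi> U x"
  have HW: "?W T U \<in> H_per X (Suc 0)" "?W T' U' \<in> H_per X (Suc 0)"
    by (intro H_per_add H_per_coef X coefs H bloch_deriv_H_per[OF H(2) X] bloch_deriv_H_per[OF H(4) X])+
  note D = H(1,2,3,4)[THEN bloch_derivI, of \<xi>] HW[THEN bloch_derivI, of \<xi>]
  show ?thesis
  proof (subst resolvent_eq_iff[OF X coefs _ _ has_bloch_deriv_diff[OF D(1,3)] has_bloch_deriv_diff[OF D(2,4)] has_bloch_deriv_diff[OF D(5,6)]])
    show "(\<lambda>x. T x - T' x) \<in> H_per X (Suc 0)" "(\<lambda>x. U x - U' x) \<in> H_per X (Suc (Suc 0))"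
      using H by (blast intro: H_per_diff)+
    show "AE x in lborel. ?W T U x - ?W T' U' x = of_real (al x) * (T x - T' x) + of_real (nb x) * (?D U x - ?D U' x)"
      by (simp add: algebra_simps)
    have eqs: "AE x in lborel. z * T x - of_real c * ?D T x - ?D U x = f x"
      "AE x in lborel. z * U x + of_real (r x) * ?D U x - ?D (?W T U) x + of_real (p x) * T x + of_real (q x) * U x = g x"
      "AE x in lborel. z * T' x - of_real c * ?D T' x - ?D U' x = f' x"
      "AE x in lborel. z * U' x + of_real (r x) * ?D U' x - ?D (?W T' U') x + of_real (p x) * T' x + of_real (q x) * U' x = g' x"
      using eq unfolding resolvent_eq_def by blast+
    have "AE x in lborel. z * (T x - T' x) - of_real c * (?D T x - ?D T' x) - (?D U x - ?D U' x) = f x - f' x"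
      using eqs(1,3) by eventually_elim (simp add: algebra_simps)
    moreover have "AE x in lborel. z * (U x - U' x) + of_real (r x) * (?D U x - ?D U' x) - (?D (?W T U) x - ?D (?W T' U') x) +
        of_real (p x) * (T x - T' x) + of_real (q x) * (U x - U' x) = g x - g' x"
      using eqs(2,4)
    proof eventually_elim
      case (elim x)
      show ?case unfolding elim[symmetric] by (simp add: algebra_simps)
    qed
    ultimately show "(AE x in lborel. z * (T x - T' x) - of_real c * (?D T x - ?D T' x) - (?D U x - ?D U' x) = f x - f' x) \<and>
      (AE x in lborel. z * (U x - U' x) + of_real (r x) * (?D U x - ?D U' x) - (?D (?W T U) x - ?D (?W T' U') x) +
        of_real (p x) * (T x - T' x) + of_real (q x) * (U x - U' x) = g x - g' x)" ..
  qed
qed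

text \<open>A nonempty open set is not a null set. This turns uniqueness almost everywhere into the
  pointwise uniqueness required of classical solutions.\<close>

lemma continuous_AE_zero:
  fixes f :: "real \<Rightarrow> complex"
  assumes "continuous_on UNIV f" "AE x in lborel. f x = 0"
  shows "f x = 0"
proof (rule ccontr)
  assume "f x \<noteq> 0"
  let ?S = "f -` (- {0})"
  have "open ?S" using assms(1) by (intro open_vimage) auto
  moreover have "?S \<noteq> {}" using \<open>f x \<noteq> 0\<close> by auto
  ultimately have "\<not> negligible ?S" by (rule open_not_negligible)
  moreover have "?S \<in> null_sets lborel"
    using assms(2) \<open>open ?S\<close> by (subst AE_iff_null_sets) (auto elim!: eventually_mono)
  then have "negligible ?S"
    by (simp add: negligible_iff_null_sets null_sets_completionI)
  ultimately show False by blast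
qed

text \<open>
  With the flux \<open>w = al t + nb Du\<close> as third unknown, the resolvent equation becomes a first order
  system, whose classical solutions are as regular as the data permit.
\<close>

lemma classical_solution_regularity:
  fixes t u w f g :: "real \<Rightarrow> complex"
  assumes X: "X > 0" and c: "c \<noteq> 0" and coefs: "coef X al" "coef X nb" "coef X r" "coef X p" "coef X q"
    and nb: "\<And>x. nb x > 0"
    and d: "d = (\<lambda>x. of_real (1 / nb x) * (w x - of_real (al x) * t x))"
    and t: "\<And>x. (t has_vector_derivative (z * t x - d x - f x) / of_real c - \<i> * of_real \<xi> * t x) (at x)"
    and u: "\<And>x. (u has_vector_derivative d x - \<i> * of_real \<xi> * u x) (at x)"
    and w: "\<And>x. (w has_vector_derivative (z * u x + of_real (r x) * d x + of_real (p x) * t x + of_real (q x) * u x - g x)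
      - \<i> * of_real \<xi> * w x) (at x)"
    and per: "periodic X t" "periodic X u" "periodic X w"
    and fg: "continuous_on UNIV f" "continuous_on UNIV g" "f \<in> H_per X s" "g \<in> H_per X s"
  shows "t \<in> H_per X (Suc s)" "u \<in> H_per X (Suc (Suc s))" "resolvent_eq X c al nb r p q z \<xi> t u f g"
proof -
  let ?t1 = "\<lambda>x. (z * t x - d x - f x) / of_real c"
  let ?w1 = "\<lambda>x. z * u x + of_real (r x) * d x + of_real (p x) * t x + of_real (q x) * u x - g x"
  have nb0: "nb x \<noteq> 0" for x using nb[of x] by simp
  have b: "coef X (\<lambda>x. 1 / nb x)" by (intro coef_divide coef_const coefs nb0)
  have cont: "continuous_on UNIV t" "continuous_on UNIV u" "continuous_on UNIV w"
    using t u w by (meson continuous_at_imp_continuous_on has_vector_derivative_continuous)+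
  note [continuous_intros] = coefD(4)[OF b] coefs[THEN coefD(4)]
  have contd: "continuous_on UNIV d" unfolding d by (intro continuous_intros cont)
  have D: "has_bloch_deriv X \<xi> t ?t1" "has_bloch_deriv X \<xi> u d" "has_bloch_deriv X \<xi> w ?w1"
    unfolding has_bloch_deriv_def
    by (rule has_weak_deriv_classical[OF X t _ per(1)] has_weak_deriv_classical[OF X u _ per(2)]
        has_weak_deriv_classical[OF X w _ per(3)]; intro continuous_intros cont contd fg; use c in simp)+
  \<comment> \<open>Bootstrapping: the system expresses each derivative by undifferentiated unknowns
    and data, so every round gains one order until the regularity \<open>s\<close> of the data is
    used up.\<close>
  have H: "t \<in> H_per X j \<and> u \<in> H_per X j \<and> w \<in> H_per X j" if "j \<le> Suc s" for j
    using that
  proof (induction j)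
    case 0
    then show ?case using cont per by (simp add: L2_periodic_continuous)
  next
    case (Suc j)
    then have IH: "t \<in> H_per X j" "u \<in> H_per X j" "w \<in> H_per X j" by auto
    have fgj: "f \<in> H_per X j" "g \<in> H_per X j" using fg(3,4) Suc.prems by (auto intro: H_per_mono)
    have dj: "d \<in> H_per X j"
      unfolding d by (intro H_per_coef[OF X b] H_per_diff H_per_coef[OF X coefs(1)] IH)
    have "?t1 \<in> H_per X j"
    proof -
      have "(\<lambda>x. (1 / of_real c) * (z * t x - d x - f x)) \<in> H_per X j"
        by (intro H_per_cmult H_per_diff IH dj fgj)
      then show ?thesis by simp
    qed
    moreover have "?w1 \<in> H_per X j"
      by (intro H_per_diff H_per_add H_per_cmult H_per_coef[OF X coefs(3)] H_per_coef[OF X coefs(4)]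
          H_per_coef[OF X coefs(5)] IH dj fgj)
    ultimately show ?case using D IH dj by (blast intro: H_per_SucI_bloch)
  qed
  have Hs: "t \<in> H_per X (Suc s)" "u \<in> H_per X (Suc s)" "w \<in> H_per X (Suc s)" using H[of "Suc s"] by auto
  show tH: "t \<in> H_per X (Suc s)" by (rule Hs)
  \<comment> \<open>The derivative \<open>d\<close> of \<open>u\<close> contains no data, which
    gives \<open>u\<close> one order more than \<open>t\<close> and \<open>w\<close>.\<close>
  have "d \<in> H_per X (Suc s)"
    unfolding d by (intro H_per_coef[OF X b] H_per_diff H_per_coef[OF X coefs(1)] Hs)
  with D(2) Hs(2) show uH: "u \<in> H_per X (Suc (Suc s))" by (rule H_per_SucI_bloch)
  show "resolvent_eq X c al nb r p q z \<xi> t u f g"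
  proof (subst resolvent_eq_iff[OF X coefs(1,2) _ _ D])
    show "t \<in> H_per X (Suc 0)" "u \<in> H_per X (Suc (Suc 0))"
      using tH uH by (auto intro: H_per_mono simp del: H_per.simps)
    show "AE x in lborel. w x = of_real (al x) * t x + of_real (nb x) * d x"
      using nb0 by (intro AE_I2) (simp add: d field_simps)
    show "(AE x in lborel. z * t x - of_real c * ?t1 x - d x = f x) \<and>
        (AE x in lborel. z * u x + of_real (r x) * d x - ?w1 x + of_real (p x) * t x + of_real (q x) * u x = g x)"
      using c by simp
  qed
qed

text \<open>Positive \<open>s\<close> allows the data to be replaced by continuous representatives,
  for which the periodic first order system is solved. Its uniqueness condition comes from
  \<open>uniq\<close>, as classical homogeneous solutions are regular enough to solve the resolvent
  equation with zero data.\<close>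

lemma resolvent_eq_solvable:
  assumes X: "X > 0" and c: "c \<noteq> 0" and coefs: "coef X al" "coef X nb" "coef X r" "coef X p" "coef X q"
    and nb: "\<And>x. nb x > 0"
    and uniq: "\<And>T U. T \<in> H_per X (Suc s) \<Longrightarrow> U \<in> H_per X (Suc (Suc s)) \<Longrightarrow>
      resolvent_eq X c al nb r p q z \<xi> T U (\<lambda>_. 0) (\<lambda>_. 0) \<Longrightarrow>
      (AE x in lborel. T x = 0) \<and> (AE x in lborel. U x = 0)"
    and s: "s > 0" and fg: "f \<in> H_per X s" "g \<in> H_per X s"
  obtains T U where "T \<in> H_per X (Suc s)" "U \<in> H_per X (Suc (Suc s))"
    "resolvent_eq X c al nb r p q z \<xi> T U f g"
proof -
  have rep: "\<exists>F. continuous_on UNIV F \<and> periodic X F \<and> F \<in> H_per X s \<and> (AE x in lborel. f x = F x)"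
    if f: "f \<in> H_per X s" for f
  proof -
    obtain k where "s = Suc k" using s by (cases s) auto
    then obtain f' where "has_weak_deriv X f f'" using f by auto
    then obtain F where F: "continuous_on UNIV F" "periodic X F" "AE x in lborel. f x = F x"
      using has_weak_deriv_continuous_rep[OF X] by metis
    have "F \<in> H_per X s" using F by (intro H_per_cong[OF f]) (auto intro: L2_periodic_continuous)
    with F show ?thesis by blast
  qed
  obtain f0 where f0: "continuous_on UNIV f0" "periodic X f0" "f0 \<in> H_per X s" "AE x in lborel. f x = f0 x"
    using rep[OF fg(1)] by blast
  obtain g0 where g0: "continuous_on UNIV g0" "periodic X g0" "g0 \<in> H_per X s" "AE x in lborel. g x = g0 x"
    using rep[OF fg(2)] by blast
  have nb0: "nb x \<noteq> 0" for x using nb[of x] by simp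
  have b: "coef X (\<lambda>x. 1 / nb x)" by (intro coef_divide coef_const coefs nb0)
  define \<beta> where "\<beta> = (\<lambda>x. complex_of_real (1 / nb x))"
  define A where "A = (\<lambda>x. complex_of_real (al x))"
  \<comment> \<open>The matrix of the system for \<open>(t, u, w)\<close>, row by row, after
    inserting \<open>d = \<beta> * (w - A * t)\<close>. The tenth entry is the value for all indices
    from 9 on, since continuity and periodicity are asked of every \<open>k i\<close>.\<close>
  define k where "k = (\<lambda>i::nat. [
    \<lambda>x. (z + \<beta> x * A x) / of_real c - \<i> * of_real \<xi>, \<lambda>x. 0, \<lambda>x. - \<beta> x / of_real c,
    \<lambda>x. - (\<beta> x * A x), \<lambda>x. - \<i> * of_real \<xi>, \<beta>,
    \<lambda>x. of_real (p x) - of_real (r x) * \<beta> x * A x, \<lambda>x. z + of_real (q x), \<lambda>x. of_real (r x) * \<beta> x - \<i> * of_real \<xi>,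
    \<lambda>x. 0] ! (if i < 9 then i else 9))"
  have "continuous_on UNIV \<beta>" unfolding \<beta>_def by (rule continuous_on_of_real) (rule coefD(4)[OF b])
  moreover have "continuous_on UNIV A" unfolding A_def by (rule continuous_on_of_real) (rule coefD(4)[OF coefs(1)])
  moreover have "periodic X \<beta>" "periodic X A"
    using coefD(3)[OF b] coefD(3)[OF coefs(1)] by (simp_all add: \<beta>_def A_def periodic_def)
  ultimately have cb: "continuous_on UNIV \<beta>" "continuous_on UNIV A" "periodic X \<beta>" "periodic X A" .
  have k: "k 0 = (\<lambda>x. (z + \<beta> x * A x) / of_real c - \<i> * of_real \<xi>)" "k 1 = (\<lambda>x. 0)" "k 2 = (\<lambda>x. - \<beta> x / of_real c)"
    "k 3 = (\<lambda>x. - (\<beta> x * A x))" "k 4 = (\<lambda>x. - \<i> * of_real \<xi>)" "k 5 = \<beta>"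
    "k 6 = (\<lambda>x. of_real (p x) - of_real (r x) * \<beta> x * A x)" "k 7 = (\<lambda>x. z + of_real (q x))"
    "k 8 = (\<lambda>x. of_real (r x) * \<beta> x - \<i> * of_real \<xi>)" and k9: "i \<ge> 9 \<Longrightarrow> k i = (\<lambda>x. 0)" for i
    by (simp_all add: k_def)
  have kP: "P (k i)" if "P (k 0)" "P (k 1)" "P (k 2)" "P (k 3)" "P (k 4)" "P (k 5)" "P (k 6)" "P (k 7)" "P (k 8)" "P (\<lambda>x. 0)" for P i
  proof (cases "i \<ge> 9")
    case False
    then have "i \<in> {0, 1, 2, 3, 4, 5, 6, 7, 8}" by auto
    with that show ?thesis by auto
  qed (use that k9 in auto)
  have kc: "continuous_on UNIV (k i)" for i
    by (rule kP[of "continuous_on UNIV"]; (unfold k)?; (intro continuous_intros cb coefs[THEN coefD(4)])?; use c in simp)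
  have kp: "periodic X (k i)" for i
    by (rule kP[of "periodic X"]; (unfold k)?; use cb(3,4) coefs(3,4,5) in \<open>simp add: coef_def periodic_def\<close>)
  let ?d = "\<lambda>t w x. complex_of_real (1 / nb x) * (w x - complex_of_real (al x) * t x)"
  have ba: "complex_of_real (1 / nb x) = \<beta> x" "complex_of_real (al x) = A x" for x
    by (simp_all only: \<beta>_def A_def)
  have rhs: "k 0 x * t x + k 1 x * u x + k 2 x * w x + - h / of_real c =
      (z * t x - ?d t w x - h) / of_real c - \<i> * of_real \<xi> * t x"
    "k 3 x * t x + k 4 x * u x + k 5 x * w x + 0 = ?d t w x - \<i> * of_real \<xi> * u x"
    "k 6 x * t x + k 7 x * u x + k 8 x * w x + - h =
      (z * u x + of_real (r x) * ?d t w x + of_real (p x) * t x + of_real (q x) * u x - h) - \<i> * of_real \<xi> * w x"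
    for t u w :: "real \<Rightarrow> complex" and h x
    unfolding k ba by (simp_all add: add_divide_distrib diff_divide_distrib algebra_simps)
  have hom_rhs: "k 0 x * t x + k 1 x * u x + k 2 x * w x = (z * t x - ?d t w x - 0) / of_real c - \<i> * of_real \<xi> * t x"
    "k 3 x * t x + k 4 x * u x + k 5 x * w x = ?d t w x - \<i> * of_real \<xi> * u x"
    "k 6 x * t x + k 7 x * u x + k 8 x * w x =
      (z * u x + of_real (r x) * ?d t w x + of_real (p x) * t x + of_real (q x) * u x - 0) - \<i> * of_real \<xi> * w x"
    for t u w :: "real \<Rightarrow> complex" and x
    unfolding k ba by (simp_all add: add_divide_distrib diff_divide_distrib algebra_simps)
  obtain t u w where sol:
    "\<And>x. (t has_vector_derivative k 0 x * t x + k 1 x * u x + k 2 x * w x + - f0 x / of_real c) (at x)"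
    "\<And>x. (u has_vector_derivative k 3 x * t x + k 4 x * u x + k 5 x * w x + 0) (at x)"
    "\<And>x. (w has_vector_derivative k 6 x * t x + k 7 x * u x + k 8 x * w x + - g0 x) (at x)"
    "periodic X t" "periodic X u" "periodic X w"
  proof (rule periodic_linear_system_exists[OF X kc kp])
    show "continuous_on UNIV (\<lambda>x. - f0 x / of_real c)" "continuous_on UNIV (\<lambda>x. 0 :: complex)" "continuous_on UNIV (\<lambda>x. - g0 x)"
      using c by (auto intro!: continuous_intros f0 g0)
    show "periodic X (\<lambda>x. - f0 x / of_real c)" "periodic X (\<lambda>x. 0 :: complex)" "periodic X (\<lambda>x. - g0 x)"
      using f0(2) g0(2) by (simp_all add: periodic_def)
    fix t u w x
    assume hom: "\<And>x. (t has_vector_derivative k 0 x * t x + k 1 x * u x + k 2 x * w x) (at x)"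
      "\<And>x. (u has_vector_derivative k 3 x * t x + k 4 x * u x + k 5 x * w x) (at x)"
      "\<And>x. (w has_vector_derivative k 6 x * t x + k 7 x * u x + k 8 x * w x) (at x)"
      and per: "periodic X t" "periodic X u" "periodic X w"
    note hom' = hom[unfolded hom_rhs]
    note reg = classical_solution_regularity[OF X c coefs nb refl hom' per, where s = s, OF continuous_on_const continuous_on_const H_per_zero H_per_zero]
    have ae: "AE x in lborel. t x = 0" "AE x in lborel. u x = 0" using uniq[OF reg] by auto
    have cont: "continuous_on UNIV t" "continuous_on UNIV u"
      using hom by (meson continuous_at_imp_continuous_on has_vector_derivative_continuous)+
    have t0: "t x = 0" and u0: "u x = 0" for x using continuous_AE_zero cont ae by blast+
    \<comment> \<open>\<open>uniq\<close> speaks only of \<open>t\<close> and \<open>u\<close>. From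
      \<open>u = 0\<close> it follows that \<open>d = 0\<close>, and with \<open>t = 0\<close> this
      gives \<open>w = 0\<close>.\<close>
    have "u = (\<lambda>_. 0)" using u0 by auto
    then have "(u has_vector_derivative 0) (at x)" by simp
    with hom'(2)[of x] have "?d t w x - \<i> * of_real \<xi> * u x = 0" by (rule vector_derivative_unique_at)
    then have "w x = 0" using nb0[of x] by (simp add: t0 u0)
    with t0 u0 show "t x = 0 \<and> u x = 0 \<and> w x = 0" by simp
  qed blast
  note sol' = sol(1-3)[unfolded rhs]
  note reg = classical_solution_regularity[OF X c coefs nb refl sol' sol(4-6) f0(1) g0(1) f0(3) g0(3)]
  have "resolvent_eq X c al nb r p q z \<xi> t u f g"
    unfolding resolvent_eq_def
  proof
    show "AE x in lborel. z * t x - of_real c * bloch_deriv X \<xi> t x - bloch_deriv X \<xi> u x = f x"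
      using f0(4) conjunct1[OF reg(3)[unfolded resolvent_eq_def]] by eventually_elim simp
    show "AE x in lborel. z * u x + of_real (r x) * bloch_deriv X \<xi> u x
        - bloch_deriv X \<xi> (\<lambda>x. of_real (al x) * t x + of_real (nb x) * bloch_deriv X \<xi> u x) x
        + of_real (p x) * t x + of_real (q x) * u x = g x"
      using g0(4) conjunct2[OF reg(3)[unfolded resolvent_eq_def]] by eventually_elim simp
  qed
  with reg(1,2) that show thesis by blast
qed

section \<open>The profile\<close>

lemma periodic_attains_extrema:
  fixes f :: "real \<Rightarrow> real"
  assumes "continuous_on UNIV f" "periodic X f" "X > 0"
  obtains a b where "\<And>x. f a \<le> f x" "\<And>x. f x \<le> f b"
proof -
  have cont: "continuous_on {0..X} f" and ne: "{0..X} \<noteq> {}"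
    using assms continuous_on_subset by auto
  obtain a where a: "\<And>x. x \<in> {0..X} \<Longrightarrow> f a \<le> f x"
    using continuous_attains_inf[OF compact_Icc ne cont] by blast
  obtain b where b: "\<And>x. x \<in> {0..X} \<Longrightarrow> f x \<le> f b"
    using continuous_attains_sup[OF compact_Icc ne cont] by blast
  have "f a \<le> f x \<and> f x \<le> f b" for x
  proof -
    obtain y where "0 \<le> y" "y < X" "f x = f y" using periodic_reduce[OF assms(2,3), of x] by blast
    then show ?thesis using a[of y] b[of y] by simp
  qed
  with that show thesis by blast
qed

text \<open>
  For \<open>c = 0\<close> the velocity is constant, and the momentum equation forces \<open>\<tau> u\<^sup>2 = 1\<close> at both
  extrema of \<open>\<tau>\<close>.
\<close>

lemma profile_speed_nonzero:
  assumes prof: "st_venant_profile F \<nu> c \<Xi> \<tau>b ub"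
  shows "c \<noteq> 0"
proof
  assume c: "c = 0"
  note P = prof[unfolded st_venant_profile_def]
  have sm: "smooth \<tau>b" "smooth ub" and \<tau>0: "\<And>x. \<tau>b x > 0" and X: "\<Xi> > 0" and per: "periodic \<Xi> \<tau>b"
    using P by blast+
  have du: "deriv ub x = 0" for x using P c by simp
  have u_const: "ub x = ub 0" for x
    using zero_deriv_const[of ub x 0] smooth_real_deriv(2)[OF sm(2)] du
    by (simp add: real_vector_deriv)
  have mom: "deriv (\<lambda>y. 1 / (2 * F\<^sup>2) * (1 / (\<tau>b y)\<^sup>2)) x = 1 - \<tau>b x * (ub 0)\<^sup>2" for x
    using P c du u_const[of x] by simp
  have crit: "\<tau>b x * (ub 0)\<^sup>2 = 1" if "deriv \<tau>b x = 0" for x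
  proof -
    have "((\<lambda>y. 1 / (\<tau>b y)\<^sup>2) has_real_derivative 0) (at x)"
      using smooth_real_deriv(2)[OF sm(1), of x] that \<tau>0[of x]
      by (auto intro!: derivative_eq_intros)
    from DERIV_cmult[OF this, of "1 / (2 * F\<^sup>2)"]
    have "((\<lambda>y. 1 / (2 * F\<^sup>2) * (1 / (\<tau>b y)\<^sup>2)) has_real_derivative 0) (at x)" by simp
    then have "deriv (\<lambda>y. 1 / (2 * F\<^sup>2) * (1 / (\<tau>b y)\<^sup>2)) x = 0" by (rule DERIV_imp_deriv)
    with mom[of x] show ?thesis by simp
  qed
  obtain a b where ab: "\<And>x. \<tau>b a \<le> \<tau>b x" "\<And>x. \<tau>b x \<le> \<tau>b b"
    using periodic_attains_extrema[OF smooth_continuous_on[OF sm(1)] per X] by blast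
  have "deriv \<tau>b a = 0"
    using DERIV_local_min[OF smooth_real_deriv(2)[OF sm(1), of a], of 1] ab(1) by simp
  moreover have "deriv \<tau>b b = 0"
    using DERIV_local_max[OF smooth_real_deriv(2)[OF sm(1), of b], of 1] ab(2) by simp
  \<comment> \<open>The value 1 in \<open>crit\<close> excludes \<open>ub 0 = 0\<close>, so the
    factor cancels and the minimum of \<open>\<tau>b\<close> equals its maximum.\<close>
  ultimately have "\<tau>b a * (ub 0)\<^sup>2 = \<tau>b b * (ub 0)\<^sup>2" "(ub 0)\<^sup>2 \<noteq> 0" using crit[of a] crit[of b] by auto
  then have "\<tau>b a = \<tau>b b" by simp
  then have "\<tau>b x = \<tau>b a" for x using ab[of x] by simp
  then have "\<forall>x. \<tau>b x = \<tau>b a \<and> ub x = ub 0" using u_const by blast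
  then show False using P by blast
qed

text \<open>
  Here \<open>al / nb = (1 / F\<^sup>2 - 2 \<nu> u') / (\<nu> \<tau>)\<close>, and \<open>u' / \<tau> = - c (ln \<tau>)'\<close> has mean zero, so the mean
  of \<open>al / nb\<close> is that of \<open>1 / (\<nu> F\<^sup>2 \<tau>)\<close>, which is positive.
\<close>

lemma damping_weight_exists:
  assumes F: "F > 0" "\<nu> > 0" and prof: "st_venant_profile F \<nu> c \<Xi> \<tau>b ub" and c: "c \<noteq> 0"
  obtains \<psi> m where "coef \<Xi> \<psi>" "\<And>x. \<psi> x > 0" "m > 0"
    "\<And>x. c / 2 * deriv \<psi> x + alpha F \<nu> \<tau>b ub x / (\<nu> / (\<tau>b x)\<^sup>2) * \<psi> x = m * \<psi> x"
proof -
  note P = prof[unfolded st_venant_profile_def]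
  have \<tau>: "coef \<Xi> \<tau>b" and \<tau>0: "\<And>x. \<tau>b x > 0" and X: "\<Xi> > 0" using P by (auto simp: coef_def)
  have \<tau>nz: "\<tau>b x \<noteq> 0" for x using \<tau>0[of x] by simp
  have du: "deriv ub x = - c * deriv \<tau>b x" for x
  proof -
    have "- c * deriv \<tau>b x - deriv ub x = 0" using P by blast
    then show ?thesis by linarith
  qed
  have inv: "coef \<Xi> (\<lambda>x. 1 / \<tau>b x)" by (intro coef_divide coef_const \<tau> \<tau>nz)
  obtain B where B: "B 0 = 0" "\<And>x. (B has_vector_derivative 1 / \<tau>b x) (at x)"
    using antiderivative_on_line[OF coefD(4)[OF inv]] by blast
  have dB: "(B has_real_derivative 1 / \<tau>b x) (at x)" for x
    using B(2) by (simp add: real_vector_deriv)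
  have "B 0 < B \<Xi>"
    using dB \<tau>0 by (intro DERIV_pos_imp_increasing[OF X]) (metis divide_pos_pos zero_less_one)
  \<comment> \<open>As \<open>B\<close> is a primitive of \<open>1 / \<tau>b\<close>, this is the
    mean of \<open>1 / (\<nu> * F^2 * \<tau>b)\<close>; \<open>G\<close> is then a primitive of the
    deviation from the mean, hence periodic.\<close>
  define m where "m = B \<Xi> / (\<nu> * F\<^sup>2 * \<Xi>)"
  have m: "m > 0" using \<open>B 0 < B \<Xi>\<close> B(1) F X by (simp add: m_def)
  define G where "G = (\<lambda>x. B x / (\<nu> * F\<^sup>2) - m * x)"
  \<comment> \<open>The equation for the weight reads
    \<open>\<psi>' / \<psi> = - (2 / c) * G' - 4 * \<tau>b' / \<tau>b\<close>, because the mean-zero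
    part \<open>2 * c * \<tau>b' / \<tau>b\<close> of the damping coefficient is a logarithmic
    derivative. Integration gives the exponential and the fourth power.\<close>
  define \<psi> where "\<psi> = (\<lambda>x. exp (- (2 / c) * G x) / (\<tau>b x) ^ 4)"
  have dG: "(G has_real_derivative 1 / (\<nu> * F\<^sup>2 * \<tau>b x) - m) (at x)" for x
  proof -
    have "(G has_real_derivative (1 / \<tau>b x) / (\<nu> * F\<^sup>2) - m) (at x)"
      unfolding G_def by (intro DERIV_diff DERIV_cdivide dB DERIV_cmult_Id)
    then show ?thesis by (simp add: mult_ac)
  qed
  have Bshift: "B (x + \<Xi>) = B x + B \<Xi>" for x
  proof -
    have "((\<lambda>x. B (x + \<Xi>) - B x) has_vector_derivative 0) (at x)" for x
    proof -
      have "((\<lambda>x. B (x + \<Xi>)) has_vector_derivative 1 / \<tau>b (x + \<Xi>)) (at x)"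
        using vector_diff_chain_at[of "\<lambda>x. x + \<Xi>" 1 x B "1 / \<tau>b (x + \<Xi>)"] B(2)
        by (simp add: o_def has_vector_derivative_add_const)
      from has_vector_derivative_diff[OF this B(2)] show ?thesis using coefD(3)[OF \<tau>] by simp
    qed
    from zero_deriv_const[OF this, of x 0] B(1) show ?thesis by simp
  qed
  have "G (x + \<Xi>) = G x" for x
    using F X by (simp add: G_def Bshift m_def add_divide_distrib distrib_left)
  moreover have "smooth G"
    by (rule smoothI_deriv[of "\<lambda>x. 1 / (\<nu> * F\<^sup>2 * \<tau>b x) - m"])
      (use F \<tau>nz \<tau> dG in \<open>auto intro!: smooth_diff smooth_divide smooth_mult simp: real_vector_deriv coef_def\<close>)
  ultimately have "coef \<Xi> \<psi>"
    unfolding \<psi>_def using \<tau>nz coefD(1,3)[OF \<tau>]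
    by (intro coefI smooth_divide smooth_exp smooth_mult smooth_const smooth_power) auto
  moreover have \<psi>0: "\<psi> x > 0" for x unfolding \<psi>_def by (intro divide_pos_pos exp_gt_zero zero_less_power \<tau>0)
  moreover have "c / 2 * deriv \<psi> x + alpha F \<nu> \<tau>b ub x / (\<nu> / (\<tau>b x)\<^sup>2) * \<psi> x = m * \<psi> x" for x
  proof -
    let ?g = "1 / (\<nu> * F\<^sup>2 * \<tau>b x) - m" and ?E = "exp (- (2 / c) * G x)"
    have "(\<psi> has_real_derivative ((?E * (- (2 / c) * ?g)) * (\<tau>b x) ^ 4 - ?E * (4 * (\<tau>b x) ^ 3 * deriv \<tau>b x)) /
        ((\<tau>b x) ^ 4 * (\<tau>b x) ^ 4)) (at x)"
      unfolding \<psi>_def using c \<tau>nz[of x] dG[of x] coefD(5)[OF \<tau>, of x]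
      by (auto intro!: derivative_eq_intros)
    then have "deriv \<psi> x = ((?E * (- (2 / c) * ?g)) * (\<tau>b x) ^ 4 - ?E * (4 * (\<tau>b x) ^ 3 * deriv \<tau>b x)) /
        ((\<tau>b x) ^ 4 * (\<tau>b x) ^ 4)" by (rule DERIV_imp_deriv)
    also have "\<dots> = \<psi> x * (- (2 / c) * ?g - 4 * deriv \<tau>b x / \<tau>b x)"
      using \<tau>nz[of x] by (simp add: \<psi>_def divide_simps power_numeral_reduce) (simp add: algebra_simps)
    finally have d\<psi>: "deriv \<psi> x = \<dots>" .
    have a: "alpha F \<nu> \<tau>b ub x / (\<nu> / (\<tau>b x)\<^sup>2) = 1 / (\<nu> * F\<^sup>2 * \<tau>b x) + 2 * c * deriv \<tau>b x / \<tau>b x"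
      using \<tau>nz[of x] F by (simp add: alpha_def du divide_simps power_numeral_reduce)
    show ?thesis unfolding d\<psi> a using c by (simp add: field_simps)
  qed
  ultimately show thesis using that m by blast
qed

section \<open>Bloch spectrum and resolvent\<close>

lemma state_norm_le_H_norm: "state_norm X \<xi> s U \<le> H_norm X \<xi> s (fst U) + H_norm X \<xi> s (snd U)"
proof -
  let ?a = "\<lambda>k. L2_norm X ((bloch_deriv X \<xi> ^^ k) (fst U))" and ?b = "\<lambda>k. L2_norm X ((bloch_deriv X \<xi> ^^ k) (snd U))"
  have "state_norm X \<xi> s U = L2_set (\<lambda>k. sqrt ((?a k)\<^sup>2 + (?b k)\<^sup>2)) {..s}"
    by (simp add: state_norm_def L2_set_def)
  also have "\<dots> \<le> (\<Sum>k\<le>s. sqrt ((?a k)\<^sup>2 + (?b k)\<^sup>2))" by (rule L2_set_le_sum) simp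
  also have "\<dots> \<le> (\<Sum>k\<le>s. ?a k + ?b k)"
    by (intro sum_mono sqrt_sum_squares_le_sum) simp_all
  finally show ?thesis by (simp add: H_norm_eq_sum sum.distrib)
qed

text \<open>The left side has \<open>2 * (s + 1)\<close> summands, and each is at most
  \<open>state_norm\<close>.\<close>

lemma H_norm_le_state_norm:
  "H_norm X \<xi> s (fst U) + H_norm X \<xi> s (snd U) \<le> 2 * real (Suc s) * state_norm X \<xi> s U"
proof -
  let ?a = "\<lambda>k. L2_norm X ((bloch_deriv X \<xi> ^^ k) (fst U))" and ?b = "\<lambda>k. L2_norm X ((bloch_deriv X \<xi> ^^ k) (snd U))"
  have *: "(?a k)\<^sup>2 + (?b k)\<^sup>2 \<le> (\<Sum>k\<le>s. (?a k)\<^sup>2 + (?b k)\<^sup>2)" if "k \<le> s" for k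
    using that by (intro member_le_sum[of k "{..s}" "\<lambda>k. (?a k)\<^sup>2 + (?b k)\<^sup>2"]) auto
  have "?a k \<le> state_norm X \<xi> s U" "?b k \<le> state_norm X \<xi> s U" if "k \<le> s" for k
    using *[OF that] unfolding state_norm_def by (auto intro!: real_le_rsqrt elim: order_trans[rotated])
  then have "(\<Sum>k\<le>s. ?a k + ?b k) \<le> (\<Sum>k\<le>s. 2 * state_norm X \<xi> s U)"
    by (intro sum_mono) (metis add_mono atMost_iff mult_2)
  then show ?thesis by (simp add: H_norm_eq_sum sum.distrib algebra_simps)
qed

lemma profile_coefs:
  assumes "\<nu> > 0" and prof: "st_venant_profile F \<nu> c \<Xi> \<tau>b ub"
  shows "\<Xi> > 0" "coef \<Xi> \<tau>b" "coef \<Xi> ub" "coef \<Xi> (alpha F \<nu> \<tau>b ub)"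
    "coef \<Xi> (\<lambda>x. k / (\<tau>b x)\<^sup>2)" "\<nu> / (\<tau>b x)\<^sup>2 > 0"
proof -
  note P = prof[unfolded st_venant_profile_def]
  show \<tau>: "\<Xi> > 0" "coef \<Xi> \<tau>b" "coef \<Xi> ub" using P by (auto simp: coef_def)
  have "\<tau>b x > 0" for x using P by blast
  then have \<tau>nz: "\<tau>b x \<noteq> 0" for x by (simp add: less_imp_neq[symmetric])
  show "coef \<Xi> (alpha F \<nu> \<tau>b ub)" unfolding alpha_def using \<tau>nz
    by (intro coef_divide coef_diff coef_mult coef_const coef_deriv coef_power \<tau>) auto
  show "coef \<Xi> (\<lambda>x. k / (\<tau>b x)\<^sup>2)" using \<tau>nz by (intro coef_divide coef_const coef_power \<tau>) auto
  show "\<nu> / (\<tau>b x)\<^sup>2 > 0" using assms(1) \<tau>nz by simp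
qed

text \<open>\<open>bloch_op\<close> differentiates the two parts of the flux separately,
  \<open>resolvent_eq\<close> differentiates their sum. Both parts have a weak derivative under the
  stated regularity, so the results agree almost everywhere. The signs of \<open>r\<close>,
  \<open>p\<close>, \<open>q\<close> are those of \<open>z\<close> minus the operator.\<close>

lemma bloch_op_resolvent_eq:
  assumes \<nu>: "\<nu> > 0" and prof: "st_venant_profile F \<nu> c \<Xi> \<tau>b ub"
    and H: "T \<in> H_per \<Xi> (Suc 0)" "U \<in> H_per \<Xi> (Suc (Suc 0))"
  shows "state_eq (shifted_op (bloch_op F \<nu> c \<Xi> \<tau>b ub \<xi>) z (T, U)) (f, g) \<longleftrightarrow>
    resolvent_eq \<Xi> c (alpha F \<nu> \<tau>b ub) (\<lambda>x. \<nu> / (\<tau>b x)\<^sup>2) (\<lambda>_. - c) (\<lambda>x. (ub x)\<^sup>2) (\<lambda>x. 2 * ub x * \<tau>b x) z \<xi> T U f g"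
proof -
  let ?D = "bloch_deriv \<Xi> \<xi>"
  note X = profile_coefs(1)[OF \<nu> prof] and al = profile_coefs(4)[OF \<nu> prof] and b = profile_coefs(5)[OF \<nu> prof]
  let ?A = "\<lambda>x. of_real (alpha F \<nu> \<tau>b ub x) * T x" and ?B = "\<lambda>x. of_real (1 / (\<tau>b x)\<^sup>2) * ?D U x"
  have HW: "?A \<in> H_per \<Xi> (Suc 0)" "?B \<in> H_per \<Xi> (Suc 0)"
    by (intro H_per_coef[OF X al H(1)]) (intro H_per_coef[OF X b] bloch_deriv_H_per[OF H(2) X])
  note D = H(1,2)[THEN bloch_derivI, of \<xi>] HW[THEN bloch_derivI, of \<xi>]
  note iff = resolvent_eq_iff[OF X al b H D(1,2) has_bloch_deriv_add[OF D(3) has_bloch_deriv_cmult[OF D(4), of "of_real \<nu>"]]]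
  show ?thesis
    by (subst iff) (simp_all add: state_eq_def shifted_op_def bloch_op_def Let_def AE_conj_iff algebra_simps)
qed

theorem proposition4p1:
  fixes F \<nu> c \<Xi> :: real and \<tau>b ub :: "real \<Rightarrow> real" and s :: nat
  assumes "F > 0" and "\<nu> > 0"
    and "st_venant_profile F \<nu> c \<Xi> \<tau>b ub"
    and "s > 0"
  shows "\<exists>\<eta> C R :: real. \<eta> > 0 \<and> C > 0 \<and> R > 0 \<and>
    (\<forall>z :: complex. cmod z \<ge> R \<and> Re z \<ge> - \<eta> \<longrightarrow>
      (\<forall>\<xi> \<in> {- pi / \<Xi> ..< pi / \<Xi>}.
         z \<notin> bloch_spectrum F \<nu> c \<Xi> \<tau>b ub s \<xi> \<and>
         op_norm (state_space \<Xi> s) (state_norm \<Xi> \<xi> s)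
           (bloch_resolvent F \<nu> c \<Xi> \<tau>b ub s \<xi> z) \<le> ereal C))"
proof -
  note prof = assms(3)
  note coefs = profile_coefs[OF assms(2) prof]
  note X = coefs(1) and \<tau> = coefs(2,3) and al = coefs(4) and nb = coefs(5)[of \<nu>] and nb0 = coefs(6)
  have c: "c \<noteq> 0" by (rule profile_speed_nonzero[OF prof])
  let ?al = "alpha F \<nu> \<tau>b ub" and ?nb = "\<lambda>x. \<nu> / (\<tau>b x)\<^sup>2" and ?r = "\<lambda>_::real. - c"
    and ?p = "\<lambda>x. (ub x)\<^sup>2" and ?q = "\<lambda>x. 2 * ub x * \<tau>b x"
  have rpq: "coef \<Xi> ?r" "coef \<Xi> ?p" "coef \<Xi> ?q" by (intro coef_const coef_power coef_mult \<tau>)+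
  obtain \<psi> m where \<psi>: "coef \<Xi> \<psi>" "\<And>x. \<psi> x > 0" "m > 0"
    "\<And>x. c / 2 * deriv \<psi> x + ?al x / ?nb x * \<psi> x = m * \<psi> x"
    using damping_weight_exists[OF assms(1-3) c] by blast
  obtain C R where C: "C > 0" "R > 0" "resolvent_bound \<Xi> c ?al ?nb ?r ?p ?q m s C R"
    using sobolev_resolvent_estimate[OF X al nb nb0 \<psi> rpq] by blast
  \<comment> \<open>The factor \<open>2 * (s + 1)\<close> is lost on bounding the
    \<open>H_norm\<close> of the data by \<open>state_norm\<close>; the opposite comparison, used
    for the solution, has constant 1.\<close>
  define C' where "C' = 2 * real (Suc s) * C"
  have C': "C' > 0" using C(1) by (simp add: C'_def)
  have main: "z \<notin> bloch_spectrum F \<nu> c \<Xi> \<tau>b ub s \<xi> \<and>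
      op_norm (state_space \<Xi> s) (state_norm \<Xi> \<xi> s) (bloch_resolvent F \<nu> c \<Xi> \<tau>b ub s \<xi> z) \<le> ereal C'"
    if z: "cmod z \<ge> R" "Re z \<ge> - (m / 2)" for z \<xi>
  proof -
    let ?eq = "resolvent_eq \<Xi> c ?al ?nb ?r ?p ?q z \<xi>"
    let ?L = "shifted_op (bloch_op F \<nu> c \<Xi> \<tau>b ub \<xi>) z" and ?N = "state_norm \<Xi> \<xi> s"
    have bound: "H_norm \<Xi> \<xi> s T + H_norm \<Xi> \<xi> s U \<le> C * (H_norm \<Xi> \<xi> s f + H_norm \<Xi> \<xi> s g)"
      if "T \<in> H_per \<Xi> (Suc s)" "U \<in> H_per \<Xi> (Suc (Suc s))" "f \<in> H_per \<Xi> s" "g \<in> H_per \<Xi> s" "?eq T U f g" for T U f g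
      using C(3) z that unfolding resolvent_bound_def by simp
    \<comment> \<open>The estimate with zero data. It serves twice: for injectivity and, through the
      Fredholm alternative, for surjectivity.\<close>
    have uniq: "(AE x in lborel. T x = 0) \<and> (AE x in lborel. U x = 0)"
      if TU: "T \<in> H_per \<Xi> (Suc s)" "U \<in> H_per \<Xi> (Suc (Suc s))" and eq: "?eq T U (\<lambda>_. 0) (\<lambda>_. 0)" for T U
    proof -
      have "H_norm \<Xi> \<xi> s T + H_norm \<Xi> \<xi> s U \<le> 0"
        using bound[OF TU H_per_zero H_per_zero eq] by (simp add: H_norm_zero[OF X])
      then have "H_norm \<Xi> \<xi> s T = 0" "H_norm \<Xi> \<xi> s U = 0"
        using H_norm_nonneg[of \<Xi> \<xi> s T] H_norm_nonneg[of \<Xi> \<xi> s U] by linarith+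
      then show ?thesis using H_norm_zeroD[OF _ X] TU[THEN H_per_L2] by blast
    qed
    have dom: "U \<in> bloch_dom \<Xi> s \<longleftrightarrow> fst U \<in> H_per \<Xi> (Suc s) \<and> snd U \<in> H_per \<Xi> (Suc (Suc s))" for U
      by (simp add: bloch_dom_def mem_Times_iff del: H_per.simps)
    have low: "fst U \<in> H_per \<Xi> (Suc 0)" "snd U \<in> H_per \<Xi> (Suc (Suc 0))" if "U \<in> bloch_dom \<Xi> s" for U
      using that unfolding dom by (auto intro: H_per_mono simp del: H_per.simps)
    have eq_iff: "state_eq (?L U) V \<longleftrightarrow> ?eq (fst U) (snd U) (fst V) (snd V)" if "U \<in> bloch_dom \<Xi> s" for U V
      using bloch_op_resolvent_eq[OF assms(2) prof low[OF that], of \<xi> z "fst V" "snd V"] by simp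
    have inj: "state_eq U U'" if U: "U \<in> bloch_dom \<Xi> s" "U' \<in> bloch_dom \<Xi> s" and LU: "state_eq (?L U) (?L U')" for U U'
    proof -
      have "state_eq (?L U') (?L U')" by (simp add: state_eq_def)
      with LU have "?eq (fst U) (snd U) (fst (?L U')) (snd (?L U'))" "?eq (fst U') (snd U') (fst (?L U')) (snd (?L U'))"
        using eq_iff U by blast+
      from resolvent_eq_diff[OF X al nb low(1)[OF U(1)] low(2)[OF U(1)] low(1)[OF U(2)] low(2)[OF U(2)] this]
      have "(AE x in lborel. fst U x - fst U' x = 0) \<and> (AE x in lborel. snd U x - snd U' x = 0)"
        using U unfolding dom by (intro uniq H_per_diff) auto
      then show ?thesis by (simp add: state_eq_def AE_conj_iff)
    qed
    have surj: "\<exists>U\<in>bloch_dom \<Xi> s. state_eq (?L U) V" if "V \<in> state_space \<Xi> s" for V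
    proof -
      from that have V: "fst V \<in> H_per \<Xi> s" "snd V \<in> H_per \<Xi> s" by (auto simp: state_space_def)
      obtain T U where "T \<in> H_per \<Xi> (Suc s)" "U \<in> H_per \<Xi> (Suc (Suc s))" "?eq T U (fst V) (snd V)"
        using resolvent_eq_solvable[OF X c al nb rpq nb0 uniq assms(4) V] by blast
      then have "(T, U) \<in> bloch_dom \<Xi> s" "state_eq (?L (T, U)) V" using eq_iff dom by simp_all
      then show ?thesis by blast
    qed
    define S where "S = bloch_resolvent F \<nu> c \<Xi> \<tau>b ub s \<xi> z"
    \<comment> \<open>The resolvent is a \<open>SOME\<close> choice. Surjectivity guarantees that
      the chosen state solves the equation, so the estimate applies whichever representative was
      chosen.\<close>
    have S: "S V \<in> bloch_dom \<Xi> s" "state_eq (?L (S V)) V" if "V \<in> state_space \<Xi> s" for V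
      using someI_ex[of "\<lambda>U. U \<in> bloch_dom \<Xi> s \<and> state_eq (?L U) V"] surj[OF that]
      unfolding S_def bloch_resolvent_def resolvent_op_def by blast+
    have SN: "?N (S V) \<le> C' * ?N V" if V: "V \<in> state_space \<Xi> s" for V
    proof -
      have "?N (S V) \<le> H_norm \<Xi> \<xi> s (fst (S V)) + H_norm \<Xi> \<xi> s (snd (S V))" by (rule state_norm_le_H_norm)
      also have "\<dots> \<le> C * (H_norm \<Xi> \<xi> s (fst V) + H_norm \<Xi> \<xi> s (snd V))"
        using V S[OF V] by (intro bound) (auto simp: dom eq_iff state_space_def)
      also have "\<dots> \<le> C * (2 * real (Suc s) * ?N V)"
        using C(1) by (intro mult_left_mono H_norm_le_state_norm) simp
      finally show ?thesis by (simp add: C'_def mult_ac)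
    qed
    have norm: "op_norm (state_space \<Xi> s) ?N S \<le> ereal C'"
      unfolding op_norm_def
    proof (rule SUP_least)
      fix V assume "V \<in> {V \<in> state_space \<Xi> s. ?N V \<le> 1}"
      then have "?N (S V) \<le> C' * ?N V" "C' * ?N V \<le> C'" using SN C' by (simp_all add: mult_left_le)
      then show "ereal (?N (S V)) \<le> ereal C'" by simp
    qed
    then have "op_norm (state_space \<Xi> s) ?N S < \<infinity>" by (rule order_le_less_trans) simp
    then have "z \<in> resolvent_set (state_space \<Xi> s) ?N (bloch_dom \<Xi> s) (bloch_op F \<nu> c \<Xi> \<tau>b ub \<xi>)"
      using inj surj unfolding resolvent_set_def S_def bloch_resolvent_def by blast
    with norm show ?thesis by (simp add: bloch_spectrum_def spectrum_def S_def)
  qed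
  show ?thesis
    by (intro exI[of _ "m / 2"] exI[of _ C'] exI[of _ R]) (use \<psi>(3) C' C(2) main in auto)
qed

end
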